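(* For all $p\in\mathbb{N}$ and $\gamma>0$ the quantity $\mu(p,\gamma)$ is finite. Equivalently, $\lim_{N\to\infty}C_N\,r(p,\gamma)^N>0$.
   Context: Setting. Let $R,\ell>0$, $p\in\mathbb{N}$ and $\gamma=\ell/R$. $\mathcal{Z}=\mathbb{R}\times[0,2\pi R]$, with $z=x+iy$. Laughlin's function. $$\Psi_N(z_1,\ldots,z_N)=\kappa_N\prod_{1\le j<k\le N}\bigl(e^{z_k/R}-e^{z_j/R}\bigr)^p\exp\Bigl(-\frac{1}{2\ell^2}\sum_k x_k^2\Bigr),$$ with the specific normalization $$\kappa_N=\frac{1}{\sqrt{N!}}\,\bigl(2\pi R\ell\sqrt\pi\bigr)^{-N/2}\exp\Bigl(-\tfrac12p^2\gamma^2\sum_{j=1}^N(j-1)^2\Bigr).$$ Normalization constants. $C_N=\|\Psi_N\|^2=\int_{\mathcal{Z}^N}|\Psi_N|^2$. Known facts (from earlier work). The limits $$\lim_{N\to\infty}\frac1N\ln C_N=:-\log r(p,\gamma)\qquad\text{and}\qquad \lim_{N\to\infty}C_N\,r(p,\gamma)^N=:\mu(p,\gamma)^{-1}$$ exist, with $0<r(p,\gamma)\le1$ and $0<\mu(p,\gamma)\le\infty$. *)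

theory Defs
  imports "HOL-Analysis.Analysis"
begin

definition cyl :: "real \<Rightarrow> complex set" where
  "cyl R = {z. 0 \<le> Im z \<and> Im z \<le> 2 * pi * R}"

text \<open>Normalization constant kappa_N (particles indexed 0..N-1, so (j-1) becomes j).\<close>
definition kappa :: "real \<Rightarrow> real \<Rightarrow> nat \<Rightarrow> nat \<Rightarrow> real" where
  "kappa R l p N = (1 / sqrt (fact N)) * (2 * pi * R * l * sqrt pi) powr (- real N / 2)
      * exp (- (1/2) * (real p)^2 * (l / R)^2 * (\<Sum>j<N. (real j)^2))"

definition laughlin :: "real \<Rightarrow> real \<Rightarrow> nat \<Rightarrow> nat \<Rightarrow> (nat \<Rightarrow> complex) \<Rightarrow> complex" where
  "laughlin R l p N z = complex_of_real (kappa R l p N)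
      * (\<Prod>k<N. \<Prod>j<k. (exp (z k / complex_of_real R) - exp (z j / complex_of_real R)) ^ p)
      * complex_of_real (exp (- (1 / (2 * l^2)) * (\<Sum>k<N. (Re (z k))^2)))"

definition normC :: "real \<Rightarrow> real \<Rightarrow> nat \<Rightarrow> nat \<Rightarrow> real" where
  "normC R l p N = (\<integral>z. (cmod (laughlin R l p N z))^2
      \<partial>(PiM {..<N} (\<lambda>_. restrict_space lborel (cyl R))))"

definition rate :: "real \<Rightarrow> real \<Rightarrow> nat \<Rightarrow> real" where
  "rate R l p = exp (- lim (\<lambda>N. ln (normC R l p N) / real N))"

end

theory Submission
  imports Defs "HOL-Probability.Probability" "HOL-Real_Asymp.Real_Asymp"
begin

text \<open>
  Expanding the power of the Vandermonde product as a signed sum over tournaments and integrating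
  out the angles gives \<open>C\<^sub>N = (1 / N!) \<Sum>\<^sub>m b(m)\<^sup>2 exp (\<gamma>\<^sup>2 (\<Sum> m\<^sub>k\<^sup>2 - p\<^sup>2 \<Sum> k\<^sup>2))\<close>, where \<open>m\<close> runs over score
  vectors. Splitting off the smallest set of players that lose every game against the others
  yields a renewal equation \<open>C\<^sub>N = \<Sum>\<^sub>k a\<^sub>k C\<^sub>N\<^sub>-\<^sub>k\<close> with \<open>a\<^sub>k \<ge> 0\<close>, so it remains to show that the associated
  renewal distribution has total mass one and finite mean.

  Physically, \<open>|\<Psi>\<^sub>N|\<^sup>2\<close> is a one-dimensional jellium: with the particles ordered along the axis, the
  \<open>k\<close>-th one is bound harmonically to \<open>p \<gamma>\<^sup>2 k\<close>, and the residual pair interaction decays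
  exponentially. Cut the system between the particles \<open>N\<close> and \<open>N + 1\<close> and remove the clusters of
  \<open>i + 1\<close> and \<open>j + 1\<close> particles nearest to the cut beyond which every particle lies on its own side
  of the cut at a distance at least proportional to its index. Such clusters cost a factor \<open>exp (- c (i\<^sup>3 + j\<^sup>3))\<close>, which beats
  their interaction \<open>exp (O((i + j)\<^sup>2))\<close>; the remaining two parts are effectively independent. Hence
  \<open>C\<^sub>N\<^sub>+\<^sub>M \<le> v\<^sub>N v\<^sub>M\<close> with \<open>v\<^sub>N = \<Sum>\<^sub>i w\<^sub>i C\<^sub>N\<^sub>-\<^sub>1\<^sub>-\<^sub>i\<close> and \<open>w\<close> decaying faster than exponentially.

  For the generating function \<open>F\<close> of \<open>C\<close> this means \<open>F' \<le> K F\<^sup>2\<close> near its radius of convergence \<open>\<rho>\<close>,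
  hence \<open>1 / F(x) \<le> K (\<rho> - x)\<close>; since \<open>1 - \<Sum> a\<^sub>k x\<^sup>k = 1 / F(x)\<close>, mass one and finite mean follow.
\<close>

section \<open>The renewal theorem\<close>

text \<open>Nothing direct is known about the size of the weights a_k; they are controlled only
  through 1 / F. An upper bound on C_(N+M) is enough for that, because C_k may be cut at each of its
  k - 1 bonds, so that k C_k, the coefficient of x F', is dominated by a convolution square. The
  outcome F >= 1 / (K (rho - x)) has the growth of a simple pole, which is what a finite mean
  requires. The inequality is proved for the truncations of F, with K independent of the degree: a
  priori F might stay bounded at rho, whereas a truncation can be compared with its value at a point
  beyond rho, and those values tend to infinity. A configuration with particles far across the cut
  has no useful interaction bound; this is why clusters are sacrificed instead of comparing C_(N+M)
  with C_N C_M itself. Their sizes depend on the configuration, so all sizes are summed over. A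
  small part of the confining energy is held back, so that integrating out the sacrificed particles
  costs only a geometric factor.\<close>

lemma tendsto_sum_atMost_dominated:
  fixes a :: "nat \<Rightarrow> real" and u :: "nat \<Rightarrow> real" and n :: "nat \<Rightarrow> nat"
  assumes a: "\<And>k. a k \<ge> 0" "summable a" and u: "\<And>m. \<bar>u m\<bar> \<le> B"
    and n: "filterlim n at_top sequentially"
    and lim: "\<And>k. (\<lambda>j. u (n j - k)) \<longlonglongrightarrow> L"
  shows "(\<lambda>j. \<Sum>k\<le>n j. a k * u (n j - k)) \<longlonglongrightarrow> L * suminf a"
proof -
  define f where "f k j = (if k \<le> n j then a k * u (n j - k) else 0)" for k j
  have "(f k) \<longlonglongrightarrow> a k * L" for k
  proof -
    have "eventually (\<lambda>j. k \<le> n j) sequentially"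
      using n by (simp add: filterlim_at_top)
    then have "eventually (\<lambda>j. a k * u (n j - k) = f k j) sequentially"
      by eventually_elim (simp add: f_def)
    moreover have "(\<lambda>j. a k * u (n j - k)) \<longlonglongrightarrow> a k * L"
      by (intro tendsto_intros lim)
    ultimately show ?thesis using tendsto_cong by force
  qed
  moreover have "norm (f k j) \<le> B * a k" for k j
  proof (cases "k \<le> n j")
    case True
    have "a k * \<bar>u (n j - k)\<bar> \<le> a k * B" using a(1) u by (intro mult_left_mono) auto
    then show ?thesis using True a(1)[of k] by (simp add: f_def abs_mult mult.commute)
  next
    case False
    have "0 \<le> B" using order_trans[OF abs_ge_zero u] .
    then show ?thesis using False a(1)[of k] by (simp add: f_def)
  qed
  then have "eventually (\<lambda>(k,j). norm (f k j) \<le> B * a k) (at_top \<times>\<^sub>F sequentially)"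
    by (intro always_eventually) auto
  ultimately have "(\<lambda>j. suminf (\<lambda>k. f k j)) \<longlonglongrightarrow> suminf (\<lambda>k. a k * L)"
    using tannerys_theorem[of f "\<lambda>k. a k * L" sequentially "\<lambda>k. B * a k"] summable_mult[OF a(2), of B]
    by (simp only: trivial_limit_sequentially simp_thms)
  moreover have "suminf (\<lambda>k. f k j) = (\<Sum>k\<le>n j. a k * u (n j - k))" for j
    by (subst suminf_finite[of "{..n j}"]) (auto simp: f_def)
  moreover have "suminf (\<lambda>k. a k * L) = L * suminf a"
    using suminf_mult2[OF a(2), of L] by (simp add: mult.commute)
  ultimately show ?thesis by simp
qed

text \<open>Along a subsequence realising the upper limit L, an average of values that are
  asymptotically at most L can tend to L only if each value of positive weight does. As
  \<open>a 1 > 0\<close>, the passage from \<open>n j - k\<close> to \<open>n j - Suc k\<close>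
  reaches every shift, and the tail identity \<open>tot\<close> then evaluates L. The right-hand
  side \<open>c\<close> is left free because the lemma is used for \<open>u\<close> and for
  \<open>- u\<close>.\<close>

lemma renewal_limit_point:
  fixes a r u :: "nat \<Rightarrow> real" and n :: "nat \<Rightarrow> nat"
  assumes a: "\<And>k. a k \<ge> 0" "a 1 > 0" "a sums 1"
    and r: "\<And>k. r k \<ge> 0" "summable r"
    and u: "\<And>m. \<bar>u m\<bar> \<le> 1"
    and rec: "\<And>m. m \<ge> 1 \<Longrightarrow> u m = (\<Sum>k\<le>m. a k * u (m - k))"
    and tot: "\<And>m. (\<Sum>k\<le>m. r k * u (m - k)) = c"
    and up: "\<And>e. e > 0 \<Longrightarrow> eventually (\<lambda>m. u m \<le> L + e) sequentially"
    and n: "filterlim n at_top sequentially"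
    and lim: "(\<lambda>j. u (n j)) \<longlonglongrightarrow> L"
  shows "L * suminf r = c"
proof -
  \<comment> \<open>The overshoot of \<open>u\<close> above L. It makes every summand
    \<open>L + d - u\<close> nonnegative, so the single summand of index 1 is bounded by the whole
    weighted sum.\<close>
  define d where "d m = max 0 (u m - L)" for m
  have d0: "d \<longlonglongrightarrow> 0"
  proof (rule LIMSEQ_I)
    fix e :: real assume "e > 0"
    then have "eventually (\<lambda>m. u m \<le> L + e/2) sequentially" by (intro up) simp
    then obtain N where "\<forall>m\<ge>N. u m \<le> L + e/2" by (auto simp: eventually_sequentially)
    with \<open>e > 0\<close> show "\<exists>N. \<forall>m\<ge>N. norm (d m - 0) < e"
      by (intro exI[of _ N]) (fastforce simp: d_def)
  qed
  have dB: "\<bar>d m\<bar> \<le> 1 + \<bar>L\<bar>" for m using u[of m] by (auto simp: d_def)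
  have sub: "filterlim (\<lambda>j. n j - k) at_top sequentially" for k
    using n by (simp add: filterlim_at_top eventually_sequentially) (meson add_le_imp_le_diff)
  have *: "(\<lambda>j. u (n j - k)) \<longlonglongrightarrow> L" for k
  proof (induction k)
    case 0 show ?case using lim by simp
  next
    case (Suc k)
    define q where "q j = n j - k" for j
    have q: "filterlim q at_top sequentially" using sub[of k] by (simp add: q_def[abs_def])
    have qd: "(\<lambda>j. d (q j - i)) \<longlonglongrightarrow> 0" for i
    proof -
      have "filterlim (\<lambda>j. q j - i) at_top sequentially"
        using sub[of "k + i"] by (simp add: q_def)
      then show ?thesis using d0 by (rule filterlim_compose[rotated])
    qed
    have lim_a: "(\<lambda>j. \<Sum>i\<le>q j. a i) \<longlonglongrightarrow> 1"
    proof -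
      have "(\<lambda>m. \<Sum>i\<le>m. a i) \<longlonglongrightarrow> 1" using a(3) sums_def_le by blast
      then show ?thesis using q by (rule filterlim_compose)
    qed
    have "(\<lambda>j. \<Sum>i\<le>q j. a i * d (q j - i)) \<longlonglongrightarrow> 0 * suminf a"
      using a sums_summable by (intro tendsto_sum_atMost_dominated[OF _ _ dB q] qd) auto
    then have "(\<lambda>j. L * (\<Sum>i\<le>q j. a i) + (\<Sum>i\<le>q j. a i * d (q j - i)) - u (q j))
        \<longlonglongrightarrow> L * 1 + 0 - L"
      using Suc lim_a by (intro tendsto_intros) (auto simp: q_def)
    then have up0: "(\<lambda>j. L * (\<Sum>i\<le>q j. a i) + (\<Sum>i\<le>q j. a i * d (q j - i)) - u (q j)) \<longlonglongrightarrow> 0"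
      by simp
    have nn: "L + d m - u m \<ge> 0" for m by (simp add: d_def)
    have bnd: "a 1 * (L + d (q j - 1) - u (q j - 1))
        \<le> L * (\<Sum>i\<le>q j. a i) + (\<Sum>i\<le>q j. a i * d (q j - i)) - u (q j)" if "q j \<ge> 1" for j
    proof -
      have "a 1 * (L + d (q j - 1) - u (q j - 1)) \<le> (\<Sum>i\<le>q j. a i * (L + d (q j - i) - u (q j - i)))"
        using that by (intro member_le_sum[where f="\<lambda>i. a i * (L + d (q j - i) - u (q j - i))"])
          (auto intro!: mult_nonneg_nonneg a(1) nn simp del: diff_ge_0_iff_ge)
      also have "\<dots> = L * (\<Sum>i\<le>q j. a i) + (\<Sum>i\<le>q j. a i * d (q j - i)) - (\<Sum>i\<le>q j. a i * u (q j - i))"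
        by (simp only: distrib_left right_diff_distrib sum.distrib sum_subtractf sum_distrib_left)
          (simp only: mult.commute)
      finally show ?thesis using rec[OF that] by simp
    qed
    have ev1: "eventually (\<lambda>j. q j \<ge> 1) sequentially" using q by (simp add: filterlim_at_top)
    have "(\<lambda>j. a 1 * (L + d (q j - 1) - u (q j - 1))) \<longlonglongrightarrow> 0"
    proof (rule tendsto_sandwich[OF _ _ tendsto_const up0])
      show "eventually (\<lambda>j. 0 \<le> a 1 * (L + d (q j - 1) - u (q j - 1))) sequentially"
        using a(2) nn by (intro always_eventually allI mult_nonneg_nonneg) auto
      show "eventually (\<lambda>j. a 1 * (L + d (q j - 1) - u (q j - 1))
          \<le> L * (\<Sum>i\<le>q j. a i) + (\<Sum>i\<le>q j. a i * d (q j - i)) - u (q j)) sequentially"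
        using ev1 by eventually_elim (rule bnd)
    qed
    then have "(\<lambda>j. L + d (q j - 1) - (a 1 * (L + d (q j - 1) - u (q j - 1))) / a 1) \<longlonglongrightarrow> L + 0 - 0 / a 1"
      using a(2) by (intro tendsto_intros qd) auto
    then show ?case using a(2) by (simp add: q_def)
  qed
  have "(\<lambda>j. \<Sum>k\<le>n j. r k * u (n j - k)) \<longlonglongrightarrow> L * suminf r"
    by (rule tendsto_sum_atMost_dominated[OF r u n *])
  then show ?thesis using tot LIMSEQ_unique by (simp add: LIMSEQ_const_iff)
qed

lemma bounded_limsup_limit_point:
  fixes u :: "nat \<Rightarrow> real"
  assumes u: "\<And>m. \<bar>u m\<bar> \<le> B"
  shows "\<exists>L n. strict_mono n \<and> (\<lambda>j. u (n j)) \<longlonglongrightarrow> L \<and>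
    (\<forall>e>0. eventually (\<lambda>m. u m \<le> L + e) sequentially)"
proof -
  have u': "- B \<le> u m" "u m \<le> B" for m using u[of m] by auto
  obtain n where n: "strict_mono n" "((\<lambda>m. ereal (u m)) o n) \<longlonglongrightarrow> limsup (\<lambda>m. ereal (u m))"
    using limsup_subseq_lim by blast
  have "limsup (\<lambda>m. ereal (u m)) \<le> ereal B" using u' by (intro Limsup_bounded) auto
  moreover have "ereal (- B) \<le> limsup (\<lambda>m. ereal (u m))"
    using u' by (intro le_Limsup) (auto intro!: always_eventually simp del: uminus_ereal.simps)
  ultimately obtain L where L: "limsup (\<lambda>m. ereal (u m)) = ereal L"
    by (cases "limsup (\<lambda>m. ereal (u m))") auto
  show ?thesis
  proof (intro exI conjI allI impI)
    show "strict_mono n" by (rule n(1))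
    show "(\<lambda>j. u (n j)) \<longlonglongrightarrow> L" using n(2) by (simp add: L comp_def)
    fix e :: real assume "e > 0"
    then have "limsup (\<lambda>m. ereal (u m)) < ereal (L + e)" by (simp add: L)
    then have "eventually (\<lambda>m. ereal (u m) < ereal (L + e)) sequentially" by (rule Limsup_lessD)
    then show "eventually (\<lambda>m. u m \<le> L + e) sequentially" by eventually_elim simp
  qed
qed

text \<open>The limit-point lemma for \<open>u\<close> and for \<open>- u\<close> forces upper and
  lower limit to be the same reciprocal. In the application \<open>r\<close> consists of the tails
  of \<open>a\<close>, whose sum is the mean.\<close>

lemma renewal_convergence:
  fixes a r u :: "nat \<Rightarrow> real"
  assumes a: "\<And>k. a k \<ge> 0" "a 1 > 0" "a sums 1"
    and r: "\<And>k. r k \<ge> 0" "summable r" "suminf r > 0"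
    and u: "\<And>m. \<bar>u m\<bar> \<le> 1"
    and rec: "\<And>m. m \<ge> 1 \<Longrightarrow> u m = (\<Sum>k\<le>m. a k * u (m - k))"
    and tot: "\<And>m. (\<Sum>k\<le>m. r k * u (m - k)) = 1"
  shows "u \<longlonglongrightarrow> 1 / suminf r"
proof -
  obtain L n where L: "strict_mono n" "(\<lambda>j. u (n j)) \<longlonglongrightarrow> L"
    "\<And>e. e > 0 \<Longrightarrow> eventually (\<lambda>m. u m \<le> L + e) sequentially"
    using bounded_limsup_limit_point[of u, OF u] by blast
  have Lr: "L * suminf r = 1"
    by (rule renewal_limit_point[OF a r(1,2) u rec tot L(3) filterlim_subseq[OF L(1)] L(2)])
  have u': "\<bar>- u m\<bar> \<le> 1" for m using u by simp
  obtain L' n' where L': "strict_mono n'" "(\<lambda>j. - u (n' j)) \<longlonglongrightarrow> L'"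
    "\<And>e. e > 0 \<Longrightarrow> eventually (\<lambda>m. - u m \<le> L' + e) sequentially"
    using bounded_limsup_limit_point[of "\<lambda>m. - u m", OF u'] by blast
  have rec': "- u m = (\<Sum>k\<le>m. a k * - u (m - k))" if "m \<ge> 1" for m
    using rec[OF that] by (simp add: sum_negf)
  have tot': "(\<Sum>k\<le>m. r k * - u (m - k)) = - 1" for m using tot[of m] by (simp add: sum_negf)
  have Lr': "L' * suminf r = - 1"
    by (rule renewal_limit_point[OF a r(1,2) u' rec' tot' L'(3) filterlim_subseq[OF L'(1)] L'(2)])
  have "(L + L') * suminf r = 0" using Lr Lr' by (simp add: distrib_right)
  then have "L' = - L" using r(3) by (metis add.commute add_eq_0_iff mult_eq_0_iff less_irrefl)
  then have LL: "L = 1 / suminf r" "L' = - L" using Lr r(3) by (auto simp: eq_divide_eq)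
  show ?thesis
  proof (rule LIMSEQ_I)
    fix e :: real assume "e > 0"
    then have "eventually (\<lambda>m. u m \<le> L + e/2) sequentially" "eventually (\<lambda>m. - u m \<le> L' + e/2) sequentially"
      by (auto intro!: L L')
    then have "eventually (\<lambda>m. norm (u m - 1 / suminf r) < e) sequentially"
      by eventually_elim (use \<open>e > 0\<close> LL in \<open>auto simp: abs_if\<close>)
    then show "\<exists>N. \<forall>m\<ge>N. norm (u m - 1 / suminf r) < e" by (simp add: eventually_sequentially)
  qed
qed

section \<open>Generating functions and the splitting inequality\<close>

text \<open>Meant for convolutions: their index pairs embed into a rectangle, so truncated
  convolutions are bounded by products of truncated sums, with no convergence involved.\<close>

lemma sum_inj_le_sum_mult_sum:
  fixes f g :: "nat \<Rightarrow> real"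
  assumes "finite I" "finite J" and inj: "inj_on h S" and im: "h ` S \<subseteq> I \<times> J"
    and nn: "\<And>i. f i \<ge> 0" "\<And>j. g j \<ge> 0"
  shows "(\<Sum>s\<in>S. f (fst (h s)) * g (snd (h s))) \<le> sum f I * sum g J"
proof -
  have "(\<Sum>s\<in>S. f (fst (h s)) * g (snd (h s))) = (\<Sum>q\<in>h ` S. f (fst q) * g (snd q))"
    by (simp add: sum.reindex[OF inj])
  also have "\<dots> \<le> (\<Sum>q\<in>I \<times> J. f (fst q) * g (snd q))"
    using assms by (intro sum_mono2) auto
  also have "\<dots> = sum f I * sum g J"
    by (simp add: sum_product sum.cartesian_product split_def)
  finally show ?thesis .
qed

text \<open>The truncated form of x F' <= F + (x W F)^2 for the generating functions F of
  \<open>C\<close> and W of \<open>w\<close>. Being a statement on finite sums it holds for every x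
  >= 0, also beyond the radius of convergence.\<close>

lemma weighted_sum_splitting_bound:
  fixes C w :: "nat \<Rightarrow> real"
  assumes C: "\<And>n. C n \<ge> 0" and w: "\<And>i. w i \<ge> 0" and x: "0 \<le> x"
    and split: "\<And>N M. N \<ge> 1 \<Longrightarrow> M \<ge> 1 \<Longrightarrow>
      C (N + M) \<le> (\<Sum>i<N. w i * C (N - 1 - i)) * (\<Sum>i<M. w i * C (M - 1 - i))"
  shows "(\<Sum>k\<le>n. real k * C k * x ^ k) \<le>
    (\<Sum>k\<le>n. C k * x ^ k) + (x * (\<Sum>i<n. w i * x ^ i) * (\<Sum>k\<le>n. C k * x ^ k))\<^sup>2"
proof -
  define v where "v N = (\<Sum>i<N. w i * C (N - 1 - i))" for N
  have v: "v N \<ge> 0" for N unfolding v_def using C w by (intro sum_nonneg mult_nonneg_nonneg)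
  define V where "V = (\<Sum>N=1..n. v N * x ^ N)"
  have kC: "real k * C k \<le> C k + (\<Sum>N=1..<k. v N * v (k - N))" for k
  proof (cases "k = 0")
    case True then show ?thesis using C[of 0] by simp
  next
    case False
    \<comment> \<open>One copy of \<open>C k\<close> for each position of the cut; the copy that is
      left over becomes the linear term.\<close>
    have "real (k - 1) * C k = (\<Sum>N=1..<k. C k)" by simp
    also have "\<dots> \<le> (\<Sum>N=1..<k. v N * v (k - N))"
    proof (rule sum_mono)
      fix N assume "N \<in> {1..<k}"
      then show "C k \<le> v N * v (k - N)" using split[of N "k - N"] by (auto simp: v_def)
    qed
    finally show ?thesis using False by (simp add: of_nat_diff algebra_simps)
  qed
  have "(\<Sum>k\<le>n. real k * C k * x ^ k) \<le> (\<Sum>k\<le>n. (C k + (\<Sum>N=1..<k. v N * v (k - N))) * x ^ k)"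
    using kC x by (intro sum_mono mult_right_mono) auto
  also have "\<dots> = (\<Sum>k\<le>n. C k * x ^ k) + (\<Sum>k\<le>n. \<Sum>N=1..<k. (v N * x ^ N) * (v (k - N) * x ^ (k - N)))"
  proof -
    have "(\<Sum>N=1..<k. v N * v (k - N)) * x ^ k =
        (\<Sum>N=1..<k. (v N * x ^ N) * (v (k - N) * x ^ (k - N)))" for k
    proof (subst sum_distrib_right, rule sum.cong[OF refl])
      fix N assume "N \<in> {1..<k}"
      then have "x ^ k = x ^ N * x ^ (k - N)" by (simp add: power_add[symmetric])
      then show "v N * v (k - N) * x ^ k = (v N * x ^ N) * (v (k - N) * x ^ (k - N))" by simp
    qed
    then show ?thesis by (simp add: distrib_right sum.distrib)
  qed
  also have "(\<Sum>k\<le>n. \<Sum>N=1..<k. (v N * x ^ N) * (v (k - N) * x ^ (k - N))) \<le> V * V"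
  proof -
    have "(\<Sum>k\<le>n. \<Sum>N=1..<k. (v N * x ^ N) * (v (k - N) * x ^ (k - N)))
        = (\<Sum>s\<in>Sigma {..n} (\<lambda>k. {1..<k}). (\<lambda>N. v N * x ^ N) (fst ((\<lambda>(k,N). (N, k - N)) s))
            * (\<lambda>N. v N * x ^ N) (snd ((\<lambda>(k,N). (N, k - N)) s)))"
      by (subst sum.Sigma) (auto simp: split_def)
    also have "\<dots> \<le> sum (\<lambda>N. v N * x ^ N) {1..n} * sum (\<lambda>N. v N * x ^ N) {1..n}"
      using v x by (intro sum_inj_le_sum_mult_sum) (auto simp: inj_on_def)
    finally show ?thesis by (simp add: V_def)
  qed
  also have "V * V \<le> (x * (\<Sum>i<n. w i * x ^ i) * (\<Sum>k\<le>n. C k * x ^ k))\<^sup>2"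
  proof -
    have V0: "V \<ge> 0" unfolding V_def using v x by (intro sum_nonneg mult_nonneg_nonneg) auto
    have "V = (\<Sum>N=1..n. \<Sum>i<N. x * ((w i * x ^ i) * (C (N - 1 - i) * x ^ (N - 1 - i))))"
      unfolding V_def
    proof (rule sum.cong[OF refl])
      fix N
      show "v N * x ^ N = (\<Sum>i<N. x * ((w i * x ^ i) * (C (N - 1 - i) * x ^ (N - 1 - i))))"
        unfolding v_def sum_distrib_right
      proof (rule sum.cong[OF refl])
        fix i assume "i \<in> {..<N}"
        then have "N = Suc (i + (N - 1 - i))" by simp
        then have "x ^ N = x * (x ^ i * x ^ (N - 1 - i))" by (metis power_Suc power_add)
        then show "w i * C (N - 1 - i) * x ^ N = x * ((w i * x ^ i) * (C (N - 1 - i) * x ^ (N - 1 - i)))"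
          by simp
      qed
    qed
    also have "\<dots> = x * (\<Sum>s\<in>Sigma {1..n} (\<lambda>N. {..<N}).
        (\<lambda>i. w i * x ^ i) (fst ((\<lambda>(N,i). (i, N - 1 - i)) s)) * (\<lambda>i. C i * x ^ i) (snd ((\<lambda>(N,i). (i, N - 1 - i)) s)))"
      by (subst sum.Sigma) (auto simp: split_def sum_distrib_left)
    also have "\<dots> \<le> x * (sum (\<lambda>i. w i * x ^ i) {..<n} * sum (\<lambda>i. C i * x ^ i) {..n})"
      using C w x by (intro mult_left_mono sum_inj_le_sum_mult_sum) (auto simp: inj_on_def)
    finally have "V \<le> x * (\<Sum>i<n. w i * x ^ i) * (\<Sum>k\<le>n. C k * x ^ k)" by simp
    then show ?thesis using V0 by (simp add: power2_eq_square mult_mono')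
  qed
  finally show ?thesis by simp
qed

text \<open>The derivative of - 1 / F is F' / F^2, which \<open>weighted_sum_splitting_bound\<close>
  controls because F >= 1. The constant is the same for all truncations and on both sides of rho, so
  a point below rho can be compared with one above.\<close>

lemma inverse_partial_sums_lipschitz:
  fixes C w :: "nat \<Rightarrow> real"
  assumes C: "\<And>n. C n \<ge> 0" "C 0 = 1" and w: "\<And>i. w i \<ge> 0" and rho: "\<rho> > 0"
    and W: "summable (\<lambda>i. w i * (2 * \<rho>) ^ i)"
    and split: "\<And>N M. N \<ge> 1 \<Longrightarrow> M \<ge> 1 \<Longrightarrow>
      C (N + M) \<le> (\<Sum>i<N. w i * C (N - 1 - i)) * (\<Sum>i<M. w i * C (M - 1 - i))"
  shows "\<exists>K. \<forall>n x y. \<rho> / 2 \<le> x \<longrightarrow> x \<le> y \<longrightarrow> y \<le> 2 * \<rho> \<longrightarrow>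
    1 / (\<Sum>k\<le>n. C k * x ^ k) - 1 / (\<Sum>k\<le>n. C k * y ^ k) \<le> K * (y - x)"
proof -
  define Ws where "Ws = (\<Sum>i. w i * (2 * \<rho>) ^ i)"
  \<comment> \<open>After division by t, the first summand comes from F <= F^2 and t >= rho / 2, the
    second from t <= 2 rho.\<close>
  define K where "K = 2 / \<rho> + 2 * \<rho> * Ws\<^sup>2"
  have Ws0: "Ws \<ge> 0" unfolding Ws_def using w rho by (intro suminf_nonneg W) auto
  have main: "1 / (\<Sum>k\<le>n. C k * x ^ k) - 1 / (\<Sum>k\<le>n. C k * y ^ k) \<le> K * (y - x)"
    if xy: "\<rho> / 2 \<le> x" "x \<le> y" "y \<le> 2 * \<rho>" for n x y
  proof -
    define F where "F t = (\<Sum>k\<le>n. C k * t ^ k)" for t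
    define F' where "F' t = (\<Sum>k\<le>n. C k * (real k * t ^ (k - 1)))" for t
    have F1: "F t \<ge> 1" if "t \<ge> 0" for t
    proof -
      have "C 0 * t ^ 0 \<le> F t" unfolding F_def
        using that C by (intro member_le_sum[where f="\<lambda>k. C k * t ^ k"]) auto
      then show ?thesis by (simp add: C)
    qed
    have dF: "(F has_real_derivative F' t) (at t)" for t
      unfolding F_def[abs_def] F'_def
      by (auto intro!: derivative_eq_intros sum.cong)
    have bound: "F' t \<le> K * (F t)\<^sup>2" if t: "\<rho> / 2 \<le> t" "t \<le> 2 * \<rho>" for t
    proof -
      have t0: "t > 0" using t rho by simp
      have "t * F' t = (\<Sum>k\<le>n. real k * C k * t ^ k)"
        unfolding F'_def sum_distrib_left
      proof (rule sum.cong[OF refl])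
        fix k show "t * (C k * (real k * t ^ (k - 1))) = real k * C k * t ^ k"
          by (cases k) auto
      qed
      also have "\<dots> \<le> F t + (t * (\<Sum>i<n. w i * t ^ i) * F t)\<^sup>2"
        unfolding F_def using t0 by (intro weighted_sum_splitting_bound[OF C(1) w _ split]) auto
      also have "\<dots> \<le> F t + (t * Ws * F t)\<^sup>2"
      proof -
        have "(\<Sum>i<n. w i * t ^ i) \<le> (\<Sum>i<n. w i * (2 * \<rho>) ^ i)"
          using t t0 w by (intro sum_mono mult_left_mono power_mono) auto
        also have "\<dots> \<le> Ws" unfolding Ws_def using w rho by (intro sum_le_suminf W) auto
        finally have "(\<Sum>i<n. w i * t ^ i) \<le> Ws" .
        moreover have "0 \<le> (\<Sum>i<n. w i * t ^ i)" using w t0 by (intro sum_nonneg) auto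
        ultimately show ?thesis using t0 F1[of t]
          by (intro add_left_mono power_mono mult_right_mono mult_left_mono) auto
      qed
      finally have *: "t * F' t \<le> F t + (t * Ws * F t)\<^sup>2" .
      have "F t \<le> (F t)\<^sup>2" using F1[of t] t0 by (simp add: power2_eq_square)
      also have "\<dots> \<le> t * (2 / \<rho>) * (F t)\<^sup>2"
        using t rho F1[of t] t0 by (simp add: field_simps)
      finally have "F t \<le> t * (2 / \<rho>) * (F t)\<^sup>2" .
      moreover have "(t * Ws * F t)\<^sup>2 \<le> t * (2 * \<rho> * Ws\<^sup>2) * (F t)\<^sup>2"
      proof -
        have "t * (t * (Ws * F t)\<^sup>2) \<le> t * (2 * \<rho> * (Ws * F t)\<^sup>2)"
          using t t0 by (intro mult_left_mono mult_right_mono) auto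
        then show ?thesis by (simp add: power2_eq_square algebra_simps)
      qed
      ultimately have "t * F' t \<le> t * (K * (F t)\<^sup>2)" using *
        by (simp add: K_def algebra_simps)
      then show ?thesis using t0 by simp
    qed
    have "K * x + 1 / F x \<le> K * y + 1 / F y"
    proof (rule DERIV_nonneg_imp_nondecreasing[OF xy(2)])
      fix t assume "x \<le> t" "t \<le> y"
      then have t: "\<rho> / 2 \<le> t" "t \<le> 2 * \<rho>" using xy by auto
      then have Ft: "F t \<ge> 1" using F1[of t] rho by simp
      have "((\<lambda>t. K * t + 1 / F t) has_real_derivative K - F' t / (F t)\<^sup>2) (at t)"
        using Ft by (auto intro!: derivative_eq_intros dF simp: power2_eq_square)
      moreover have "K - F' t / (F t)\<^sup>2 \<ge> 0"
        using bound[OF t] Ft by (simp add: field_simps)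
      ultimately show "\<exists>y. ((\<lambda>t. K * t + 1 / F t) has_real_derivative y) (at t) \<and> y \<ge> 0" by blast
    qed
    then show ?thesis by (simp add: F_def algebra_simps)
  qed
  then show ?thesis by blast
qed

text \<open>The geometric upper bound makes the set of convergent arguments nonempty and the lower
  bound makes it bounded, so the radius is a positive real supremum.\<close>

lemma nonneg_series_radius:
  fixes C :: "nat \<Rightarrow> real"
  assumes C: "\<And>n. c ^ n \<le> C n" "\<And>n. C n \<le> D ^ n" and c: "c > 0"
  obtains \<rho> where "\<rho> > 0" "\<And>x. 0 \<le> x \<Longrightarrow> x < \<rho> \<Longrightarrow> summable (\<lambda>n. C n * x ^ n)"
    "\<And>x. \<rho> < x \<Longrightarrow> \<not> summable (\<lambda>n. C n * x ^ n)"
proof -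
  define X where "X = {x. 0 < x \<and> summable (\<lambda>n. C n * x ^ n)}"
  have C0: "C n \<ge> 0" for n using C(1)[of n] c order_trans[OF zero_le_power] by (meson less_imp_le)
  have D: "D > 0" using C(1)[of 1] C(2)[of 1] c by simp
  have X1: "1 / (2 * D) \<in> X"
  proof -
    have "summable (\<lambda>n. C n * (1 / (2 * D)) ^ n)"
    proof (rule summable_comparison_test')
      show "summable (\<lambda>n. (1/2::real) ^ n)" by (rule summable_geometric) simp
      fix n :: nat
      have "C n * (1 / (2 * D)) ^ n \<le> D ^ n * (1 / (2 * D)) ^ n"
        using C(2) D by (intro mult_right_mono) auto
      also have "\<dots> = (1/2) ^ n" using D by (simp add: power_mult_distrib[symmetric])
      finally show "norm (C n * (1 / (2 * D)) ^ n) \<le> (1/2) ^ n" using C0 D by simp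
    qed
    then show ?thesis using D by (simp add: X_def)
  qed
  have X2: "x \<le> 1 / c" if "x \<in> X" for x
  proof (rule ccontr)
    assume "\<not> x \<le> 1 / c"
    then have cx: "c * x > 1" using c by (simp add: field_simps)
    have x: "x > 0" "summable (\<lambda>n. C n * x ^ n)" using that by (auto simp: X_def)
    have "summable (\<lambda>n. (c * x) ^ n)"
    proof (rule summable_comparison_test'[OF x(2)])
      fix n show "norm ((c * x) ^ n) \<le> C n * x ^ n"
        using C(1)[of n] c x by (simp add: power_mult_distrib)
    qed
    then show False using cx by (simp add: summable_geometric_iff)
  qed
  then have bdd: "bdd_above X" by (auto intro!: bdd_aboveI)
  define \<rho> where "\<rho> = Sup X"
  have "\<rho> \<ge> 1 / (2 * D)" unfolding \<rho>_def by (intro cSup_upper X1 bdd)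
  then have "\<rho> > 0" using D by (smt (verit) divide_pos_pos)
  moreover have "summable (\<lambda>n. C n * x ^ n)" if x: "0 \<le> x" "x < \<rho>" for x
  proof -
    obtain y where y: "y \<in> X" "x < y" using x X1 less_cSup_iff[OF _ bdd, of x] by (auto simp: \<rho>_def)
    then have "summable (\<lambda>n. C n * y ^ n)" by (simp add: X_def)
    then show ?thesis
    proof (rule summable_comparison_test')
      fix n show "norm (C n * x ^ n) \<le> C n * y ^ n"
        using y x C0[of n] by (auto intro!: mult_left_mono power_mono)
    qed
  qed
  moreover have "\<not> summable (\<lambda>n. C n * x ^ n)" if x: "\<rho> < x" for x
  proof
    assume "summable (\<lambda>n. C n * x ^ n)"
    then have "x \<in> X" using x \<open>\<rho> > 0\<close> by (simp add: X_def)
    then have "x \<le> \<rho>" unfolding \<rho>_def by (intro cSup_upper bdd)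
    then show False using x by simp
  qed
  ultimately show ?thesis using that by blast
qed

text \<open>Decomposition by the last renewal up to time m: the tail of \<open>a\<close> beyond k is
  the probability that the next k steps contain no renewal. The derivation is purely algebraic, so
  that it is available whatever the mass of \<open>a\<close>.\<close>

lemma renewal_tail_sum:
  fixes a u :: "nat \<Rightarrow> real"
  assumes a0: "a 0 = 0" and u0: "u 0 = 1"
    and rec: "\<And>m. m \<ge> 1 \<Longrightarrow> u m = (\<Sum>k\<le>m. a k * u (m - k))"
  shows "(\<Sum>k\<le>m. (1 - (\<Sum>i\<le>k. a i)) * u (m - k)) = 1"
proof (induction m)
  case 0 then show ?case by (simp add: a0 u0)
next
  case (Suc m)
  define t where "t k = 1 - (\<Sum>i\<le>k. a i)" for k
  have "(\<Sum>k\<le>Suc m. t k * u (Suc m - k)) = t 0 * u (Suc m) + (\<Sum>k\<le>m. t (Suc k) * u (m - k))"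
    by (subst sum.atMost_Suc_shift) simp
  also have "(\<Sum>k\<le>m. t (Suc k) * u (m - k)) = (\<Sum>k\<le>m. t k * u (m - k)) - (\<Sum>k\<le>m. a (Suc k) * u (m - k))"
    by (simp add: t_def left_diff_distrib distrib_right sum_subtractf sum.distrib)
  also have "(\<Sum>k\<le>m. a (Suc k) * u (m - k)) = u (Suc m)"
    using rec[of "Suc m"] by (simp add: sum.atMost_Suc_shift a0 del: sum.atMost_Suc)
  finally show ?case using Suc by (simp add: t_def a0)
qed

text \<open>An Abelian argument as t increases to 1: the generating function is squeezed to 1, which
  gives the mass, and its distance from 1 bounds the sum of the tails, that is the mean.\<close>

lemma renewal_mean_bound:
  fixes a :: "nat \<Rightarrow> real"
  assumes a: "\<And>k. a k \<ge> 0"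
    and gen: "\<And>t. 1/2 \<le> t \<Longrightarrow> t < 1 \<Longrightarrow> summable (\<lambda>k. a k * t ^ k)"
      "\<And>t. 1/2 \<le> t \<Longrightarrow> t < 1 \<Longrightarrow> (\<Sum>k. a k * t ^ k) < 1"
      "\<And>t. 1/2 \<le> t \<Longrightarrow> t < 1 \<Longrightarrow> 1 - (\<Sum>k. a k * t ^ k) \<le> K * (1 - t)"
  shows "a sums 1" "\<And>k. 0 \<le> 1 - (\<Sum>i\<le>k. a i)" "summable (\<lambda>k. 1 - (\<Sum>i\<le>k. a i))"
proof -
  have nb: "at_left (1::real) \<noteq> bot" by simp
  have ev: "eventually (\<lambda>t. 1/2 \<le> t \<and> t < (1::real)) (at_left 1)"
    by (rule eventually_at_leftI[of "1/2"]) auto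
  have part: "(\<Sum>k<n. a k) \<le> 1" for n
  proof (rule tendsto_upperbound[OF _ _ nb])
    show "((\<lambda>t. \<Sum>k<n. a k * t ^ k) \<longlongrightarrow> (\<Sum>k<n. a k)) (at_left 1)"
      by (rule tendsto_eq_intros tendsto_ident_at refl | simp)+
    show "eventually (\<lambda>t. (\<Sum>k<n. a k * t ^ k) \<le> 1) (at_left 1)"
      using ev
    proof eventually_elim
      case (elim t)
      then have "(\<Sum>k<n. a k * t ^ k) \<le> (\<Sum>k. a k * t ^ k)"
        using a by (intro sum_le_suminf gen) auto
      then show ?case using gen(2)[of t] elim by simp
    qed
  qed
  have sm: "summable a"
    using part a by (intro summableI_nonneg_bounded)
  have le1: "suminf a \<le> 1" using part by (intro suminf_le_const[OF sm]) 
  have ge1: "1 \<le> suminf a"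
  proof (rule tendsto_upperbound[OF _ _ nb])
    show "((\<lambda>t. 1 - K * (1 - t)) \<longlongrightarrow> 1) (at_left 1)"
      by (rule tendsto_eq_intros tendsto_ident_at refl | simp)+
    show "eventually (\<lambda>t. 1 - K * (1 - t) \<le> suminf a) (at_left 1)"
      using ev
    proof eventually_elim
      case (elim t)
      have "a k * t ^ k \<le> a k" for k
        using a[of k] elim power_le_one[of t k] mult_left_le[of "t ^ k" "a k"] by simp
      then have "(\<Sum>k. a k * t ^ k) \<le> suminf a"
        using elim by (intro suminf_le gen sm) auto
      then show ?case using gen(3)[of t] elim by simp
    qed
  qed
  show s1: "a sums 1" using sm le1 ge1 by (metis antisym summable_sums)
  define T where "T m = 1 - (\<Sum>k<m. a k)" for m
  have T0: "T m \<ge> 0" for m using part[of m] by (simp add: T_def)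
  have TS: "1 - (\<Sum>i\<le>k. a i) = T (Suc k)" for k by (simp add: T_def lessThan_Suc_atMost)
  show "0 \<le> 1 - (\<Sum>i\<le>k. a i)" for k using T0 TS by simp
  have part2: "(\<Sum>k<n. T (Suc k)) \<le> K" for n
  proof (rule tendsto_upperbound[OF _ _ nb])
    show "((\<lambda>t. \<Sum>k<n. T (Suc k) * t ^ k) \<longlongrightarrow> (\<Sum>k<n. T (Suc k))) (at_left 1)"
      by (rule tendsto_eq_intros tendsto_ident_at refl | simp)+
    show "eventually (\<lambda>t. (\<Sum>k<n. T (Suc k) * t ^ k) \<le> K) (at_left 1)"
      using ev
    proof eventually_elim
      case (elim t)
      \<comment> \<open>Summation by parts. The boundary term \<open>t ^ n * T n\<close> is at least
        the missing tail of the series, since powers of t decrease; so the right-hand side is at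
        most 1 minus the full generating function.\<close>
      have id: "(1 - t) * (\<Sum>k<n. T (Suc k) * t ^ k) = 1 - (\<Sum>k<n. a k * t ^ k) - t ^ n * T n"
      proof (induction n)
        case 0 then show ?case by (simp add: T_def)
      next
        case (Suc n)
        have "T n = T (Suc n) + a n" by (simp add: T_def)
        with Suc show ?case by (simp add: algebra_simps)
      qed
      have st: "summable (\<lambda>k. a k * t ^ k)" using elim by (intro gen) auto
      have "(\<Sum>k. a k * t ^ k) = (\<Sum>k. a (k + n) * t ^ (k + n)) + (\<Sum>k<n. a k * t ^ k)"
        by (rule suminf_split_initial_segment[OF st])
      also have "(\<Sum>k. a (k + n) * t ^ (k + n)) \<le> (\<Sum>k. t ^ n * a (k + n))"
      proof (rule suminf_le)
        show "summable (\<lambda>k. a (k + n) * t ^ (k + n))" using st by (subst summable_iff_shift)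
        show "summable (\<lambda>k. t ^ n * a (k + n))" using sm by (intro summable_mult) (simp add: summable_iff_shift)
        fix k
        have "t ^ n * (a (k + n) * t ^ k) \<le> t ^ n * (a (k + n) * 1)"
          using a[of "k + n"] elim by (intro mult_left_mono power_le_one) auto
        then show "a (k + n) * t ^ (k + n) \<le> t ^ n * a (k + n)"
          by (simp add: power_add algebra_simps)
      qed
      also have "(\<Sum>k. t ^ n * a (k + n)) = t ^ n * T n"
      proof -
        have "summable (\<lambda>k. a (k + n))" using sm by (simp add: summable_iff_shift)
        moreover have "(\<Sum>k. a (k + n)) = T n"
          using suminf_split_initial_segment[OF sm, of n] s1 by (simp add: T_def sums_iff)
        ultimately show ?thesis by (simp add: suminf_mult)
      qed
      finally have "1 - (\<Sum>k<n. a k * t ^ k) - t ^ n * T n \<le> 1 - (\<Sum>k. a k * t ^ k)" by simp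
      also have "\<dots> \<le> K * (1 - t)" using elim by (intro gen) auto
      finally have "(1 - t) * (\<Sum>k<n. T (Suc k) * t ^ k) \<le> (1 - t) * K"
        unfolding id[symmetric] by (simp add: mult.commute)
      then show ?case using elim by simp
    qed
  qed
  show "summable (\<lambda>k. 1 - (\<Sum>i\<le>k. a i))"
    unfolding TS using T0 part2 by (intro summableI_nonneg_bounded[of _ K]) auto
qed

text \<open>The renewal equation is the power series identity A F = F - 1, where the 1 corrects
  index 0. Summability passes from \<open>C\<close> to \<open>a\<close> because the last term of the
  recursion, with \<open>C 0 = 1\<close>, gives \<open>a k \<le> C k\<close>.\<close>

lemma renewal_generating_function:
  fixes C a :: "nat \<Rightarrow> real"
  assumes C: "\<And>n. C n \<ge> 0" "C 0 = 1" and a: "\<And>k. a k \<ge> 0" "a 0 = 0"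
    and rec: "\<And>n. n \<ge> 1 \<Longrightarrow> C n = (\<Sum>k\<le>n. a k * C (n - k))"
    and x: "x \<ge> 0" and sm: "summable (\<lambda>n. C n * x ^ n)"
  shows "summable (\<lambda>k. a k * x ^ k)" "1 - (\<Sum>k. a k * x ^ k) = 1 / (\<Sum>k. C k * x ^ k)"
    "(\<Sum>k. C k * x ^ k) \<ge> 1"
proof -
  have aC: "a k \<le> C k" for k
  proof (cases "k = 0")
    case False
    have "a k * C (k - k) \<le> (\<Sum>i\<le>k. a i * C (k - i))"
      using C a by (intro member_le_sum[where f="\<lambda>i. a i * C (k - i)"]) auto
    then show ?thesis using rec[of k] False C(2) by simp
  qed (simp add: a C)
  show sa: "summable (\<lambda>k. a k * x ^ k)"
  proof (rule summable_comparison_test'[OF sm])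
    fix n show "norm (a n * x ^ n) \<le> C n * x ^ n" using aC[of n] a(1)[of n] x by (simp add: mult_right_mono)
  qed
  have "(\<lambda>n. \<Sum>k\<le>n. (a k * x ^ k) * (C (n - k) * x ^ (n - k))) sums ((\<Sum>k. a k * x ^ k) * (\<Sum>k. C k * x ^ k))"
    using sa sm a C x by (intro Cauchy_product_sums) auto
  also have "(\<lambda>n. \<Sum>k\<le>n. (a k * x ^ k) * (C (n - k) * x ^ (n - k))) = (\<lambda>n. C n * x ^ n - (if n = 0 then 1 else 0))"
  proof
    fix n
    have "(\<Sum>k\<le>n. (a k * x ^ k) * (C (n - k) * x ^ (n - k))) = (\<Sum>k\<le>n. a k * C (n - k)) * x ^ n"
      unfolding sum_distrib_right
    proof (rule sum.cong[OF refl])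
      fix k assume "k \<in> {..n}"
      then have "x ^ n = x ^ k * x ^ (n - k)" by (simp add: power_add[symmetric])
      then show "(a k * x ^ k) * (C (n - k) * x ^ (n - k)) = a k * C (n - k) * x ^ n" by simp
    qed
    then show "(\<Sum>k\<le>n. (a k * x ^ k) * (C (n - k) * x ^ (n - k))) = C n * x ^ n - (if n = 0 then 1 else 0)"
      using rec[of n] a(2) C(2) by (cases "n = 0") auto
  qed
  finally have "(\<lambda>n. C n * x ^ n - (if n = 0 then 1 else 0)) sums ((\<Sum>k. a k * x ^ k) * (\<Sum>k. C k * x ^ k))" .
  moreover have "(\<lambda>n. C n * x ^ n - (if n = 0 then 1 else 0)) sums ((\<Sum>k. C k * x ^ k) - 1)"
    using sm sums_single[of 0 "\<lambda>_. 1::real"] by (intro sums_diff) (auto simp: summable_sums)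
  ultimately have eq: "(\<Sum>k. a k * x ^ k) * (\<Sum>k. C k * x ^ k) = (\<Sum>k. C k * x ^ k) - 1"
    by (rule sums_unique2)
  have "(\<Sum>k\<in>{0}. C k * x ^ k) \<le> (\<Sum>k. C k * x ^ k)" using C x by (intro sum_le_suminf sm) auto
  then show ge1: "(\<Sum>k. C k * x ^ k) \<ge> 1" by (simp add: C)
  then show "1 - (\<Sum>k. a k * x ^ k) = 1 / (\<Sum>k. C k * x ^ k)" using eq by (simp add: field_simps)
qed

text \<open>Cutting off a single particle, M = 1, bounds each value by earlier ones with total
  weight at most \<open>suminf w * w 0\<close>, so a geometric bound propagates. It is what keeps
  rho positive.\<close>

lemma splitting_exponential_bound:
  fixes C w :: "nat \<Rightarrow> real"
  assumes C: "\<And>n. C n \<ge> 0" "C 0 = 1" and w: "\<And>i. w i \<ge> 0" "summable w"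
    and split: "\<And>N M. N \<ge> 1 \<Longrightarrow> M \<ge> 1 \<Longrightarrow>
      C (N + M) \<le> (\<Sum>i<N. w i * C (N - 1 - i)) * (\<Sum>i<M. w i * C (M - 1 - i))"
  shows "\<exists>D. \<forall>n. C n \<le> D ^ n"
proof -
  define D where "D = 1 + C 1 + suminf w * w 0"
  have sw: "suminf w \<ge> 0" using w by (intro suminf_nonneg) auto
  have D1: "D \<ge> 1" unfolding D_def using C(1)[of 1] w(1)[of 0] sw by simp
  have "C n \<le> D ^ n" for n
  proof (induction n rule: less_induct)
    case (less n)
    consider "n = 0" | "n = 1" | N where "n = N + 1" "N \<ge> 1"
      by (metis One_nat_def Suc_eq_plus1 not0_implies_Suc not_less_eq_eq zero_le)
    then show ?case
    proof cases
      case 1 then show ?thesis by (simp add: C)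
    next
      case 2 then show ?thesis using w(1)[of 0] sw by (simp add: D_def)
    next
      case 3
      have "(\<Sum>i<N. w i * C (N - 1 - i)) \<le> (\<Sum>i<N. w i * D ^ N)"
      proof (rule sum_mono)
        fix i assume "i \<in> {..<N}"
        then have "C (N - 1 - i) \<le> D ^ (N - 1 - i)" using 3 by (intro less) auto
        also have "\<dots> \<le> D ^ N" using D1 by (intro power_increasing) auto
        finally show "w i * C (N - 1 - i) \<le> w i * D ^ N" using w by (intro mult_left_mono) auto
      qed
      also have "\<dots> \<le> suminf w * D ^ N"
        unfolding sum_distrib_right[symmetric] using D1 w by (intro mult_right_mono sum_le_suminf) auto
      finally have "(\<Sum>i<N. w i * C (N - 1 - i)) * w 0 \<le> suminf w * D ^ N * w 0"
        using w by (intro mult_right_mono) auto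
      moreover have "C n \<le> (\<Sum>i<N. w i * C (N - 1 - i)) * w 0"
        using split[of N 1] 3 C(2) by simp
      moreover have "suminf w * D ^ N * w 0 \<le> D * D ^ N"
      proof -
        have "suminf w * w 0 * D ^ N \<le> D * D ^ N"
          using C(1)[of 1] D1 by (intro mult_right_mono) (auto simp: D_def)
        then show ?thesis by (simp add: algebra_simps)
      qed
      ultimately show ?thesis using 3 by simp
    qed
  qed
  then show ?thesis by blast
qed

text \<open>The analytic half of the argument. \<open>a 1 > 0\<close> serves twice: as aperiodicity
  in the renewal theorem and as a geometric lower bound on \<open>C\<close>, which makes rho
  finite.\<close>

theorem renewal_splitting_limit:
  fixes C a w :: "nat \<Rightarrow> real"
  assumes C0: "C 0 = 1" and a: "\<And>k. a k \<ge> 0" "a 0 = 0" "a 1 > 0"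
    and rec: "\<And>n. n \<ge> 1 \<Longrightarrow> C n = (\<Sum>k\<le>n. a k * C (n - k))"
    and w: "\<And>i. w i \<ge> 0" "\<And>x. x > 0 \<Longrightarrow> summable (\<lambda>i. w i * x ^ i)"
    and split: "\<And>N M. N \<ge> 1 \<Longrightarrow> M \<ge> 1 \<Longrightarrow>
      C (N + M) \<le> (\<Sum>i<N. w i * C (N - 1 - i)) * (\<Sum>i<M. w i * C (M - 1 - i))"
  shows "\<exists>L>0. (\<lambda>N. C N * exp (- lim (\<lambda>N. ln (C N) / real N)) ^ N) \<longlonglongrightarrow> L"
proof -
  have Cge: "a 1 ^ n \<le> C n" for n
  proof (induction n rule: less_induct)
    case (less n)
    show ?case
    proof (cases n)
      case 0 then show ?thesis by (simp add: C0)
    next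
      case (Suc m)
      have nn: "C k \<ge> 0" if "k < n" for k using less[OF that] a(3) by (meson less_imp_le order_trans zero_le_power)
      have "a 1 * C (n - 1) \<le> (\<Sum>k\<le>n. a k * C (n - k))"
      proof (rule member_le_sum[where f="\<lambda>k. a k * C (n - k)"])
        fix k assume "k \<in> {..n} - {1}"
        then show "0 \<le> a k * C (n - k)" using a nn[of "n - k"] Suc by (cases "k = 0") auto
      qed (use Suc in auto)
      moreover have "a 1 * a 1 ^ m \<le> a 1 * C m" using less[of m] Suc a(3) by simp
      ultimately show ?thesis using rec[of n] Suc by simp
    qed
  qed
  have Cpos: "C n > 0" for n using Cge[of n] a(3) by (meson less_le_trans zero_less_power)
  have Cnn: "C n \<ge> 0" for n using Cpos[of n] by simp
  have sw: "summable w" using w(2)[of 1] by simp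
  obtain D where D: "\<And>n. C n \<le> D ^ n"
    using splitting_exponential_bound[of C w, OF Cnn C0 w(1) sw split] by blast
  obtain \<rho> where rho: "\<rho> > 0" "\<And>x. 0 \<le> x \<Longrightarrow> x < \<rho> \<Longrightarrow> summable (\<lambda>n. C n * x ^ n)"
    "\<And>x. \<rho> < x \<Longrightarrow> \<not> summable (\<lambda>n. C n * x ^ n)"
    using nonneg_series_radius[of "a 1" C D, OF Cge D a(3)] by blast
  have "summable (\<lambda>i. w i * (2 * \<rho>) ^ i)" using w(2)[of "2 * \<rho>"] rho(1) by simp
  then obtain K where K: "\<And>n x y. \<rho> / 2 \<le> x \<Longrightarrow> x \<le> y \<Longrightarrow> y \<le> 2 * \<rho> \<Longrightarrow>
    1 / (\<Sum>k\<le>n. C k * x ^ k) - 1 / (\<Sum>k\<le>n. C k * y ^ k) \<le> K * (y - x)"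
    using inverse_partial_sums_lipschitz[of C w \<rho>, OF Cnn C0 w(1) rho(1) _ split] by blast
  \<comment> \<open>Compare x with a point y beyond rho: the truncations at y diverge, so 1 / F(y)
    disappears as the degree grows. Afterwards y decreases to rho.\<close>
  have F_bound: "1 / (\<Sum>k. C k * x ^ k) \<le> K * (\<rho> - x)" if x: "\<rho> / 2 \<le> x" "x < \<rho>" for x
  proof -
    have sx: "summable (\<lambda>n. C n * x ^ n)" using x rho(1) by (intro rho(2)) auto
    have Fx: "(\<Sum>k. C k * x ^ k) \<ge> 1"
      using x rho(1) by (intro renewal_generating_function(3)[OF Cnn C0 a(1,2) rec _ sx]) auto
    have *: "1 / (\<Sum>k. C k * x ^ k) \<le> K * (y - x)" if y: "\<rho> < y" "y \<le> 2 * \<rho>" for y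
    proof -
      have nn: "0 \<le> C k * y ^ k" for k using Cnn[of k] y rho(1) by simp
      have "filterlim (\<lambda>n. \<Sum>k\<le>n. C k * y ^ k) at_top sequentially"
      proof -
        have "\<exists>n. (\<Sum>k\<le>n. C k * y ^ k) \<ge> Z" for Z
        proof (rule ccontr)
          assume "\<nexists>n. Z \<le> (\<Sum>k\<le>n. C k * y ^ k)"
          then have "(\<Sum>k\<le>n. C k * y ^ k) \<le> Z" for n by (meson linear)
          then have "summable (\<lambda>k. C k * y ^ k)"
            using nn by (intro bounded_imp_summable) auto
          then show False using rho(3) y by simp
        qed
        moreover have "(\<Sum>k\<le>m. C k * y ^ k) \<le> (\<Sum>k\<le>n. C k * y ^ k)" if "m \<le> n" for m n
          using nn that by (intro sum_mono2) auto
        ultimately show ?thesis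
          unfolding filterlim_at_top eventually_sequentially by (meson order_trans)
      qed
      then have "(\<lambda>n. 1 / (\<Sum>k\<le>n. C k * y ^ k)) \<longlonglongrightarrow> 0"
        by (intro real_tendsto_divide_at_top[OF tendsto_const])
      moreover have "(\<lambda>n. \<Sum>k\<le>n. C k * x ^ k) \<longlonglongrightarrow> (\<Sum>k. C k * x ^ k)"
        using sx by (rule summable_LIMSEQ')
      ultimately have "(\<lambda>n. 1 / (\<Sum>k\<le>n. C k * x ^ k) - 1 / (\<Sum>k\<le>n. C k * y ^ k)) \<longlonglongrightarrow> 1 / (\<Sum>k. C k * x ^ k) - 0"
        using Fx by (intro tendsto_intros) auto
      then have "1 / (\<Sum>k. C k * x ^ k) - 0 \<le> K * (y - x)"
        by (rule LIMSEQ_le_const2) (use K x y in auto)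
      then show ?thesis by simp
    qed
    show ?thesis
    proof (rule tendsto_lowerbound[OF _ _ trivial_limit_at_right_real])
      show "((\<lambda>y. K * (y - x)) \<longlongrightarrow> K * (\<rho> - x)) (at_right \<rho>)"
        by (intro tendsto_intros)
      show "eventually (\<lambda>y. 1 / (\<Sum>k. C k * x ^ k) \<le> K * (y - x)) (at_right \<rho>)"
        using * rho(1) by (intro eventually_at_rightI[of \<rho> "2 * \<rho>"]) auto
    qed
  qed
  \<comment> \<open>Exponential tilting by rho turns the weights into a candidate probability
    distribution; that its mass is 1 and its mean finite is the content of \<open>M\<close>
    below.\<close>
  define b where "b k = a k * \<rho> ^ k" for k
  define u where "u k = C k * \<rho> ^ k" for k
  have b: "b k \<ge> 0" for k using a(1)[of k] rho(1) by (simp add: b_def)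
  have b0: "b 0 = 0" by (simp add: b_def a)
  have b1: "b 1 > 0" using a(3) rho(1) by (simp add: b_def)
  have u0: "u 0 = 1" by (simp add: u_def C0)
  have urec: "u n = (\<Sum>k\<le>n. b k * u (n - k))" if "n \<ge> 1" for n
  proof -
    have "u n = (\<Sum>k\<le>n. a k * C (n - k) * \<rho> ^ n)" using rec[OF that] by (simp add: u_def sum_distrib_right)
    also have "\<dots> = (\<Sum>k\<le>n. b k * u (n - k))"
    proof (rule sum.cong[OF refl])
      fix k assume "k \<in> {..n}"
      then have "\<rho> ^ n = \<rho> ^ k * \<rho> ^ (n - k)" by (simp add: power_add[symmetric])
      then show "a k * C (n - k) * \<rho> ^ n = b k * u (n - k)" by (simp add: b_def u_def)
    qed
    finally show ?thesis .
  qed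
  have gen: "summable (\<lambda>k. b k * t ^ k) \<and> (\<Sum>k. b k * t ^ k) < 1 \<and> 1 - (\<Sum>k. b k * t ^ k) \<le> (K * \<rho>) * (1 - t)"
    if t: "1/2 \<le> t" "t < 1" for t
  proof -
    have bt: "b k * t ^ k = a k * (\<rho> * t) ^ k" for k by (simp add: b_def power_mult_distrib)
    have x: "\<rho> / 2 \<le> \<rho> * t" "\<rho> * t < \<rho>" "0 \<le> \<rho> * t" using t rho(1) by auto
    have sx: "summable (\<lambda>n. C n * (\<rho> * t) ^ n)" using x by (intro rho(2))
    note G = renewal_generating_function[OF Cnn C0 a(1,2) rec x(3) sx]
    have "0 < 1 / (\<Sum>k. C k * (\<rho> * t) ^ k)" using G(3) by simp
    moreover have "K * (\<rho> - \<rho> * t) = (K * \<rho>) * (1 - t)" by (simp add: algebra_simps)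
    ultimately show ?thesis unfolding bt using G(1,2) F_bound[OF x(1,2)] by linarith
  qed
  note M = renewal_mean_bound[of b "K * \<rho>", OF b conjunct1[OF gen] conjunct1[OF conjunct2[OF gen]]
      conjunct2[OF conjunct2[OF gen]]]
  have u1: "0 \<le> u n \<and> u n \<le> 1" for n
  proof (induction n rule: less_induct)
    case (less n)
    show ?case
    proof (cases "n = 0")
      case True then show ?thesis by (simp add: u0)
    next
      case False
      have k: "0 \<le> b k * u (n - k) \<and> b k * u (n - k) \<le> b k" if "k \<le> n" for k
      proof (cases "k = 0")
        case True then show ?thesis by (simp add: b0)
      next
        case k: False
        then have "0 \<le> u (n - k)" "u (n - k) \<le> 1" using less[of "n - k"] False by auto
        then show ?thesis using b[of k] by (simp add: mult_left_le)
      qed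
      have "(\<Sum>k\<le>n. b k * u (n - k)) \<le> (\<Sum>k\<le>n. b k)" using k by (intro sum_mono) auto
      then show ?thesis using urec[of n] False k M(2)[of n] by (auto intro!: sum_nonneg)
    qed
  qed
  define r where "r k = 1 - (\<Sum>i\<le>k. b i)" for k
  have r0: "r k \<ge> 0" for k using M(2) by (simp add: r_def)
  have rs: "summable r" using M(3) by (simp add: r_def[abs_def])
  have "(\<Sum>k\<in>{0}. r k) \<le> suminf r" using r0 by (intro sum_le_suminf rs) auto
  then have rpos: "suminf r > 0" by (simp add: r_def b0)
  have ulim: "u \<longlonglongrightarrow> 1 / suminf r"
  proof (rule renewal_convergence[OF b b1 M(1) r0 rs rpos _ urec])
    show "\<bar>u m\<bar> \<le> 1" for m using u1[of m] by simp
    show "(\<Sum>k\<le>m. r k * u (m - k)) = 1" for m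
      unfolding r_def by (rule renewal_tail_sum[OF b0 u0 urec])
  qed
  \<comment> \<open>As \<open>u\<close> has a positive limit, its logarithm contributes nothing per
    particle. So the \<open>lim\<close> in the statement is a genuine limit, and the exponential of
    its negative is rho.\<close>
  have "(\<lambda>N. ln (u N) * (1 / real N) - ln \<rho>) \<longlonglongrightarrow> ln (1 / suminf r) * 0 - ln \<rho>"
    using ulim rpos by (intro tendsto_intros lim_1_over_n) auto
  moreover have "eventually (\<lambda>N. ln (u N) * (1 / real N) - ln \<rho> = ln (C N) / real N) sequentially"
    using eventually_gt_at_top[of 0]
  proof eventually_elim
    case (elim N)
    have "ln (u N) = ln (C N) + real N * ln \<rho>"
      using Cpos[of N] rho(1) by (simp add: u_def ln_mult ln_realpow)
    then show ?case using elim by (simp add: field_simps)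
  qed
  ultimately have "(\<lambda>N. ln (C N) / real N) \<longlonglongrightarrow> ln (1 / suminf r) * 0 - ln \<rho>"
    by (rule Lim_transform_eventually)
  then have "(\<lambda>N. ln (C N) / real N) \<longlonglongrightarrow> - ln \<rho>" by (simp only: mult_zero_right diff_0)
  then have "lim (\<lambda>N. ln (C N) / real N) = - ln \<rho>" by (rule limI)
  then have "(\<lambda>N. C N * exp (- lim (\<lambda>N. ln (C N) / real N)) ^ N) = u"
    using rho(1) by (simp add: u_def fun_eq_iff)
  then show ?thesis using ulim rpos by (intro exI[of _ "1 / suminf r"]) auto
qed

section \<open>Tournament expansion of the Vandermonde product\<close>

text \<open>The games of a tournament in which every two players meet \<open>p\<close> times, one
  game for each linear factor of the \<open>p\<close>-th power of the Vandermonde product;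
  \<open>c\<close> numbers the rounds.\<close>

definition edges :: "nat \<Rightarrow> nat set \<Rightarrow> (nat \<times> nat \<times> nat) set" where
  "edges p S = {(k, j, c). k \<in> S \<and> j \<in> S \<and> j < k \<and> c < p}"

text \<open>\<open>T\<close> collects the factors \<open>w k - w j\<close> from which the term
  \<open>- w j\<close> is chosen. The winner is thus the index whose variable is picked up, a score
  is an exponent, and \<open>card T\<close> carries the sign.\<close>

definition winner :: "(nat \<times> nat \<times> nat) set \<Rightarrow> nat \<times> nat \<times> nat \<Rightarrow> nat" where
  "winner T e = (if e \<in> T then fst (snd e) else fst e)"

definition score :: "nat \<Rightarrow> nat set \<Rightarrow> (nat \<times> nat \<times> nat) set \<Rightarrow> nat \<Rightarrow> nat" where
  "score p S T v = card {e \<in> edges p S. winner T e = v}"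

text \<open>The restriction makes a score vector determined by its values on \<open>S\<close>, so
  that distinct vectors differ at some player; orthogonality needs this later.\<close>

definition scores :: "nat \<Rightarrow> nat set \<Rightarrow> (nat \<Rightarrow> nat) set" where
  "scores p S = (\<lambda>T. restrict (score p S T) S) ` Pow (edges p S)"

definition coef :: "nat \<Rightarrow> nat set \<Rightarrow> (nat \<Rightarrow> nat) \<Rightarrow> real" where
  "coef p S m = (\<Sum>T | T \<subseteq> edges p S \<and> (\<forall>v\<in>S. score p S T v = m v). (-1) ^ card T)"

text \<open>The equality case of Landau's inequality: the players of \<open>A\<close> always win at
  least as many games as they play among themselves, with equality exactly when they lose every game
  against outsiders.\<close>

definition tight :: "nat \<Rightarrow> nat set \<Rightarrow> (nat \<Rightarrow> nat) \<Rightarrow> bool" where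
  "tight p A m \<longleftrightarrow> (\<Sum>v\<in>A. m v) = card (edges p A)"

lemma edges_eq_Sigma: "edges p S = Sigma S (\<lambda>k. {j\<in>S. j < k} \<times> {..<p})"
  by (auto simp: edges_def)

lemma finite_edges [simp]: "finite S \<Longrightarrow> finite (edges p S)"
  by (auto simp: edges_eq_Sigma)

lemma edges_mono: "A \<subseteq> S \<Longrightarrow> edges p A \<subseteq> edges p S"
  by (auto simp: edges_def)

lemma winner_in: "e \<in> edges p S \<Longrightarrow> winner T e \<in> S"
  by (auto simp: edges_def winner_def)

lemma finite_scores [simp]: "finite S \<Longrightarrow> finite (scores p S)"
  by (simp add: scores_def)

lemma scores_extensional: "m \<in> scores p S \<Longrightarrow> m \<in> extensional S"
  by (auto simp: scores_def)

lemma card_incident_edges: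
  assumes "v \<in> S" "B \<subseteq> S - {v}"
  shows "card {(k, j, c) \<in> edges p S. k = v \<and> j \<in> B \<or> j = v \<and> k \<in> B} = p * card B"
proof -
  let ?f = "\<lambda>(b, c). (max b v, min b v, c)"
  let ?I = "{(k, j, c) \<in> edges p S. k = v \<and> j \<in> B \<or> j = v \<and> k \<in> B}"
  have "bij_betw ?f (B \<times> {..<p})
      ?I"
    unfolding bij_betw_def
  proof
    show "inj_on ?f (B \<times> {..<p})"
      by (auto simp: inj_on_def max_def min_def split: if_splits)
    have m1: "(k, j, c) \<in> ?f ` (B \<times> {..<p})"
      if "(k, j, c) \<in> edges p S" "k = v \<and> j \<in> B \<or> j = v \<and> k \<in> B" for k j c
    proof (cases "k = v \<and> j \<in> B")
      case True
      then show ?thesis using that by (intro image_eqI[of _ _ "(j, c)"]) (auto simp: edges_def)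
    next
      case False
      then show ?thesis using that by (intro image_eqI[of _ _ "(k, c)"]) (auto simp: edges_def)
    qed
    have m2: "(max b v, min b v, c) \<in> ?I"
      if "b \<in> B" "c < p" for b c
      using that assms by (cases "b < v") (auto simp: edges_def max_def min_def)
    show "?f ` (B \<times> {..<p})
        = ?I"
    proof (intro equalityI subsetI)
      fix e assume "e \<in> ?f ` (B \<times> {..<p})"
      then obtain b c where "b \<in> B" "c < p" "e = (max b v, min b v, c)" by auto
      then show "e \<in> ?I"
        using m2[of b c] by (simp only:)
    next
      fix e assume e: "e \<in> ?I"
      obtain k j c where "e = (k, j, c)" by (cases e)
      then show "e \<in> ?f ` (B \<times> {..<p})"
        using m1[of k j c] e by simp
    qed
  qed
  then have "card (B \<times> {..<p}) = card ?I"
    by (rule bij_betw_same_card)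
  then show ?thesis by (simp add: card_cartesian_product mult.commute)
qed

lemma card_edges:
  assumes "finite S"
  shows "card (edges p S) = p * (\<Sum>j<card S. j)"
  using assms
proof (induction S rule: finite_induct)
  case empty then show ?case by (simp add: edges_eq_Sigma)
next
  case (insert x S)
  let ?I = "{(k, j, c) \<in> edges p (insert x S). k = x \<and> j \<in> S \<or> j = x \<and> k \<in> S}"
  have I: "card ?I = p * card S" using insert by (intro card_incident_edges) auto
  have eq: "edges p (insert x S) = edges p S \<union> ?I" by (auto simp: edges_def)
  have fin: "finite ?I" by (rule finite_subset[of _ "edges p (insert x S)"]) (use insert in auto)
  have "card (edges p (insert x S)) = card (edges p S) + card ?I"
    by (subst eq, rule card_Un_disjoint[OF finite_edges[OF insert(1)] fin])
      (use insert(2) in \<open>auto simp: edges_def\<close>)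
  then show ?case using insert I by (simp add: distrib_left)
qed

lemma sum_score:
  assumes "finite S" "A \<subseteq> S"
  shows "(\<Sum>v\<in>A. score p S T v) = card {e \<in> edges p S. winner T e \<in> A}"
proof -
  have finA: "finite A" using assms finite_subset by blast
  have "card (\<Union>v\<in>A. {e \<in> edges p S. winner T e = v}) = (\<Sum>v\<in>A. card {e \<in> edges p S. winner T e = v})"
    using assms finA by (intro card_UN_disjoint) auto
  moreover have "(\<Union>v\<in>A. {e \<in> edges p S. winner T e = v}) = {e \<in> edges p S. winner T e \<in> A}" by auto
  ultimately show ?thesis by (simp add: score_def)
qed

lemma sum_scores:
  assumes "finite S" "m \<in> scores p S"
  shows "(\<Sum>v\<in>S. m v) = card (edges p S)"
proof -
  obtain T where T: "m = restrict (score p S T) S" using assms(2) by (auto simp: scores_def)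
  have "{e \<in> edges p S. winner T e \<in> S} = edges p S" by (auto dest: winner_in)
  then show ?thesis using sum_score[OF assms(1) order_refl, of p T] by (simp add: T)
qed

text \<open>Multiply out one factor per game. Tournaments with equal scores are collected with their
  signs in \<open>coef\<close>, so all cancellation is retained and every later decomposition has to
  respect it.\<close>

lemma vandermonde_power_expansion:
  fixes w :: "nat \<Rightarrow> complex"
  assumes "finite S"
  shows "(\<Prod>k\<in>S. \<Prod>j\<in>{j\<in>S. j < k}. (w k - w j) ^ p) =
    (\<Sum>m\<in>scores p S. of_real (coef p S m) * (\<Prod>v\<in>S. w v ^ m v))"
proof -
  let ?E = "edges p S"
  have "(\<Prod>k\<in>S. \<Prod>j\<in>{j\<in>S. j < k}. (w k - w j) ^ p) = (\<Prod>k\<in>S. \<Prod>q\<in>{j\<in>S. j < k} \<times> {..<p}. w k - w (fst q))"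
  proof (rule prod.cong[OF refl])
    fix k
    show "(\<Prod>j\<in>{j\<in>S. j < k}. (w k - w j) ^ p) = (\<Prod>q\<in>{j\<in>S. j < k} \<times> {..<p}. w k - w (fst q))"
      using prod.cartesian_product[of "\<lambda>j c. w k - w j" "{..<p}" "{j\<in>S. j < k}"]
      by (simp add: split_def)
  qed
  also have "\<dots> = (\<Prod>e\<in>?E. w (fst e) - w (fst (snd e)))"
    unfolding edges_eq_Sigma using assms by (subst prod.Sigma) (auto simp: split_def)
  also have "\<dots> = (\<Prod>e\<in>?E. - w (fst (snd e)) + w (fst e))" by (simp add: algebra_simps)
  also have "\<dots> = (\<Sum>T\<in>Pow ?E. (\<Prod>e\<in>T. - w (fst (snd e))) * (\<Prod>e\<in>?E - T. w (fst e)))"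
    using assms by (intro prod_add) auto
  also have "\<dots> = (\<Sum>T\<in>Pow ?E. (-1) ^ card T * (\<Prod>v\<in>S. w v ^ score p S T v))"
  proof (rule sum.cong[OF refl])
    fix T assume "T \<in> Pow ?E"
    then have T: "T \<subseteq> ?E" "finite T" using assms by (auto intro: finite_subset)
    have "(\<Prod>e\<in>T. - w (fst (snd e))) = (-1) ^ card T * (\<Prod>e\<in>T. w (fst (snd e)))"
      using prod.distrib[of "\<lambda>e. -1" "\<lambda>e. w (fst (snd e))" T] by simp
    moreover have "(\<Prod>e\<in>T. w (fst (snd e))) * (\<Prod>e\<in>?E - T. w (fst e)) = (\<Prod>e\<in>?E. w (winner T e))"
    proof -
      have "(\<Prod>e\<in>?E. w (winner T e)) = (\<Prod>e\<in>?E - T. w (winner T e)) * (\<Prod>e\<in>T. w (winner T e))"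
        using T assms by (intro prod.subset_diff) auto
      then show ?thesis by (simp add: winner_def mult.commute)
    qed
    moreover have "(\<Prod>e\<in>?E. w (winner T e)) = (\<Prod>v\<in>S. \<Prod>e\<in>{e \<in> ?E. winner T e = v}. w (winner T e))"
      using assms by (intro prod.group[symmetric]) (auto dest: winner_in)
    ultimately show "(\<Prod>e\<in>T. - w (fst (snd e))) * (\<Prod>e\<in>?E - T. w (fst e)) =
        (-1) ^ card T * (\<Prod>v\<in>S. w v ^ score p S T v)"
      by (simp add: score_def)
  qed
  also have "\<dots> = (\<Sum>m\<in>scores p S. \<Sum>T\<in>{T \<in> Pow ?E. restrict (score p S T) S = m}.
      (-1) ^ card T * (\<Prod>v\<in>S. w v ^ score p S T v))"
    unfolding scores_def using assms by (intro sum.image_gen) auto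
  also have "\<dots> = (\<Sum>m\<in>scores p S. of_real (coef p S m) * (\<Prod>v\<in>S. w v ^ m v))"
  proof (rule sum.cong[OF refl])
    fix m assume m: "m \<in> scores p S"
    have "{T \<in> Pow ?E. restrict (score p S T) S = m} = {T. T \<subseteq> ?E \<and> (\<forall>v\<in>S. score p S T v = m v)}"
      using scores_extensional[OF m] by (auto intro!: extensionalityI[where A=S])
    moreover have "(\<Sum>T | T \<subseteq> ?E \<and> (\<forall>v\<in>S. score p S T v = m v). (-1) ^ card T * (\<Prod>v\<in>S. w v ^ score p S T v))
        = (\<Sum>T | T \<subseteq> ?E \<and> (\<forall>v\<in>S. score p S T v = m v). (-1) ^ card T * (\<Prod>v\<in>S. w v ^ m v))"
      by (intro sum.cong refl) (auto intro!: prod.cong)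
    ultimately show "(\<Sum>T\<in>{T \<in> Pow ?E. restrict (score p S T) S = m}.
      (-1) ^ card T * (\<Prod>v\<in>S. w v ^ score p S T v)) = of_real (coef p S m) * (\<Prod>v\<in>S. w v ^ m v)"
      by (simp add: coef_def sum_distrib_right)
  qed
  finally show ?thesis .
qed

text \<open>Internal games are always among those won by members of \<open>A\<close>; equal
  cardinalities leave no room for a win against an outsider.\<close>

lemma tight_score_iff:
  assumes "finite S" "A \<subseteq> S"
  shows "tight p A (score p S T) \<longleftrightarrow> (\<forall>e\<in>edges p S. winner T e \<in> A \<longrightarrow> e \<in> edges p A)"
proof -
  let ?X = "{e \<in> edges p S. winner T e \<in> A}"
  have sub: "edges p A \<subseteq> ?X" using edges_mono[OF assms(2)] by (auto dest: winner_in)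
  have fin: "finite ?X" using assms by simp
  have "tight p A (score p S T) \<longleftrightarrow> card ?X = card (edges p A)"
    by (simp add: tight_def sum_score[OF assms])
  also have "\<dots> \<longleftrightarrow> ?X = edges p A"
    using card_subset_eq[OF fin sub] by auto
  also have "\<dots> \<longleftrightarrow> (\<forall>e\<in>edges p S. winner T e \<in> A \<longrightarrow> e \<in> edges p A)"
    using sub by auto
  finally show ?thesis .
qed

lemma winner_Int_edges: "e \<in> edges p A \<Longrightarrow> winner (T \<inter> edges p A) e = winner T e"
  by (simp add: winner_def)

lemma score_tight_inside:
  assumes S: "finite S" "A \<subseteq> S" and t: "tight p A (score p S T)" and v: "v \<in> A"
  shows "score p S T v = score p A (T \<inter> edges p A) v"
proof -
  have "{e \<in> edges p S. winner T e = v} = {e \<in> edges p A. winner (T \<inter> edges p A) e = v}"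
    using t v edges_mono[OF S(2), of p] unfolding tight_score_iff[OF S] by (auto simp: winner_Int_edges)
  then show ?thesis by (simp add: score_def)
qed

text \<open>An outsider wins all its games against a tight \<open>A\<close>. That this offset is the
  same for all outsiders is what makes the remaining tournament one of the same kind, up to a common
  shift.\<close>

lemma score_tight_outside:
  assumes S: "finite S" "A \<subseteq> S" and t: "tight p A (score p S T)" and v: "v \<in> S - A"
  shows "score p S T v = score p (S - A) (T \<inter> edges p (S - A)) v + p * card A"
proof -
  let ?D = "edges p (S - A)"
  let ?I = "{(k, j, c) \<in> edges p S. k = v \<and> j \<in> A \<or> j = v \<and> k \<in> A}"
  have t': "\<And>e. e \<in> edges p S \<Longrightarrow> winner T e \<in> A \<Longrightarrow> e \<in> edges p A"
    using t by (simp add: tight_score_iff[OF S])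
  have "{e \<in> edges p S. winner T e = v} = {e \<in> ?D. winner (T \<inter> ?D) e = v} \<union> ?I"
  proof (intro equalityI subsetI)
    fix e assume e: "e \<in> {e \<in> edges p S. winner T e = v}"
    obtain k j c where kj: "e = (k, j, c)" by (cases e)
    show "e \<in> {e \<in> ?D. winner (T \<inter> ?D) e = v} \<union> ?I"
    proof (cases "e \<in> ?D")
      case True then show ?thesis using e by (simp add: winner_Int_edges)
    next
      case False
      then show ?thesis using e kj v by (auto simp: edges_def winner_def split: if_splits)
    qed
  next
    fix e assume e: "e \<in> {e \<in> ?D. winner (T \<inter> ?D) e = v} \<union> ?I"
    obtain k j c where kj: "e = (k, j, c)" by (cases e)
    show "e \<in> {e \<in> edges p S. winner T e = v}"
    proof (cases "e \<in> ?D")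
      case True
      then have "e \<notin> ?I" by (auto simp: edges_def)
      then have "winner (T \<inter> ?D) e = v" using e by blast
      then have "winner T e = v" by (simp only: winner_Int_edges[OF True])
      then show ?thesis using True edges_mono[of "S - A" S p] by auto
    next
      case False
      then have I: "e \<in> ?I" using e by auto
      then have eS: "e \<in> edges p S" by auto
      have "e \<notin> edges p A" using I v by (auto simp: edges_def)
      then have "winner T e \<notin> A" using t' eS by blast
      then show ?thesis using I eS kj v by (auto simp: winner_def split: if_splits)
    qed
  qed
  moreover have "{e \<in> ?D. winner (T \<inter> ?D) e = v} \<inter> ?I = {}" by (auto simp: edges_def)
  moreover have "finite ?I" by (rule finite_subset[of _ "edges p S"]) (use S in auto)
  moreover have "card ?I = p * card A" using S v by (intro card_incident_edges) auto
  ultimately show ?thesis using S by (simp add: score_def card_Un_disjoint)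
qed

lemma score_le:
  assumes A: "finite A" "v \<in> A"
  shows "score p A T v \<le> p * (card A - 1)"
proof -
  let ?I = "{(k, j, c) \<in> edges p A. k = v \<and> j \<in> A - {v} \<or> j = v \<and> k \<in> A - {v}}"
  have "score p A T v \<le> card ?I"
    unfolding score_def
  proof (rule card_mono)
    show "finite ?I" by (rule finite_subset[of _ "edges p A"]) (use A in auto)
    show "{e \<in> edges p A. winner T e = v} \<subseteq> ?I" by (auto simp: edges_def winner_def split: if_splits)
  qed
  also have "\<dots> = p * card (A - {v})" using A by (intro card_incident_edges) auto
  finally show ?thesis using A by simp
qed

text \<open>A player of \<open>A\<close> outside \<open>B\<close> would have beaten all of
  \<open>B\<close>, hence \<open>p * card B\<close> wins, while a member of the tight set
  \<open>A\<close> has at most \<open>p * (card A - 1)\<close>. So the tight sets of a tournament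
  form a chain, and the smallest nonempty one is unique.\<close>

lemma tight_subset:
  assumes S: "finite S" "A \<subseteq> S" "B \<subseteq> S" and p: "p \<ge> 1"
    and t: "tight p A (score p S T)" "tight p B (score p S T)" and c: "card A \<le> card B"
  shows "A \<subseteq> B"
proof
  fix v assume v: "v \<in> A"
  have finA: "finite A" using S finite_subset by blast
  show "v \<in> B"
  proof (rule ccontr)
    assume "v \<notin> B"
    then have "p * card B \<le> score p S T v" using score_tight_outside[OF S(1,3) t(2), of v] v S by auto
    also have "\<dots> \<le> p * (card A - 1)"
      using score_tight_inside[OF S(1,2) t(1) v] score_le[OF finA v] by simp
    finally have "card B \<le> card A - 1" using p by simp
    moreover have "card A > 0" using finA v card_gt_0_iff by blast
    ultimately show False using c by simp
  qed
qed

section \<open>Gluing tournaments along a tight set\<close>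

definition downhill :: "nat \<Rightarrow> nat set \<Rightarrow> nat set \<Rightarrow> (nat \<times> nat \<times> nat) set" where
  "downhill p S A = {e \<in> edges p S. fst e \<in> A \<and> fst (snd e) \<notin> A}"

text \<open>The results of the crossing games are prescribed: the outsider wins. In the encoding by
  \<open>winner\<close>, a crossing game then belongs to \<open>T\<close> exactly when its larger
  index lies in \<open>A\<close>, which is \<open>downhill\<close>.\<close>

lemma glue_tournaments:
  assumes S: "finite S" "A \<subseteq> S" and T: "T1 \<subseteq> edges p A" "T2 \<subseteq> edges p (S - A)"
  defines "T \<equiv> T1 \<union> T2 \<union> downhill p S A"
  shows "T \<subseteq> edges p S" "T \<inter> edges p A = T1" "T \<inter> edges p (S - A) = T2"
    "tight p A (score p S T)" "card T = card T1 + card T2 + card (downhill p S A)"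
proof -
  let ?X = "downhill p S A"
  have X: "?X \<subseteq> edges p S" "?X \<inter> edges p A = {}" "?X \<inter> edges p (S - A) = {}"
    by (auto simp: downhill_def edges_def)
  have D: "edges p A \<inter> edges p (S - A) = {}" by (auto simp: edges_def)
  show "T \<subseteq> edges p S" using T X edges_mono[OF S(2), of p] edges_mono[of "S - A" S p] by (auto simp: T_def)
  show "T \<inter> edges p A = T1" "T \<inter> edges p (S - A) = T2" using T X D by (auto simp: T_def)
  show "tight p A (score p S T)"
    unfolding tight_score_iff[OF S]
  proof (intro ballI impI)
    fix e assume e: "e \<in> edges p S" "winner T e \<in> A"
    obtain k j c where kj: "e = (k, j, c)" by (cases e)
    show "e \<in> edges p A"
    proof (rule ccontr)
      assume nA: "e \<notin> edges p A"
      show False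
      proof (cases "e \<in> T")
        case True
        then have "e \<in> T2 \<or> e \<in> ?X" using nA T by (auto simp: T_def)
        then have "j \<notin> A" using T kj by (auto simp: downhill_def edges_def)
        then show False using e True kj by (simp add: winner_def)
      next
        case False
        then have "k \<in> A" "e \<notin> ?X" using e kj by (auto simp: winner_def T_def)
        then have "j \<in> A" using e kj by (auto simp: downhill_def)
        then show False using nA e kj \<open>k \<in> A\<close> by (auto simp: edges_def)
      qed
    qed
  qed
  have fin: "finite (edges p A)" "finite (edges p (S - A))" "finite (edges p S)"
    using S finite_subset[OF S(2,1)] by auto
  then have finT: "finite T1" "finite T2" "finite ?X" using T X finite_subset by blast+
  have "card T = card (T1 \<union> T2) + card ?X"
    unfolding T_def using finT X T by (intro card_Un_disjoint) auto
  also have "card (T1 \<union> T2) = card T1 + card T2"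
    using finT D T by (intro card_Un_disjoint) auto
  finally show "card T = card T1 + card T2 + card ?X" .
qed

lemma tight_tournament_split:
  assumes S: "finite S" "A \<subseteq> S" and T: "T \<subseteq> edges p S" and t: "tight p A (score p S T)"
  shows "T = (T \<inter> edges p A) \<union> (T \<inter> edges p (S - A)) \<union> downhill p S A"
proof -
  have t': "\<And>e. e \<in> edges p S \<Longrightarrow> winner T e \<in> A \<Longrightarrow> e \<in> edges p A"
    using t by (simp add: tight_score_iff[OF S])
  have "e \<in> T" if e: "e \<in> downhill p S A" for e
  proof (rule ccontr)
    assume "e \<notin> T"
    then have "e \<in> edges p A" using e by (intro t') (auto simp: downhill_def winner_def)
    then show False using e by (auto simp: downhill_def edges_def)
  qed
  moreover have "e \<in> edges p A \<union> edges p (S - A) \<union> downhill p S A" if e: "e \<in> T" for e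
  proof -
    obtain k j c where kj: "e = (k, j, c)" by (cases e)
    have eS: "e \<in> edges p S" using e T by auto
    show ?thesis
    proof (cases "j \<in> A")
      case True
      then have "e \<in> edges p A" using e kj eS by (intro t') (auto simp: winner_def)
      then show ?thesis by simp
    next
      case False
      then show ?thesis using eS kj by (auto simp: edges_def downhill_def)
    qed
  qed
  ultimately show ?thesis by blast
qed

lemma tight_cong: "(\<And>v. v \<in> A \<Longrightarrow> m v = m' v) \<Longrightarrow> tight p A m \<longleftrightarrow> tight p A m'"
  by (simp add: tight_def cong: sum.cong)

text \<open>Tournaments for which \<open>A\<close> is tight correspond to pairs of tournaments on
  \<open>A\<close> and on its complement, and the crossing games give all of them the same sign.
  Hence the signed counts factorise in spite of cancellation, and the sign will vanish in the
  square.\<close>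

lemma coef_glue:
  assumes S: "finite S" "A \<subseteq> S" and m1: "(\<Sum>v\<in>A. m1 v) = card (edges p A)"
    and m: "\<And>v. v \<in> A \<Longrightarrow> m v = m1 v" "\<And>v. v \<in> S - A \<Longrightarrow> m v = m2 v + p * card A"
  shows "coef p S m = (-1) ^ card (downhill p S A) * coef p A m1 * coef p (S - A) m2"
proof -
  define TT where "TT S m = {T. T \<subseteq> edges p S \<and> (\<forall>v\<in>S. score p S T v = m v)}" for S and m :: "nat \<Rightarrow> nat"
  let ?h = "\<lambda>(T1, T2). T1 \<union> T2 \<union> downhill p S A"
  have tight_TT: "tight p A (score p S T)" if "T \<in> TT S m" for T
    using that m1 m(1) S(2) by (auto simp: TT_def tight_def subset_iff cong: sum.cong)
  have "bij_betw ?h (TT A m1 \<times> TT (S - A) m2) (TT S m)"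
  proof (rule bij_betw_byWitness[where f'="\<lambda>T. (T \<inter> edges p A, T \<inter> edges p (S - A))"])
    show "\<forall>q\<in>TT A m1 \<times> TT (S - A) m2. (?h q \<inter> edges p A, ?h q \<inter> edges p (S - A)) = q"
    proof
      fix q assume "q \<in> TT A m1 \<times> TT (S - A) m2"
      then obtain T1 T2 where q: "q = (T1, T2)" "T1 \<subseteq> edges p A" "T2 \<subseteq> edges p (S - A)" by (auto simp: TT_def)
      show "(?h q \<inter> edges p A, ?h q \<inter> edges p (S - A)) = q"
        using glue_tournaments(2,3)[OF S q(2,3)] by (simp only: q(1) split_conv)
    qed
    show "\<forall>T\<in>TT S m. ?h (T \<inter> edges p A, T \<inter> edges p (S - A)) = T"
      using tight_tournament_split[OF S] tight_TT by (simp add: TT_def)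
    show "?h ` (TT A m1 \<times> TT (S - A) m2) \<subseteq> TT S m"
    proof clarify
      fix T1 T2 assume T: "T1 \<in> TT A m1" "T2 \<in> TT (S - A) m2"
      define T where "T = T1 \<union> T2 \<union> downhill p S A"
      have sub: "T1 \<subseteq> edges p A" "T2 \<subseteq> edges p (S - A)" using T by (auto simp: TT_def)
      note G = glue_tournaments[OF S sub, folded T_def]
      have "score p S T v = m v" if "v \<in> S" for v
      proof (cases "v \<in> A")
        case True
        then show ?thesis using score_tight_inside[OF S G(4) True] T m by (simp add: G TT_def)
      next
        case False
        then show ?thesis using score_tight_outside[OF S G(4), of v] T m that by (simp add: G TT_def)
      qed
      then show "T1 \<union> T2 \<union> downhill p S A \<in> TT S m" using G(1) by (simp add: TT_def T_def)
    qed
    show "(\<lambda>T. (T \<inter> edges p A, T \<inter> edges p (S - A))) ` TT S m \<subseteq> TT A m1 \<times> TT (S - A) m2"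
    proof (rule image_subsetI)
      fix T assume T: "T \<in> TT S m"
      note t = tight_TT[OF T]
      have "score p A (T \<inter> edges p A) v = m1 v" if "v \<in> A" for v
        using score_tight_inside[OF S t that] T m that S by (auto simp: TT_def)
      moreover have "score p (S - A) (T \<inter> edges p (S - A)) v = m2 v" if "v \<in> S - A" for v
        using score_tight_outside[OF S t that] T m that S by (auto simp: TT_def)
      ultimately show "(T \<inter> edges p A, T \<inter> edges p (S - A)) \<in> TT A m1 \<times> TT (S - A) m2"
        by (auto simp: TT_def)
    qed
  qed
  then have "(\<Sum>T\<in>TT S m. (-1) ^ card T) = (\<Sum>q\<in>TT A m1 \<times> TT (S - A) m2. (-1::real) ^ card (?h q))"
    by (rule sum.reindex_bij_betw[symmetric])
  also have "\<dots> = (\<Sum>q\<in>TT A m1 \<times> TT (S - A) m2. (-1) ^ card (downhill p S A) * ((-1) ^ card (fst q) * (-1) ^ card (snd q)))"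
  proof (rule sum.cong[OF refl])
    fix q assume "q \<in> TT A m1 \<times> TT (S - A) m2"
    then obtain T1 T2 where q: "q = (T1, T2)" "T1 \<subseteq> edges p A" "T2 \<subseteq> edges p (S - A)" by (auto simp: TT_def)
    show "(-1::real) ^ card (?h q) = (-1) ^ card (downhill p S A) * ((-1) ^ card (fst q) * (-1) ^ card (snd q))"
      using glue_tournaments(5)[OF S q(2,3)] by (simp add: q(1) power_add)
  qed
  also have "\<dots> = (-1) ^ card (downhill p S A) * ((\<Sum>T\<in>TT A m1. (-1) ^ card T) * (\<Sum>T\<in>TT (S - A) m2. (-1) ^ card T))"
    by (simp only: sum_distrib_left[symmetric]) (simp add: sum_product sum.cartesian_product split_def)
  finally show ?thesis by (simp add: coef_def TT_def)
qed

text \<open>The score vectors of strongly connected tournaments.\<close>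

definition irr_scores :: "nat \<Rightarrow> nat set \<Rightarrow> (nat \<Rightarrow> nat) set" where
  "irr_scores p A = {m \<in> scores p A. \<forall>B. B \<subset> A \<longrightarrow> B \<noteq> {} \<longrightarrow> \<not> tight p B m}"

definition glue :: "nat \<Rightarrow> nat set \<Rightarrow> nat set \<Rightarrow> (nat \<Rightarrow> nat) \<times> (nat \<Rightarrow> nat) \<Rightarrow> nat \<Rightarrow> nat" where
  "glue p S A q = restrict (\<lambda>v. if v \<in> A then fst q v else snd q v + p * card A) S"

lemma bij_betw_glue:
  assumes S: "finite S" "A \<subseteq> S"
  shows "bij_betw (glue p S A) (irr_scores p A \<times> scores p (S - A))
    {m \<in> scores p S. tight p A m \<and> (\<forall>B. B \<subset> A \<longrightarrow> B \<noteq> {} \<longrightarrow> \<not> tight p B m)}"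
  unfolding bij_betw_def
proof
  have finA: "finite A" using S finite_subset by blast
  show "inj_on (glue p S A) (irr_scores p A \<times> scores p (S - A))"
  proof (rule inj_onI, clarify)
    fix m1 m2 m1' m2'
    assume m: "m1 \<in> irr_scores p A" "m1' \<in> irr_scores p A"
      "m2 \<in> scores p (S - A)" "m2' \<in> scores p (S - A)"
      and eq: "glue p S A (m1, m2) = glue p S A (m1', m2')"
    have ext: "m1 \<in> extensional A" "m1' \<in> extensional A" "m2 \<in> extensional (S - A)" "m2' \<in> extensional (S - A)"
      using m by (auto simp: irr_scores_def scores_extensional)
    have "m1 v = m1' v" if "v \<in> A" for v
      using fun_cong[OF eq, of v] that S by (auto simp: glue_def)
    moreover have "m2 v = m2' v" if "v \<in> S - A" for v
      using fun_cong[OF eq, of v] that S by (auto simp: glue_def)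
    ultimately show "m1 = m1' \<and> m2 = m2'" using ext by (auto intro!: extensionalityI)
  qed
  show "glue p S A ` (irr_scores p A \<times> scores p (S - A)) =
    {m \<in> scores p S. tight p A m \<and> (\<forall>B. B \<subset> A \<longrightarrow> B \<noteq> {} \<longrightarrow> \<not> tight p B m)}" (is "?L = ?R")
  proof
    show "?L \<subseteq> ?R"
    proof clarify
      fix m1 m2 assume m: "m1 \<in> irr_scores p A" "m2 \<in> scores p (S - A)"
      then obtain T1 T2 where T: "T1 \<subseteq> edges p A" "m1 = restrict (score p A T1) A"
        "T2 \<subseteq> edges p (S - A)" "m2 = restrict (score p (S - A) T2) (S - A)"
        by (auto simp: irr_scores_def scores_def)
      define T where "T = T1 \<union> T2 \<union> downhill p S A"
      note G = glue_tournaments[OF S T(1,3), folded T_def]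
      have eq: "glue p S A (m1, m2) = restrict (score p S T) S"
      proof
        fix v
        show "glue p S A (m1, m2) v = restrict (score p S T) S v"
          using score_tight_inside[OF S G(4), of v] score_tight_outside[OF S G(4), of v] S(2)
          by (cases "v \<in> A"; cases "v \<in> S") (auto simp: glue_def G T)
      qed
      have agree: "glue p S A (m1, m2) v = m1 v" if "v \<in> A" for v using that S by (auto simp: glue_def)
      have m1s: "m1 \<in> scores p A" using m by (simp add: irr_scores_def)
      show "glue p S A (m1, m2) \<in> scores p S \<and> tight p A (glue p S A (m1, m2)) \<and>
        (\<forall>B. B \<subset> A \<longrightarrow> B \<noteq> {} \<longrightarrow> \<not> tight p B (glue p S A (m1, m2)))"
      proof (intro conjI allI impI)
        show "glue p S A (m1, m2) \<in> scores p S" using eq G(1) by (auto simp: scores_def)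
        have "tight p A m1" using sum_scores[OF finA m1s] by (simp add: tight_def)
        moreover have "tight p A (glue p S A (m1, m2)) = tight p A m1" by (intro tight_cong agree)
        ultimately show "tight p A (glue p S A (m1, m2))" by simp
        fix B assume B: "B \<subset> A" "B \<noteq> {}"
        then have "\<not> tight p B m1" using m by (simp add: irr_scores_def)
        moreover have "tight p B (glue p S A (m1, m2)) = tight p B m1"
          using B by (intro tight_cong agree) auto
        ultimately show "\<not> tight p B (glue p S A (m1, m2))" by blast
      qed
    qed
    show "?R \<subseteq> ?L"
    proof
      fix m assume m: "m \<in> ?R"
      then obtain T where T: "T \<subseteq> edges p S" "m = restrict (score p S T) S" by (auto simp: scores_def)
      have "tight p A m = tight p A (score p S T)" using S by (intro tight_cong) (auto simp: T)
      then have t: "tight p A (score p S T)" using m by blast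
      define m1 where "m1 = restrict (score p A (T \<inter> edges p A)) A"
      define m2 where "m2 = restrict (score p (S - A) (T \<inter> edges p (S - A))) (S - A)"
      have m1: "m1 \<in> scores p A" "m2 \<in> scores p (S - A)" by (auto simp: m1_def m2_def scores_def)
      have agree: "m v = m1 v" if "v \<in> A" for v
        using score_tight_inside[OF S t that] that S by (auto simp: T m1_def)
      have "m1 \<in> irr_scores p A"
      proof -
        have "\<not> tight p B m1" if B: "B \<subset> A" "B \<noteq> {}" for B
        proof -
          have "\<not> tight p B m" using m B by blast
          moreover have "tight p B m = tight p B m1" using B by (intro tight_cong agree) auto
          ultimately show ?thesis by blast
        qed
        then show ?thesis using m1 by (simp add: irr_scores_def)
      qed
      moreover have "m = glue p S A (m1, m2)"
      proof
        fix v
        show "m v = glue p S A (m1, m2) v"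
          using agree[of v] score_tight_outside[OF S t, of v] S(2)
          by (cases "v \<in> A"; cases "v \<in> S") (auto simp: glue_def T m2_def)
      qed
      ultimately show "m \<in> ?L" using m1 by blast
    qed
  qed
qed

text \<open>Score vectors are classified by their inclusion-minimal nonempty tight set. It exists
  because \<open>S\<close> itself is tight, and it is unique because tight sets are nested, which is
  where p >= 1 enters.\<close>

lemma sum_scores_decomposition:
  fixes f :: "(nat \<Rightarrow> nat) \<Rightarrow> real"
  assumes S: "finite S" "S \<noteq> {}" and p: "p \<ge> 1"
  shows "(\<Sum>m\<in>scores p S. f m) =
    (\<Sum>A\<in>Pow S - {{}}. \<Sum>q\<in>irr_scores p A \<times> scores p (S - A). f (glue p S A q))"
proof -
  define Y where "Y A = {m \<in> scores p S. tight p A m \<and> (\<forall>B. B \<subset> A \<longrightarrow> B \<noteq> {} \<longrightarrow> \<not> tight p B m)}" for A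
  have cover: "scores p S = (\<Union>A\<in>Pow S - {{}}. Y A)"
  proof (intro equalityI subsetI)
    fix m assume m: "m \<in> scores p S"
    define Q where "Q A \<longleftrightarrow> A \<subseteq> S \<and> A \<noteq> {} \<and> tight p A m" for A
    have "Q S" using sum_scores[OF S(1) m] S by (simp add: Q_def tight_def)
    then obtain A where A: "Q A" "\<And>B. Q B \<Longrightarrow> card A \<le> card B"
      using ex_has_least_nat[of Q S card] by blast
    have "\<not> tight p B m" if "B \<subset> A" "B \<noteq> {}" for B
    proof
      assume "tight p B m"
      then have "Q B" using that A(1) by (auto simp: Q_def)
      then have "card A \<le> card B" by (rule A(2))
      moreover have "card B < card A"
        using that A(1) S(1) by (intro psubset_card_mono) (auto simp: Q_def intro: finite_subset)
      ultimately show False by simp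
    qed
    then show "m \<in> (\<Union>A\<in>Pow S - {{}}. Y A)" using A(1) m by (auto simp: Q_def Y_def)
  qed (auto simp: Y_def)
  have disj: "Y A \<inter> Y A' = {}" if AA: "A \<in> Pow S - {{}}" "A' \<in> Pow S - {{}}" "A \<noteq> A'" for A A'
  proof (rule ccontr)
    assume "Y A \<inter> Y A' \<noteq> {}"
    then obtain m where m: "m \<in> Y A" "m \<in> Y A'" by blast
    then obtain T where T: "m = restrict (score p S T) S" by (auto simp: Y_def scores_def)
    have tt: "tight p B m = tight p B (score p S T)" if "B \<subseteq> S" for B
      using that by (intro tight_cong) (auto simp: T)
    have t: "tight p A (score p S T)" "tight p A' (score p S T)"
      using m AA tt by (auto simp: Y_def)
    have "A \<subseteq> A' \<or> A' \<subseteq> A"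
      using tight_subset[OF S(1) _ _ p t] tight_subset[OF S(1) _ _ p t(2,1)] AA
      by (cases "card A \<le> card A'") auto
    then have "A \<subset> A' \<or> A' \<subset> A" using AA by blast
    then show False using m AA by (auto simp: Y_def)
  qed
  have "(\<Sum>m\<in>scores p S. f m) = (\<Sum>A\<in>Pow S - {{}}. \<Sum>m\<in>Y A. f m)"
    unfolding cover using S disj by (intro sum.UNION_disjoint) (auto simp: Y_def)
  also have "\<dots> = (\<Sum>A\<in>Pow S - {{}}. \<Sum>q\<in>irr_scores p A \<times> scores p (S - A). f (glue p S A q))"
  proof (rule sum.cong[OF refl])
    fix A assume "A \<in> Pow S - {{}}"
    then have "bij_betw (glue p S A) (irr_scores p A \<times> scores p (S - A)) (Y A)"
      using bij_betw_glue[OF S(1), of A p] by (simp add: Y_def)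
    then show "(\<Sum>m\<in>Y A. f m) = (\<Sum>q\<in>irr_scores p A \<times> scores p (S - A). f (glue p S A q))"
      by (rule sum.reindex_bij_betw[symmetric])
  qed
  finally show ?thesis .
qed

section \<open>Gaussian weights and the renewal equation\<close>

definition weight :: "real \<Rightarrow> real \<Rightarrow> nat set \<Rightarrow> (nat \<Rightarrow> nat) \<Rightarrow> real" where
  "weight g q S m = exp (g * (\<Sum>v\<in>S. (real (m v) + q)\<^sup>2))"

text \<open>Up to a power of the constant \<open>area\<close> this is the integral of
  \<open>dens q S\<close>, see \<open>integral_dens\<close>. The shift \<open>q\<close> of all
  exponents arises when a tight set has been split off.\<close>

definition gauss_sum :: "real \<Rightarrow> nat \<Rightarrow> real \<Rightarrow> nat set \<Rightarrow> real" where
  "gauss_sum g p q S = (\<Sum>m\<in>scores p S. (coef p S m)\<^sup>2 * weight g q S m)"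

definition irr_sum :: "real \<Rightarrow> nat \<Rightarrow> nat set \<Rightarrow> real" where
  "irr_sum g p S = (\<Sum>m\<in>irr_scores p S. (coef p S m)\<^sup>2 * weight g 0 S m)"

text \<open>The mixed term of the square involves only the total score, which is the number of games
  for every score vector; so the shift factors out.\<close>

lemma gauss_sum_shift:
  assumes "finite S"
  shows "gauss_sum g p q S = exp (g * (2 * q * card (edges p S) + q\<^sup>2 * card S)) * gauss_sum g p 0 S"
  unfolding gauss_sum_def sum_distrib_left
proof (rule sum.cong[OF refl])
  fix m assume m: "m \<in> scores p S"
  have "(\<Sum>v\<in>S. (real (m v) + q)\<^sup>2) = (\<Sum>v\<in>S. (real (m v))\<^sup>2) + 2 * q * (\<Sum>v\<in>S. real (m v)) + q\<^sup>2 * card S"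
    by (simp add: power2_sum sum.distrib sum_distrib_left mult.assoc mult.left_commute mult.commute)
  also have "(\<Sum>v\<in>S. real (m v)) = real (card (edges p S))"
    using sum_scores[OF assms m] by (simp flip: of_nat_sum)
  finally have "weight g q S m = exp (g * (2 * q * card (edges p S) + q\<^sup>2 * card S)) * weight g 0 S m"
    by (simp add: weight_def algebra_simps flip: exp_add)
  then show "(coef p S m)\<^sup>2 * weight g q S m =
      exp (g * (2 * q * card (edges p S) + q\<^sup>2 * card S)) * ((coef p S m)\<^sup>2 * weight g 0 S m)" by simp
qed

lemma gauss_sum_decomposition:
  assumes S: "finite S" "S \<noteq> {}" and p: "p \<ge> 1"
  shows "gauss_sum g p 0 S = (\<Sum>A\<in>Pow S - {{}}. irr_sum g p A * gauss_sum g p (real (p * card A)) (S - A))"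
  unfolding gauss_sum_def[of g p 0 S] sum_scores_decomposition[OF S p]
proof (rule sum.cong[OF refl])
  fix A assume "A \<in> Pow S - {{}}"
  then have A: "A \<subseteq> S" by auto
  then have finA: "finite A" using S finite_subset by blast
  have *: "(coef p S (glue p S A q))\<^sup>2 * weight g 0 S (glue p S A q) =
      ((coef p A (fst q))\<^sup>2 * weight g 0 A (fst q)) *
      ((coef p (S - A) (snd q))\<^sup>2 * weight g (real (p * card A)) (S - A) (snd q))"
    if q: "q \<in> irr_scores p A \<times> scores p (S - A)" for q
  proof -
    have m1: "fst q \<in> scores p A" using q by (auto simp: irr_scores_def)
    have "coef p S (glue p S A q) = (-1) ^ card (downhill p S A) * coef p A (fst q) * coef p (S - A) (snd q)"
      by (rule coef_glue[OF S(1) A sum_scores[OF finA m1]]) (use A in \<open>auto simp: glue_def\<close>)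
    moreover have "weight g 0 S (glue p S A q) = weight g 0 A (fst q) * weight g (real (p * card A)) (S - A) (snd q)"
    proof -
      have "(\<Sum>v\<in>S. (real (glue p S A q v))\<^sup>2) =
          (\<Sum>v\<in>S - A. (real (glue p S A q v))\<^sup>2) + (\<Sum>v\<in>A. (real (glue p S A q v))\<^sup>2)"
        using S A by (intro sum.subset_diff) auto
      also have "(\<Sum>v\<in>A. (real (glue p S A q v))\<^sup>2) = (\<Sum>v\<in>A. (real (fst q v))\<^sup>2)"
        using A by (intro sum.cong) (auto simp: glue_def)
      also have "(\<Sum>v\<in>S - A. (real (glue p S A q v))\<^sup>2) = (\<Sum>v\<in>S - A. (real (snd q v) + real (p * card A))\<^sup>2)"
        by (intro sum.cong) (auto simp: glue_def)
      finally show ?thesis by (simp add: weight_def distrib_left add.commute flip: exp_add)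
    qed
    ultimately show ?thesis by (simp add: power_mult_distrib power_even_eq flip: power_mult)
  qed
  show "(\<Sum>q\<in>irr_scores p A \<times> scores p (S - A). (coef p S (glue p S A q))\<^sup>2 * weight g 0 S (glue p S A q))
      = irr_sum g p A * gauss_sum g p (real (p * card A)) (S - A)"
    unfolding irr_sum_def gauss_sum_def sum_product sum.cartesian_product
    by (intro sum.cong refl) (use * in auto)
qed

text \<open>The subtracted energy is that of the scores 0, p, 2 p, ... of a transitive tournament.
  With it the shift factors telescope, by \<open>sum_squares_shift\<close>.\<close>

definition normalized_sum :: "real \<Rightarrow> nat \<Rightarrow> nat set \<Rightarrow> real" where
  "normalized_sum g p S = gauss_sum g p 0 S * exp (- g * (real p)\<^sup>2 * (\<Sum>j<card S. (real j)\<^sup>2))"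

lemma sum_squares_shift:
  "(\<Sum>j<a + d. (real j)\<^sup>2) = (\<Sum>j<a. (real j)\<^sup>2) + (\<Sum>j<d. (real j)\<^sup>2) + 2 * real a * (\<Sum>j<d. real j) + real d * (real a)\<^sup>2"
  by (induction d) (simp_all add: power2_sum algebra_simps)

lemma gauss_sum_shift_normalized:
  assumes "finite S"
  shows "gauss_sum g p (real (p * a)) S =
    normalized_sum g p S * exp (g * (real p)\<^sup>2 * ((\<Sum>j<a + card S. (real j)\<^sup>2) - (\<Sum>j<a. (real j)\<^sup>2)))"
proof -
  have "g * (2 * real (p * a) * card (edges p S) + (real (p * a))\<^sup>2 * card S)
      = - g * (real p)\<^sup>2 * (\<Sum>j<card S. (real j)\<^sup>2)
        + g * (real p)\<^sup>2 * ((\<Sum>j<a + card S. (real j)\<^sup>2) - (\<Sum>j<a. (real j)\<^sup>2))"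
    unfolding sum_squares_shift card_edges[OF assms]
    by (simp add: algebra_simps power2_eq_square)
  then show ?thesis
    unfolding gauss_sum_shift[OF assms, of g p "real (p * a)"] normalized_sum_def
    by (simp only: exp_add mult.assoc mult.commute mult.left_commute)
qed

lemma normalized_sum_decomposition:
  assumes S: "finite S" "S \<noteq> {}" and p: "p \<ge> 1"
  shows "normalized_sum g p S = (\<Sum>A\<in>Pow S - {{}}.
    (irr_sum g p A * exp (- g * (real p)\<^sup>2 * (\<Sum>j<card A. (real j)\<^sup>2))) * normalized_sum g p (S - A))"
  unfolding normalized_sum_def[of g p S] gauss_sum_decomposition[OF S p] sum_distrib_right
proof (rule sum.cong[OF refl])
  fix A assume "A \<in> Pow S - {{}}"
  then have A: "A \<subseteq> S" by auto
  have c: "card A + card (S - A) = card S"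
    using A S by (simp add: card_Diff_subset finite_subset card_mono)
  have e: "exp (g * (real p)\<^sup>2 * ((\<Sum>j<card S. (real j)\<^sup>2) - (\<Sum>j<card A. (real j)\<^sup>2))) *
      exp (- g * (real p)\<^sup>2 * (\<Sum>j<card S. (real j)\<^sup>2)) = exp (- g * (real p)\<^sup>2 * (\<Sum>j<card A. (real j)\<^sup>2))"
    by (simp add: algebra_simps flip: exp_add)
  show "irr_sum g p A * gauss_sum g p (real (p * card A)) (S - A) * exp (- g * (real p)\<^sup>2 * (\<Sum>j<card S. (real j)\<^sup>2)) =
      (irr_sum g p A * exp (- g * (real p)\<^sup>2 * (\<Sum>j<card A. (real j)\<^sup>2))) * normalized_sum g p (S - A)"
    unfolding gauss_sum_shift_normalized[OF finite_Diff[OF S(1)]] c e[symmetric]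
    by (simp only: mult.assoc mult.commute mult.left_commute)
qed

lemma sum_Pow_card:
  fixes f :: "nat \<Rightarrow> real"
  assumes "finite S"
  shows "(\<Sum>A\<in>Pow S. f (card A)) = (\<Sum>k\<le>card S. real (card S choose k) * f k)"
proof -
  have "(\<Sum>A\<in>Pow S. f (card A)) = (\<Sum>k\<le>card S. \<Sum>A\<in>{A \<in> Pow S. card A = k}. f (card A))"
    using assms by (intro sum.group[symmetric]) (auto intro: card_mono)
  also have "\<dots> = (\<Sum>k\<le>card S. real (card S choose k) * f k)"
  proof (rule sum.cong[OF refl])
    fix k
    have "card {A \<in> Pow S. card A = k} = card S choose k"
      using n_subsets[OF assms, of k] by simp
    moreover have "(\<Sum>A\<in>{A \<in> Pow S. card A = k}. f (card A)) = (\<Sum>A\<in>{A \<in> Pow S. card A = k}. f k)"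
      by (rule sum.cong) auto
    ultimately show "(\<Sum>A\<in>{A \<in> Pow S. card A = k}. f (card A)) = real (card S choose k) * f k" by simp
  qed
  finally show ?thesis .
qed

text \<open>Summing over subsets by cardinality yields binomial coefficients, which become a
  convolution after division by factorials. That \<open>i\<close> depends only on the cardinality is
  deduced: as \<open>H 0 = 1\<close>, the recursion can be solved for its top term
  \<open>i S\<close>.\<close>

lemma set_recursion_renewal:
  fixes h i :: "nat set \<Rightarrow> real" and H :: "nat \<Rightarrow> real"
  assumes rec: "\<And>S. finite S \<Longrightarrow> S \<noteq> {} \<Longrightarrow> h S = (\<Sum>A\<in>Pow S - {{}}. i A * h (S - A))"
    and h: "\<And>S. finite S \<Longrightarrow> h S = H (card S)" and H0: "H 0 = 1" and H1: "H 1 > 0"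
    and i: "\<And>A. i A \<ge> 0"
  shows "\<exists>a. (\<forall>k. a k \<ge> 0) \<and> a 0 = 0 \<and> a 1 > (0::real) \<and>
    (\<forall>n\<ge>1. H n / fact n = (\<Sum>k\<le>n. a k * (H (n - k) / fact (n - k))))"
proof -
  define J where "J n = (if n = 0 then 0 else i {..<n})" for n
  have recJ: "h S = (\<Sum>A\<in>Pow S - {{}, S}. i A * H (card S - card A)) + i S"
    if S: "finite S" "S \<noteq> {}" for S
  proof -
    have "h S = (\<Sum>A\<in>insert S (Pow S - {{}, S}). i A * h (S - A))"
      using rec[OF S] S(2) by (intro trans[OF rec[OF S]] sum.cong) auto
    also have "\<dots> = i S * h {} + (\<Sum>A\<in>Pow S - {{}, S}. i A * h (S - A))"
      using S by (subst sum.insert) auto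
    also have "(\<Sum>A\<in>Pow S - {{}, S}. i A * h (S - A)) = (\<Sum>A\<in>Pow S - {{}, S}. i A * H (card S - card A))"
    proof (rule sum.cong[OF refl])
      fix A assume "A \<in> Pow S - {{}, S}"
      then show "i A * h (S - A) = i A * H (card S - card A)"
        using S h[of "S - A"] by (auto simp: card_Diff_subset finite_subset)
    qed
    finally show ?thesis using h[of "{}"] H0 by simp
  qed
  \<comment> \<open>Strong induction on the cardinality: proper subsets contribute equally for
    \<open>S\<close> and for \<open>{..<card S}\<close>, hence the top terms agree as well.\<close>
  have iJ: "i S = J (card S)" if "finite S" "S \<noteq> {}" for S
    using that
  proof (induction "card S" arbitrary: S rule: less_induct)
    case less
    have red: "(\<Sum>A\<in>Pow S' - {{}, S'}. i A * H (card S' - card A)) =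
        (\<Sum>k\<le>card S. real (card S choose k) * (if k = 0 \<or> k = card S then 0 else J k * H (card S - k)))"
      if S': "finite S'" "card S' = card S" for S'
    proof -
      let ?f = "\<lambda>k. if k = 0 \<or> k = card S then 0 else J k * H (card S - k)"
      have "(\<Sum>A\<in>Pow S' - {{}, S'}. i A * H (card S' - card A)) = (\<Sum>A\<in>Pow S' - {{}, S'}. ?f (card A))"
      proof (rule sum.cong[OF refl])
        fix A assume A: "A \<in> Pow S' - {{}, S'}"
        then have fA: "finite A" "A \<noteq> {}" "A \<subset> S'" using S' finite_subset by auto
        then have "card A < card S'" using S' by (intro psubset_card_mono) auto
        then have "i A = J (card A)" "card A \<noteq> 0" "card A \<noteq> card S" using fA S' by (auto intro: less)
        then show "i A * H (card S' - card A) = ?f (card A)" using S' by simp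
      qed
      also have "\<dots> = (\<Sum>A\<in>Pow S'. ?f (card A))"
        using S' by (intro sum.mono_neutral_left) auto
      finally show ?thesis using sum_Pow_card[OF S'(1), of ?f] S' by simp
    qed
    have c: "card S \<noteq> 0" using less by simp
    have "h S = h {..<card S}" using h less by simp
    then have "i S = i {..<card S}"
      using recJ[OF less(2,3)] recJ[of "{..<card S}"] red[of S] red[of "{..<card S}"] less(2) c
      by (simp add: lessThan_empty_iff)
    then show ?case using c by (simp add: J_def)
  qed
  define a where "a k = J k / fact k" for k
  have J0: "J k \<ge> 0" for k using i by (simp add: J_def)
  have main: "H n / fact n = (\<Sum>k\<le>n. a k * (H (n - k) / fact (n - k)))" if n: "n \<ge> 1" for n
  proof -
    have "H n = (\<Sum>A\<in>Pow {..<n} - {{}}. i A * h ({..<n} - A))"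
      using rec[of "{..<n}"] h[of "{..<n}"] n by (simp add: lessThan_empty_iff)
    also have "\<dots> = (\<Sum>A\<in>Pow {..<n} - {{}}. J (card A) * H (n - card A))"
    proof (rule sum.cong[OF refl])
      fix A assume A: "A \<in> Pow {..<n} - {{}}"
      then have "finite A" using finite_subset by blast
      then show "i A * h ({..<n} - A) = J (card A) * H (n - card A)"
        using A iJ[of A] h[of "{..<n} - A"] by (auto simp: card_Diff_subset)
    qed
    also have "\<dots> = (\<Sum>A\<in>Pow {..<n}. J (card A) * H (n - card A))"
      by (intro sum.mono_neutral_left) (auto simp: J_def)
    also have "\<dots> = (\<Sum>k\<le>n. real (n choose k) * (J k * H (n - k)))"
      using sum_Pow_card[of "{..<n}" "\<lambda>k. J k * H (n - k)"] by simp
    finally have "H n / fact n = (\<Sum>k\<le>n. real (n choose k) * (J k * H (n - k)) / fact n)"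
      by (simp add: sum_divide_distrib)
    also have "\<dots> = (\<Sum>k\<le>n. a k * (H (n - k) / fact (n - k)))"
    proof (rule sum.cong[OF refl])
      fix k assume "k \<in> {..n}"
      then show "real (n choose k) * (J k * H (n - k)) / fact n = a k * (H (n - k) / fact (n - k))"
        by (simp add: a_def binomial_fact)
    qed
    finally show ?thesis .
  qed
  have "a 1 = H 1" using main[of 1] H0 by (simp add: a_def J_def)
  then show ?thesis using main J0 H1 by (intro exI[of _ a]) (auto simp: a_def J_def)
qed

lemma gauss_sum_empty [simp]: "gauss_sum g p q {} = 1"
proof -
  have "edges p {} = {}" by (auto simp: edges_def)
  then show ?thesis by (simp add: gauss_sum_def scores_def coef_def weight_def)
qed

lemma gauss_sum_singleton [simp]: "gauss_sum g p 0 {x} = 1"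
proof -
  have e: "edges p {x} = {}" by (auto simp: edges_def)
  then have "score p {x} {} x = 0" by (simp add: score_def)
  then have "{T. T = {} \<and> score p {x} T x = 0} = {{}}" by auto
  then show ?thesis using \<open>score p {x} {} x = 0\<close>
    by (simp add: gauss_sum_def scores_def coef_def weight_def e)
qed

lemma irr_sum_nonneg: "irr_sum g p A \<ge> 0"
  by (auto simp: irr_sum_def weight_def intro!: sum_nonneg)

lemma gauss_sum_nonneg: "gauss_sum g p q A \<ge> 0"
  by (auto simp: gauss_sum_def weight_def intro!: sum_nonneg)

lemma normalized_sum_renewal:
  assumes p: "p \<ge> 1"
    and inv: "\<And>S. finite S \<Longrightarrow> gauss_sum g p 0 S = gauss_sum g p 0 {..<card S}"
  shows "\<exists>a. (\<forall>k. a k \<ge> 0) \<and> a 0 = 0 \<and> a 1 > (0::real) \<and>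
    (\<forall>n\<ge>1. normalized_sum g p {..<n} / fact n =
      (\<Sum>k\<le>n. a k * (normalized_sum g p {..<n - k} / fact (n - k))))"
proof (rule set_recursion_renewal[where h="normalized_sum g p" and H="\<lambda>n. normalized_sum g p {..<n}"
      and i="\<lambda>A. irr_sum g p A * exp (- g * (real p)\<^sup>2 * (\<Sum>j<card A. (real j)\<^sup>2))"])
  show "normalized_sum g p S = normalized_sum g p {..<card S}" if "finite S" for S
    using inv[OF that] by (simp add: normalized_sum_def)
  show "normalized_sum g p {..<1} > 0" by (simp add: normalized_sum_def lessThan_Suc)
  show "normalized_sum g p {..<0} = 1" by (simp add: normalized_sum_def)
  show "normalized_sum g p S = (\<Sum>A\<in>Pow S - {{}}.
      irr_sum g p A * exp (- g * (real p)\<^sup>2 * (\<Sum>j<card A. (real j)\<^sup>2)) * normalized_sum g p (S - A))"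
    if "finite S" "S \<noteq> {}" for S
    using that p by (rule normalized_sum_decomposition)
qed (simp_all add: irr_sum_nonneg)

section \<open>Integration over the cylinder\<close>

text \<open>Makes Fubini available for integrands that separate into real and imaginary
  part.\<close>

lemma lborel_complex_eq_distr:
  "(lborel :: complex measure) = distr (lborel \<Otimes>\<^sub>M lborel) borel (\<lambda>(x, y). Complex x y)"
proof (rule lborel_eqI)
  have m [measurable]: "(\<lambda>(x, y). Complex x y) \<in> borel_measurable (lborel \<Otimes>\<^sub>M lborel)"
    by (auto simp: Complex_eq split_def)
  fix a b :: complex assume ab: "\<And>i. i \<in> Basis \<Longrightarrow> a \<bullet> i \<le> b \<bullet> i"
  have re: "Re a \<le> Re b" "Im a \<le> Im b" using ab[of 1] ab[of \<i>] by (auto simp: Basis_complex_def)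
  have "emeasure (distr (lborel \<Otimes>\<^sub>M lborel) borel (\<lambda>(x, y). Complex x y)) (box a b)
      = emeasure (lborel \<Otimes>\<^sub>M lborel) ((\<lambda>(x, y). Complex x y) -` box a b \<inter> space (lborel \<Otimes>\<^sub>M lborel))"
    by (rule emeasure_distr) auto
  also have "(\<lambda>(x, y). Complex x y) -` box a b \<inter> space (lborel \<Otimes>\<^sub>M lborel) = box (Re a) (Re b) \<times> box (Im a) (Im b)"
    by (auto simp: box_def Basis_complex_def space_pair_measure)
  also have "emeasure (lborel \<Otimes>\<^sub>M lborel) (box (Re a) (Re b) \<times> box (Im a) (Im b))
      = ennreal (Re b - Re a) * ennreal (Im b - Im a)"
    using re by (subst lborel.emeasure_pair_measure_Times) (auto simp: box_real)
  also have "\<dots> = ennreal (\<Prod>i\<in>Basis. (b - a) \<bullet> i)"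
    using re by (simp add: Basis_complex_def ennreal_mult)
  finally show "emeasure (distr (lborel \<Otimes>\<^sub>M lborel) borel (\<lambda>(x, y). Complex x y)) (box a b)
      = ennreal (\<Prod>i\<in>Basis. (b - a) \<bullet> i)" .
qed simp

definition strip :: "real \<Rightarrow> complex measure" where
  "strip R = restrict_space lborel (cyl R)"

lemma cyl_sets [measurable]: "cyl R \<in> sets borel"
proof -
  have "closed (cyl R)"
    unfolding cyl_def by (intro closed_Collect_conj closed_Collect_le continuous_intros)
  then show ?thesis by (rule borel_closed)
qed

lemma integral_strip_product:
  fixes f h :: "real \<Rightarrow> complex"
  assumes f: "integrable lborel f" and h: "continuous_on UNIV h"
  shows "integrable (strip R) (\<lambda>z. f (Re z) * h (Im z))"
    and "(\<integral>z. f (Re z) * h (Im z) \<partial>strip R) = (\<integral>x. f x \<partial>lborel) * (\<integral>y. indicator {0..2 * pi * R} y *\<^sub>R h y \<partial>lborel)"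
proof -
  define h' where "h' y = indicator {0..2 * pi * R} y *\<^sub>R h y" for y :: real
  have h': "integrable lborel h'"
    unfolding h'_def[abs_def] using h by (intro borel_integrable_compact) (auto intro: continuous_on_subset)
  have [measurable]: "f \<in> borel_measurable borel" "h' \<in> borel_measurable borel"
    using f h' by (auto dest: borel_measurable_integrable)
  have m [measurable]: "(\<lambda>(x, y). Complex x y) \<in> borel_measurable (lborel \<Otimes>\<^sub>M lborel)"
    by (auto simp: Complex_eq split_def)
  have [measurable]: "Re \<in> borel_measurable borel" "Im \<in> borel_measurable borel"
    by (auto intro!: borel_measurable_continuous_onI continuous_intros)
  have ip: "integrable (lborel \<Otimes>\<^sub>M lborel) (\<lambda>(x, y). f x * h' y)"
  proof (rule lborel_pair.Fubini_integrable)
    show "integrable lborel (\<lambda>x. \<integral>y. norm (case (x, y) of (x, y) \<Rightarrow> f x * h' y) \<partial>lborel)"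
      using f by (simp add: norm_mult)
    show "AE x in lborel. integrable lborel (\<lambda>y. case (x, y) of (x, y) \<Rightarrow> f x * h' y)"
      using h' by simp
  qed measurable
  have ic: "integrable lborel (\<lambda>z. f (Re z) * h' (Im z))"
    unfolding lborel_complex_eq_distr by (subst integrable_distr_eq) (use ip in \<open>auto simp: split_def\<close>)
  have ind: "indicator (cyl R) z *\<^sub>R (f (Re z) * h (Im z)) = f (Re z) * h' (Im z)" for z
    by (auto simp: cyl_def h'_def indicator_def)
  show "integrable (strip R) (\<lambda>z. f (Re z) * h (Im z))"
    unfolding strip_def by (subst integrable_restrict_space) (use ic in \<open>auto simp: ind\<close>)
  have "(\<integral>z. f (Re z) * h (Im z) \<partial>strip R) = (\<integral>z. f (Re z) * h' (Im z) \<partial>lborel)"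
    unfolding strip_def by (subst integral_restrict_space) (auto simp: ind)
  also have "\<dots> = (\<integral>q. (case q of (x, y) \<Rightarrow> f x * h' y) \<partial>(lborel \<Otimes>\<^sub>M lborel))"
    unfolding lborel_complex_eq_distr by (subst integral_distr) (auto simp: split_def)
  also have "\<dots> = (\<integral>x. \<integral>y. f x * h' y \<partial>lborel \<partial>lborel)"
    using lborel_pair.integral_fst'[OF ip] by simp
  also have "\<dots> = (\<integral>x. f x \<partial>lborel) * (\<integral>y. h' y \<partial>lborel)"
    using h' f by simp
  finally show "(\<integral>z. f (Re z) * h (Im z) \<partial>strip R) = (\<integral>x. f x \<partial>lborel) * (\<integral>y. indicator {0..2 * pi * R} y *\<^sub>R h y \<partial>lborel)"
    by (simp add: h'_def)
qed

lemma integral_full_period_cis: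
  assumes R: "R > 0"
  shows "(\<integral>y. indicator {0..2 * pi * R} y *\<^sub>R cis (of_int k * y / R) \<partial>lborel) =
    (if k = 0 then complex_of_real (2 * pi * R) else 0)"
proof (cases "k = 0")
  case True
  then show ?thesis using R by (simp add: scaleR_conv_of_real)
next
  case False
  define F where "F y = cis (of_int k * y / R) * (R / (\<i> * of_int k))" for y
  have "(\<integral>y. indicator {0..2 * pi * R} y *\<^sub>R cis (of_int k * y / R) \<partial>lborel) = F (2 * pi * R) - F 0"
  proof (rule integral_FTC_Icc)
    show "0 \<le> 2 * pi * R" using R by simp
    show "(F has_vector_derivative cis (of_int k * y / R)) (at y within {0..2 * pi * R})" for y
    proof -
      have "((\<lambda>z. exp (\<i> * of_int k * z / R) * (R / (\<i> * of_int k))) has_field_derivative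
        exp (\<i> * of_int k * of_real y / R)) (at (of_real y))"
        using False R by (auto intro!: derivative_eq_intros)
      from has_vector_derivative_real_field[OF this]
      show ?thesis by (simp add: F_def[abs_def] cis_conv_exp mult.assoc)
    qed
    show "continuous_on {0..2 * pi * R} (\<lambda>y. cis (of_int k * y / R))"
      using R by (intro continuous_intros) auto
  qed
  also have "F (2 * pi * R) = F 0"
  proof -
    have "cis (of_int k * (2 * pi * R) / R) = cis (2 * pi * of_int k)" using R by (simp add: field_simps)
    also have "\<dots> = 1" by (simp add: cis_multiple_2pi)
    finally show ?thesis by (simp add: F_def)
  qed
  finally show ?thesis using False by simp
qed

lemma integral_gaussian:
  fixes l c :: real
  assumes l: "l > 0"
  shows "integrable lborel (\<lambda>x. exp (c * x - x\<^sup>2 / l\<^sup>2))"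
    and "(\<integral>x. exp (c * x - x\<^sup>2 / l\<^sup>2) \<partial>lborel) = l * sqrt pi * exp (c\<^sup>2 * l\<^sup>2 / 4)"
proof -
  have "exp (c * x - x\<^sup>2 / l\<^sup>2) = l * sqrt pi * exp (c\<^sup>2 * l\<^sup>2 / 4) * normal_density (c * l\<^sup>2 / 2) (l / sqrt 2) x" for x
  proof -
    have "c * x - x\<^sup>2 / l\<^sup>2 = c\<^sup>2 * l\<^sup>2 / 4 + (- (x - c * l\<^sup>2 / 2)\<^sup>2 / (2 * (l / sqrt 2)\<^sup>2))"
      using l by (simp add: field_simps power2_eq_square)
    moreover have "sqrt (2 * pi * (l / sqrt 2)\<^sup>2) = l * sqrt pi"
      using l by (simp add: power_divide real_sqrt_mult)
    ultimately show ?thesis using l by (simp add: normal_density_def mult_exp_exp)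
  qed
  then show "integrable lborel (\<lambda>x. exp (c * x - x\<^sup>2 / l\<^sup>2))"
    "(\<integral>x. exp (c * x - x\<^sup>2 / l\<^sup>2) \<partial>lborel) = l * sqrt pi * exp (c\<^sup>2 * l\<^sup>2 / 4)"
    using l by simp_all
qed

section \<open>The tilted particle density and its integral\<close>

locale cylinder =
  fixes R l :: real and p :: nat
  assumes R: "R > 0" and l: "l > 0"
begin

definition w :: "complex \<Rightarrow> complex" where "w z = exp (z / complex_of_real R)"

text \<open>The squared modulus of the Vandermonde product in the variables \<open>w (z v)\<close>.
  Running over ordered pairs makes it visibly invariant under relabelling.\<close>

definition pairs :: "nat set \<Rightarrow> (nat \<Rightarrow> complex) \<Rightarrow> real" where
  "pairs S z = (\<Prod>v\<in>S. \<Prod>u\<in>S - {v}. cmod (w (z u) - w (z v)))"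

text \<open>The one-particle Gaussian times \<open>cmod (w z)\<close> to the power 2 q. For q = p D
  the extra factor is the effect of D particles far to the left.\<close>

definition gauss :: "real \<Rightarrow> complex \<Rightarrow> real" where
  "gauss q z = exp (2 * q * Re z / R - (Re z)\<^sup>2 / l\<^sup>2)"

definition dens :: "real \<Rightarrow> nat set \<Rightarrow> (nat \<Rightarrow> complex) \<Rightarrow> real" where
  "dens q S z = pairs S z ^ p * (\<Prod>v\<in>S. gauss q (z v))"

abbreviation area :: real where "area \<equiv> 2 * pi * R * l * sqrt pi"
abbreviation g2 :: real where "g2 \<equiv> (l / R)\<^sup>2"

abbreviation conf :: "nat set \<Rightarrow> (nat \<Rightarrow> complex) measure" where
  "conf S \<equiv> PiM S (\<lambda>_. strip R)"

sublocale sigma_finite_measure "strip R"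
  unfolding strip_def by (intro sigma_finite_measure_restrict_space lborel.sigma_finite_measure_axioms) simp

sublocale product_sigma_finite "\<lambda>_ :: nat. strip R"
  by standard

lemma pairs_nonneg: "pairs S z \<ge> 0"
  by (auto simp: pairs_def intro!: prod_nonneg)

lemma gauss_pos: "gauss q z > 0"
  by (simp add: gauss_def)

lemma dens_nonneg: "dens q S z \<ge> 0"
  unfolding dens_def
  by (intro mult_nonneg_nonneg zero_le_power pairs_nonneg prod_nonneg ballI less_imp_le[OF gauss_pos])

lemma measurable_strip:
  "f \<in> borel_measurable borel \<Longrightarrow> f \<in> borel_measurable (strip R)"
  unfolding strip_def by (intro measurable_restrict_space1) simp

lemma measurable_w: "w \<in> borel_measurable borel"
  unfolding w_def[abs_def] by (intro borel_measurable_continuous_onI continuous_intros) (use R in simp)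

lemma measurable_gauss: "gauss q \<in> borel_measurable borel"
  unfolding gauss_def[abs_def] by (intro borel_measurable_continuous_onI continuous_intros) (use R l in auto)

lemma measurable_component:
  "f \<in> borel_measurable borel \<Longrightarrow> v \<in> I \<Longrightarrow> (\<lambda>z. f (z v)) \<in> borel_measurable (conf I)"
  by (rule measurable_compose[OF measurable_component_singleton[where M="\<lambda>_. strip R"] measurable_strip])

lemma measurable_dens: "S \<subseteq> I \<Longrightarrow> dens q S \<in> borel_measurable (conf I)"
  unfolding dens_def[abs_def] pairs_def
proof (intro borel_measurable_times borel_measurable_power borel_measurable_prod)
  assume S: "S \<subseteq> I"
  fix v assume v: "v \<in> S"
  then show "(\<lambda>z. gauss q (z v)) \<in> borel_measurable (conf I)"
    using S by (intro measurable_component measurable_gauss) auto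
  fix u assume u: "u \<in> S - {v}"
  have "(\<lambda>z. w (z u)) \<in> borel_measurable (conf I)" "(\<lambda>z. w (z v)) \<in> borel_measurable (conf I)"
    using S u v by (auto intro!: measurable_component measurable_w)
  then show "(\<lambda>z. cmod (w (z u) - w (z v))) \<in> borel_measurable (conf I)" by measurable
qed

text \<open>The imaginary part runs through a full period, so different powers are orthogonal;
  completing the square in the real part produces the exponential of
  \<open>g2 * (m + q)^2\<close>.\<close>

lemma one_particle_orthogonality:
  shows "integrable (strip R) (\<lambda>z. w z ^ m * cnj (w z ^ m') * of_real (gauss q z))"
    and "(\<integral>z. w z ^ m * cnj (w z ^ m') * of_real (gauss q z) \<partial>strip R) =
      (if m = m' then complex_of_real (area * exp (g2 * (real m + q)\<^sup>2)) else 0)"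
proof -
  define f where "f x = complex_of_real (exp ((real m + real m' + 2 * q) / R * x - x\<^sup>2 / l\<^sup>2))" for x :: real
  define h where "h y = cis (of_int (int m - int m') * y / R)" for y :: real
  have wz: "w z ^ n = of_real (exp (real n * Re z / R)) * cis (real n * Im z / R)" for z n
  proof -
    have "w z ^ n = exp (of_nat n * (z / complex_of_real R))" by (simp only: w_def exp_of_nat_mult)
    also have "of_nat n * (z / complex_of_real R) = Complex (real n * Re z / R) (real n * Im z / R)"
      by (simp add: complex_eq_iff)
    finally show ?thesis by (simp add: exp_eq_polar)
  qed
  have eq: "w z ^ m * cnj (w z ^ m') * of_real (gauss q z) = f (Re z) * h (Im z)" for z
  proof -
    have 1: "cis (real m * Im z / R) * cnj (cis (real m' * Im z / R)) = h (Im z)"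
      by (simp add: h_def cis_cnj cis_mult left_diff_distrib diff_divide_distrib)
    have 2: "complex_of_real (exp (real m * Re z / R)) * of_real (exp (real m' * Re z / R)) * of_real (gauss q z) = f (Re z)"
      by (simp add: f_def gauss_def field_simps add_divide_distrib flip: of_real_mult exp_add)
    show ?thesis
      unfolding 1[symmetric] 2[symmetric] wz complex_cnj_mult complex_cnj_complex_of_real by (simp only: mult_ac)
  qed
  have f: "integrable lborel f" unfolding f_def[abs_def] by (intro integrable_of_real integral_gaussian l)
  have h: "continuous_on UNIV h" unfolding h_def[abs_def] using R by (intro continuous_intros) auto
  show "integrable (strip R) (\<lambda>z. w z ^ m * cnj (w z ^ m') * of_real (gauss q z))"
    unfolding eq by (rule integral_strip_product[OF f h])
  have "(\<integral>z. w z ^ m * cnj (w z ^ m') * of_real (gauss q z) \<partial>strip R) =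
      (\<integral>x. f x \<partial>lborel) * (\<integral>y. indicator {0..2 * pi * R} y *\<^sub>R h y \<partial>lborel)"
    unfolding eq by (rule integral_strip_product[OF f h])
  also have "(\<integral>x. f x \<partial>lborel) = complex_of_real (l * sqrt pi * exp (((real m + real m' + 2 * q) / R)\<^sup>2 * l\<^sup>2 / 4))"
    unfolding f_def[abs_def] by (simp only: integral_complex_of_real integral_gaussian(2)[OF l])
  also have "(\<integral>y. indicator {0..2 * pi * R} y *\<^sub>R h y \<partial>lborel) = (if m = m' then complex_of_real (2 * pi * R) else 0)"
    unfolding h_def[abs_def] integral_full_period_cis[OF R] by simp
  also have "complex_of_real (l * sqrt pi * exp (((real m + real m' + 2 * q) / R)\<^sup>2 * l\<^sup>2 / 4)) *
      (if m = m' then complex_of_real (2 * pi * R) else 0) =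
      (if m = m' then complex_of_real (area * exp (g2 * (real m + q)\<^sup>2)) else 0)"
  proof (cases "m = m'")
    case True
    have "((real m + real m + 2 * q) / R)\<^sup>2 * l\<^sup>2 / 4 = g2 * (real m + q)\<^sup>2"
      using R by (simp add: field_simps power2_eq_square)
    then show ?thesis using True by simp
  qed simp
  finally show "(\<integral>z. w z ^ m * cnj (w z ^ m') * of_real (gauss q z) \<partial>strip R) =
      (if m = m' then complex_of_real (area * exp (g2 * (real m + q)\<^sup>2)) else 0)" .
qed

lemma pairs_eq_cmod_squared:
  assumes "finite S"
  shows "pairs S z = (cmod (\<Prod>k\<in>S. \<Prod>j\<in>{j\<in>S. j < k}. (w (z k) - w (z j))))\<^sup>2"
proof -
  let ?d = "\<lambda>u v. cmod (w (z u) - w (z v))"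
  have split: "(\<Prod>u\<in>S - {v}. ?d u v) = (\<Prod>u\<in>{u\<in>S. u < v}. ?d u v) * (\<Prod>u\<in>{u\<in>S. v < u}. ?d u v)" for v
  proof -
    have "S - {v} = {u\<in>S. u < v} \<union> {u\<in>S. v < u}" by auto
    then show ?thesis using assms by (simp add: prod.union_disjoint[symmetric] disjoint_iff)
  qed
  have "(\<Prod>v\<in>S. \<Prod>u\<in>{u\<in>S. v < u}. ?d u v) = (\<Prod>u\<in>S. \<Prod>v\<in>{v\<in>S. v < u}. ?d u v)"
    using assms by (intro prod.swap_restrict) auto
  moreover have "(\<Prod>v\<in>S. \<Prod>u\<in>{u\<in>S. u < v}. ?d u v) = (\<Prod>v\<in>S. \<Prod>u\<in>{u\<in>S. u < v}. ?d v u)"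
    by (simp add: norm_minus_commute)
  ultimately show ?thesis
    by (simp add: pairs_def split prod.distrib prod_norm[symmetric] power2_eq_square)
qed

lemma dens_expansion:
  assumes "finite S"
  shows "complex_of_real (dens q S z) = (\<Sum>m\<in>scores p S. \<Sum>m'\<in>scores p S.
    of_real (coef p S m * coef p S m') * (\<Prod>v\<in>S. w (z v) ^ m v * cnj (w (z v) ^ m' v) * of_real (gauss q (z v))))"
proof -
  define V where "V = (\<Prod>k\<in>S. \<Prod>j\<in>{j\<in>S. j < k}. (w (z k) - w (z j)) ^ p)"
  have V: "V = (\<Sum>m\<in>scores p S. of_real (coef p S m) * (\<Prod>v\<in>S. w (z v) ^ m v))"
    unfolding V_def by (rule vandermonde_power_expansion[OF assms])
  have "pairs S z ^ p = (cmod V)\<^sup>2"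
    unfolding pairs_eq_cmod_squared[OF assms] V_def
    by (simp add: prod_power_distrib[symmetric] norm_power power_mult[symmetric] mult.commute)
  then have "complex_of_real (dens q S z) = V * cnj V * (\<Prod>v\<in>S. of_real (gauss q (z v)))"
    unfolding dens_def by (simp add: complex_norm_square flip: of_real_power)
  also have "\<dots> = (\<Sum>m\<in>scores p S. \<Sum>m'\<in>scores p S.
    of_real (coef p S m * coef p S m') * (\<Prod>v\<in>S. w (z v) ^ m v * cnj (w (z v) ^ m' v) * of_real (gauss q (z v))))"
  proof -
    have cV: "cnj V = (\<Sum>m\<in>scores p S. of_real (coef p S m) * (\<Prod>v\<in>S. cnj (w (z v) ^ m v)))"
      by (simp add: V)
    have "V * cnj V * (\<Prod>v\<in>S. of_real (gauss q (z v))) = (\<Sum>m\<in>scores p S. \<Sum>m'\<in>scores p S.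
      (of_real (coef p S m) * (\<Prod>v\<in>S. w (z v) ^ m v)) * (of_real (coef p S m') * (\<Prod>v\<in>S. cnj (w (z v) ^ m' v)))
        * (\<Prod>v\<in>S. of_real (gauss q (z v))))"
      unfolding cV unfolding V sum_product by (simp only: sum_distrib_right)
    then show ?thesis by (simp only: prod.distrib of_real_mult mult_ac)
  qed
  finally show ?thesis .
qed

text \<open>Distinct score vectors differ at some player, so orthogonality removes the mixed terms
  of the double sum and leaves the squares of \<open>coef\<close>. Read backwards, the identity lets
  sums over scores be estimated by integrals.\<close>

lemma integral_dens:
  assumes "finite S"
  shows "integrable (conf S) (dens q S)"
    and "(\<integral>z. dens q S z \<partial>conf S) = area ^ card S * gauss_sum g2 p q S"
proof -
  let ?t = "\<lambda>m m' z. \<Prod>v\<in>S. w (z v) ^ m v * cnj (w (z v) ^ m' v) * of_real (gauss q (z v))"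
  have int: "integrable (conf S) (?t m m')" for m m'
    using product_integrable_prod[OF assms one_particle_orthogonality(1)] by simp
  have val: "(\<integral>z. ?t m m' z \<partial>conf S) = (if m = m' then of_real (area ^ card S * weight g2 q S m) else 0)"
    if m: "m \<in> scores p S" "m' \<in> scores p S" for m m'
  proof -
    have "(\<integral>z. ?t m m' z \<partial>conf S) = (\<Prod>v\<in>S. if m v = m' v then complex_of_real (area * exp (g2 * (real (m v) + q)\<^sup>2)) else 0)"
      unfolding one_particle_orthogonality(2)[symmetric]
      using product_integral_prod[OF assms one_particle_orthogonality(1)] by simp
    also have "\<dots> = (if m = m' then of_real (area ^ card S * weight g2 q S m) else 0)"
    proof (cases "m = m'")
      case True
      then show ?thesis by (simp add: prod.distrib weight_def exp_sum[OF assms] sum_distrib_left)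
    next
      case False
      then obtain v where "v \<in> S" "m v \<noteq> m' v"
        using scores_extensional[OF m(1)] scores_extensional[OF m(2)] extensionalityI by metis
      then show ?thesis using False assms by (auto intro!: prod_zero)
    qed
    finally show ?thesis .
  qed
  have intC: "integrable (conf S) (\<lambda>z. complex_of_real (dens q S z))"
    unfolding dens_expansion[OF assms] by (intro Bochner_Integration.integrable_sum integrable_mult_right int)
  from integrable_Re[OF this] show "integrable (conf S) (dens q S)" by simp
  have "complex_of_real (\<integral>z. dens q S z \<partial>conf S) = (\<integral>z. complex_of_real (dens q S z) \<partial>conf S)"
    by simp
  also have "\<dots> = (\<Sum>m\<in>scores p S. \<Sum>m'\<in>scores p S. of_real (coef p S m * coef p S m') * (\<integral>z. ?t m m' z \<partial>conf S))"
  proof -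
    have i2: "integrable (conf S) (\<lambda>z. of_real (coef p S m * coef p S m') * ?t m m' z)" for m m'
      by (intro integrable_mult_right int)
    have "(\<integral>z. complex_of_real (dens q S z) \<partial>conf S) =
        (\<Sum>m\<in>scores p S. \<Sum>m'\<in>scores p S. (\<integral>z. of_real (coef p S m * coef p S m') * ?t m m' z \<partial>conf S))"
      unfolding dens_expansion[OF assms]
      by (subst Bochner_Integration.integral_sum, intro Bochner_Integration.integrable_sum i2,
          intro sum.cong refl Bochner_Integration.integral_sum i2)
    then show ?thesis by (simp only: integral_mult_right_zero)
  qed
  also have "\<dots> = (\<Sum>m\<in>scores p S. \<Sum>m'\<in>scores p S. if m = m' then of_real ((coef p S m)\<^sup>2 * (area ^ card S * weight g2 q S m)) else 0)"
  proof (intro sum.cong refl)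
    fix m m' assume m: "m \<in> scores p S" "m' \<in> scores p S"
    show "of_real (coef p S m * coef p S m') * (\<integral>z. ?t m m' z \<partial>conf S) =
        (if m = m' then of_real ((coef p S m)\<^sup>2 * (area ^ card S * weight g2 q S m)) else 0)"
      unfolding val[OF m] by (simp add: power2_eq_square[of "coef p S m'"])
  qed
  also have "\<dots> = complex_of_real (area ^ card S * gauss_sum g2 p q S)"
    using assms by (simp add: gauss_sum_def sum_distrib_left mult_ac)
  finally show "(\<integral>z. dens q S z \<partial>conf S) = area ^ card S * gauss_sum g2 p q S"
    using of_real_eq_iff by blast
qed

lemma nn_integral_dens:
  assumes "finite S"
  shows "(\<integral>\<^sup>+z. ennreal (dens q S z) \<partial>conf S) = ennreal (area ^ card S * gauss_sum g2 p q S)"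
proof -
  have "(\<integral>\<^sup>+z. ennreal (dens q S z) \<partial>conf S) = ennreal (\<integral>z. dens q S z \<partial>conf S)"
    by (rule nn_integral_eq_integral[OF integral_dens(1)[OF assms]]) (simp add: dens_nonneg)
  then show ?thesis by (simp only: integral_dens(2)[OF assms])
qed

lemma distr_conf_reindex:
  assumes f: "bij_betw f I J" and fin: "finite I" "finite J"
  shows "distr (conf J) (conf I) (\<lambda>z. \<lambda>i\<in>I. z (f i)) = conf I"
proof (rule PiM_eqI[OF fin(1)])
  have fI: "\<And>i. i \<in> I \<Longrightarrow> f i \<in> J" using bij_betwE[OF f] by blast
  have m: "(\<lambda>z. \<lambda>i\<in>I. z (f i)) \<in> measurable (conf J) (conf I)"
  proof (rule measurable_restrict)
    show "(\<lambda>z. z (f i)) \<in> measurable (conf J) (strip R)" if "i \<in> I" for i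
      using measurable_component_singleton[of "f i" J "\<lambda>_. strip R"] fI[OF that] by simp
  qed
  fix A :: "nat \<Rightarrow> complex set" assume A: "\<And>i. i \<in> I \<Longrightarrow> A i \<in> sets (strip R)"
  define B where "B j = A (the_inv_into I f j)" for j
  have B: "B (f i) = A i" if "i \<in> I" for i
    using that f by (simp add: B_def the_inv_into_f_f bij_betw_def)
  have BJ: "B j \<in> sets (strip R)" if j: "j \<in> J" for j
  proof -
    obtain i where "i \<in> I" "j = f i" using j f unfolding bij_betw_def by blast
    then show ?thesis using A B by simp
  qed
  have "(\<lambda>z. \<lambda>i\<in>I. z (f i)) -` Pi\<^sub>E I A \<inter> space (conf J) = Pi\<^sub>E J B"
  proof (intro equalityI subsetI)
    fix z assume z: "z \<in> (\<lambda>z. \<lambda>i\<in>I. z (f i)) -` Pi\<^sub>E I A \<inter> space (conf J)"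
    show "z \<in> Pi\<^sub>E J B"
    proof (rule PiE_I)
      fix j assume "j \<in> J"
      then obtain i where "i \<in> I" "j = f i" using f unfolding bij_betw_def by blast
      then show "z j \<in> B j" using z B by (auto simp: PiE_iff)
    qed (use z in \<open>auto simp: space_PiM PiE_iff extensional_def\<close>)
  next
    fix z assume z: "z \<in> Pi\<^sub>E J B"
    have "z j \<in> space (strip R)" if "j \<in> J" for j
      using z that sets.sets_into_space[OF BJ[OF that]] by auto
    moreover have "z (f i) \<in> A i" if "i \<in> I" for i using z B[OF that] fI[OF that] by auto
    ultimately show "z \<in> (\<lambda>z. \<lambda>i\<in>I. z (f i)) -` Pi\<^sub>E I A \<inter> space (conf J)"
      using z by (auto simp: space_PiM PiE_iff)
  qed
  then have "emeasure (distr (conf J) (conf I) (\<lambda>z. \<lambda>i\<in>I. z (f i))) (Pi\<^sub>E I A) = emeasure (conf J) (Pi\<^sub>E J B)"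
    using A fin by (subst emeasure_distr[OF m]) auto
  also have "\<dots> = (\<Prod>j\<in>J. emeasure (strip R) (B j))" using BJ fin by (intro emeasure_PiM) auto
  also have "\<dots> = (\<Prod>i\<in>I. emeasure (strip R) (A i))"
    using prod.reindex_bij_betw[OF f, of "\<lambda>j. emeasure (strip R) (B j)"] B by (simp cong: prod.cong)
  finally show "emeasure (distr (conf J) (conf I) (\<lambda>z. \<lambda>i\<in>I. z (f i))) (Pi\<^sub>E I A) = (\<Prod>i\<in>I. emeasure (strip R) (A i))" .
qed simp

lemma dens_reindex:
  assumes f: "bij_betw f I J"
  shows "dens q J z = dens q I (\<lambda>i. z (f i))"
proof -
  have "(\<Prod>u\<in>J - {f v}. cmod (w (z u) - w (z (f v)))) = (\<Prod>u\<in>I - {v}. cmod (w (z (f u)) - w (z (f v))))"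
    if "v \<in> I" for v
  proof -
    have "bij_betw f (I - {v}) (J - {f v})"
      using f that by (auto simp: bij_betw_def inj_on_def)
    then show ?thesis by (rule prod.reindex_bij_betw[symmetric])
  qed
  then have "pairs J z = pairs I (\<lambda>i. z (f i))"
    unfolding pairs_def by (subst prod.reindex_bij_betw[OF f, symmetric]) (simp cong: prod.cong)
  moreover have "(\<Prod>v\<in>J. gauss q (z v)) = (\<Prod>v\<in>I. gauss q (z (f v)))"
    by (rule prod.reindex_bij_betw[OF f, symmetric])
  ultimately show ?thesis by (simp add: dens_def)
qed

lemma dens_cong: "(\<And>v. v \<in> S \<Longrightarrow> z v = z' v) \<Longrightarrow> dens q S z = dens q S z'"
  unfolding dens_def pairs_def by (intro arg_cong2[where f="(*)"] arg_cong2[where f="(^)"] prod.cong refl) auto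

text \<open>\<open>edges\<close> refers to the order of the labels, but the integrand
  \<open>dens\<close> is symmetric in them, so the integral yields independence of the label
  set.\<close>

lemma gauss_sum_card:
  assumes "finite S"
  shows "gauss_sum g2 p q S = gauss_sum g2 p q {..<card S}"
proof -
  obtain f where f: "bij_betw f {..<card S} S"
    using ex_bij_betw_nat_finite[OF assms] by (auto simp: atLeast0LessThan)
  let ?I = "{..<card S}"
  have m: "(\<lambda>z. \<lambda>i\<in>?I. z (f i)) \<in> measurable (conf S) (conf ?I)"
  proof (rule measurable_restrict)
    show "(\<lambda>z. z (f i)) \<in> measurable (conf S) (strip R)" if "i \<in> ?I" for i
      using measurable_component_singleton[of "f i" S "\<lambda>_. strip R"] bij_betwE[OF f] that by simp
  qed
  have "(\<integral>z. dens q ?I z \<partial>conf ?I) = (\<integral>z. dens q ?I z \<partial>distr (conf S) (conf ?I) (\<lambda>z. \<lambda>i\<in>?I. z (f i)))"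
    using distr_conf_reindex[OF f] assms by simp
  also have "\<dots> = (\<integral>z. dens q ?I (\<lambda>i\<in>?I. z (f i)) \<partial>conf S)"
    by (rule integral_distr[OF m measurable_dens[OF order_refl]])
  also have "\<dots> = (\<integral>z. dens q S z \<partial>conf S)"
    unfolding dens_reindex[OF f] by (intro Bochner_Integration.integral_cong refl dens_cong) simp
  finally have "area ^ card S * gauss_sum g2 p q ?I = area ^ card S * gauss_sum g2 p q S"
    using integral_dens(2)[OF assms, of q] integral_dens(2)[of ?I q] by simp
  then show ?thesis using R l by simp
qed

text \<open>The square of \<open>kappa\<close> cancels \<open>area ^ N\<close> and supplies both 1 /
  N! and the energy subtracted in \<open>normalized_sum\<close>.\<close>

lemma normC_eq: "normC R l p N = normalized_sum g2 p {..<N} / fact N"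
proof -
  have "(cmod (laughlin R l p N z))\<^sup>2 = (kappa R l p N)\<^sup>2 * dens 0 {..<N} z" for z
  proof -
    have "(\<Prod>k<N. \<Prod>j<k. (exp (z k / complex_of_real R) - exp (z j / complex_of_real R)) ^ p)
        = (\<Prod>k<N. \<Prod>j\<in>{j\<in>{..<N}. j < k}. (w (z k) - w (z j))) ^ p"
      unfolding w_def prod_power_distrib[symmetric]
      by (intro prod.cong arg_cong2[where f="(^)"] refl) auto
    then have "(cmod (\<Prod>k<N. \<Prod>j<k. (exp (z k / complex_of_real R) - exp (z j / complex_of_real R)) ^ p))\<^sup>2
        = pairs {..<N} z ^ p"
      unfolding pairs_eq_cmod_squared[OF finite_lessThan]
      by (simp add: norm_power power_mult[symmetric] mult.commute)
    moreover have "(exp (- (1 / (2 * l\<^sup>2)) * (\<Sum>k<N. (Re (z k))\<^sup>2)))\<^sup>2 = (\<Prod>v<N. gauss 0 (z v))"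
    proof -
      have "(exp (- (1 / (2 * l\<^sup>2)) * (\<Sum>k<N. (Re (z k))\<^sup>2)))\<^sup>2 = exp (\<Sum>k<N. - ((Re (z k))\<^sup>2 / l\<^sup>2))"
        by (simp add: sum_negf sum_divide_distrib[symmetric] field_simps flip: exp_double)
      then show ?thesis by (simp add: gauss_def exp_sum)
    qed
    ultimately show ?thesis
      by (simp add: laughlin_def norm_mult power_mult_distrib dens_def)
  qed
  then have "normC R l p N = (kappa R l p N)\<^sup>2 * (area ^ N * gauss_sum g2 p 0 {..<N})"
    using integral_dens(2)[of "{..<N}" 0] by (simp add: normC_def strip_def)
  moreover have "(kappa R l p N)\<^sup>2 * area ^ N = exp (- g2 * (real p)\<^sup>2 * (\<Sum>j<N. (real j)\<^sup>2)) / fact N"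
  proof -
    have ar: "area > 0" using R l by simp
    have "(area powr (- real N / 2))\<^sup>2 = area powr (- real N)"
      by (simp add: power2_eq_square flip: powr_add)
    also have "\<dots> = inverse (area ^ N)" by (simp only: powr_minus powr_realpow[OF ar])
    finally have inv: "(area powr (- real N / 2))\<^sup>2 = inverse (area ^ N)" .
    have "area ^ N \<noteq> 0" using ar by (metis less_irrefl power_not_zero)
    then have "(area powr (- real N / 2))\<^sup>2 * area ^ N = 1"
      unfolding inv by (rule left_inverse)
    moreover have "(exp (- (1/2) * (real p)\<^sup>2 * (l / R)\<^sup>2 * (\<Sum>j<N. (real j)\<^sup>2)))\<^sup>2 = exp (- g2 * (real p)\<^sup>2 * (\<Sum>j<N. (real j)\<^sup>2))"
      by (simp flip: exp_double add: mult_ac)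
    moreover have "(1 / sqrt (fact N))\<^sup>2 = (1 / fact N :: real)" by (simp add: power_divide)
    ultimately show ?thesis
      unfolding kappa_def power_mult_distrib by (simp only: mult_ac) simp
  qed
  ultimately show ?thesis by (simp add: normalized_sum_def mult.assoc[symmetric])
qed

lemma normC_renewal:
  assumes "p \<ge> 1"
  shows "\<exists>a. (\<forall>k. a k \<ge> 0) \<and> a 0 = 0 \<and> a 1 > (0::real) \<and>
    (\<forall>n\<ge>1. normC R l p n = (\<Sum>k\<le>n. a k * normC R l p (n - k)))"
proof -
  have inv: "gauss_sum g2 p 0 S = gauss_sum g2 p 0 {..<card S}" if "finite S" for S
    by (rule gauss_sum_card[OF that])
  show ?thesis using normalized_sum_renewal[where g="g2", OF assms inv] by (simp only: normC_eq)
qed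

end

section \<open>Cutting the jellium\<close>

text \<open>About \<tau> / \<alpha> terms are bounded by 1, and the rest is dominated by a geometric
  series: a particle at depth \<tau> inside a row of spacing \<alpha> interacts with order \<tau> /
  \<alpha> others.\<close>

lemma sum_min_exp_le:
  fixes \<alpha> \<tau> :: real
  assumes \<alpha>: "\<alpha> > 0" and \<tau>: "\<tau> \<ge> 0"
  shows "(\<Sum>i<n. min 1 (exp (\<tau> - \<alpha> * real i))) \<le> \<tau> / \<alpha> + (1 + 1 / (1 - exp (- \<alpha>)))"
proof -
  define q where "q = nat \<lceil>\<tau> / \<alpha>\<rceil>"
  have q: "\<tau> / \<alpha> \<le> real q" "real q \<le> \<tau> / \<alpha> + 1"
    using \<alpha> \<tau> by (auto simp: q_def) 
  have "(\<Sum>i<n. min 1 (exp (\<tau> - \<alpha> * real i))) \<le> (\<Sum>i<n + q. min 1 (exp (\<tau> - \<alpha> * real i)))"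
    by (intro sum_mono2) auto
  also have "\<dots> = (\<Sum>i<q. min 1 (exp (\<tau> - \<alpha> * real i))) + (\<Sum>i=q..<n + q. min 1 (exp (\<tau> - \<alpha> * real i)))"
    by (subst sum.atLeastLessThan_concat[of 0 q "n + q", symmetric, unfolded atLeast0LessThan]) auto
  also have "(\<Sum>i<q. min 1 (exp (\<tau> - \<alpha> * real i))) \<le> (\<Sum>i<q. 1)" by (intro sum_mono) auto
  also have "(\<Sum>i=q..<n + q. min 1 (exp (\<tau> - \<alpha> * real i))) = (\<Sum>i<n. min 1 (exp (\<tau> - \<alpha> * real (i + q))))"
    by (simp add: sum.shift_bounds_nat_ivl[of _ 0 q n, simplified] atLeast0LessThan)
  also have "\<dots> \<le> (\<Sum>i<n. exp (- \<alpha>) ^ i)"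
  proof (rule sum_mono)
    fix i
    have "\<tau> \<le> \<alpha> * real q" using q(1) \<alpha> by (simp add: field_simps)
    then have "exp (\<tau> - \<alpha> * real (i + q)) \<le> exp (real i * - \<alpha>)" by (simp add: algebra_simps)
    then show "min 1 (exp (\<tau> - \<alpha> * real (i + q))) \<le> exp (- \<alpha>) ^ i" by (simp only: exp_of_nat_mult min.coboundedI2)
  qed
  also have "\<dots> \<le> (\<Sum>i. exp (- \<alpha>) ^ i)"
    using \<alpha> by (intro sum_le_suminf summable_geometric) auto
  also have "\<dots> = 1 / (1 - exp (- \<alpha>))" using \<alpha> by (intro suminf_geometric) auto
  finally show ?thesis using q(2) by simp
qed

lemma sum_inj_min_exp_le:
  fixes \<alpha> \<tau> :: real and h :: "nat \<Rightarrow> nat"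
  assumes \<alpha>: "\<alpha> > 0" and \<tau>: "\<tau> \<ge> 0" and X: "finite X" "inj_on h X"
    and f: "\<And>x. x \<in> X \<Longrightarrow> f x \<le> 1" "\<And>x. x \<in> X \<Longrightarrow> f x \<le> exp (\<tau> - \<alpha> * real (h x))"
  shows "sum f X \<le> \<tau> / \<alpha> + (1 + 1 / (1 - exp (- \<alpha>)))"
proof -
  obtain n where n: "h ` X \<subseteq> {..<n}" using X by (meson finite_imageI finite_nat_iff_bounded)
  have "sum f X \<le> (\<Sum>x\<in>X. min 1 (exp (\<tau> - \<alpha> * real (h x))))" using f by (intro sum_mono) auto
  also have "\<dots> = (\<Sum>i\<in>h ` X. min 1 (exp (\<tau> - \<alpha> * real i)))" using X by (simp add: sum.reindex)
  also have "\<dots> \<le> (\<Sum>i<n. min 1 (exp (\<tau> - \<alpha> * real i)))" using n by (intro sum_mono2) auto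
  also have "\<dots> \<le> \<tau> / \<alpha> + (1 + 1 / (1 - exp (- \<alpha>)))" by (rule sum_min_exp_le[OF \<alpha> \<tau>])
  finally show ?thesis .
qed

text \<open>\<open>t\<close> lists the sorted heights, \<open>s\<close> is the cut, and the indices
  from \<open>A0\<close> to below \<open>D0\<close> form the cluster. Outside it the particles
  recede linearly from the cut, so a cluster particle interacts with a number of them linear in its
  distance from \<open>s\<close>, and the two outer parts have bounded total interaction. Inside the
  cluster only the number of pairs is counted. Linear growth is what a quadratic energy can
  absorb.\<close>

lemma interaction_bound:
  fixes t :: "nat \<Rightarrow> real" and \<alpha> s :: real and N A0 D0 n :: nat
  assumes \<alpha>: "\<alpha> > 0" and mono: "\<And>i j. i \<le> j \<Longrightarrow> j < n \<Longrightarrow> t i \<le> t j"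
    and ord: "A0 < N" "N \<le> D0" "D0 \<le> n"
    and goodL: "\<And>j. j < A0 \<Longrightarrow> t j \<le> s - \<alpha> * real (N - 1 - j)"
    and goodR: "\<And>k. D0 \<le> k \<Longrightarrow> k < n \<Longrightarrow> t k \<ge> s + \<alpha> * real (k - N)"
  defines "c0 \<equiv> 1 + 1 / (1 - exp (- \<alpha>))"
  shows "(\<Sum>k=A0..<D0. \<Sum>j<k. exp (t j - t k)) + (\<Sum>k=D0..<n. \<Sum>j<D0. exp (t j - t k))
    \<le> (real (D0 - A0))\<^sup>2 + (\<Sum>k=A0..<D0. 2 * (\<bar>t k - s\<bar> / \<alpha> + c0)) + c0\<^sup>2"
proof -
  have le1: "exp (t j - t k) \<le> 1" if "j \<le> k" "k < n" for j k using mono[OF that] by simp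
  have L: "(\<Sum>j<A0. exp (t j - t k)) \<le> \<bar>t k - s\<bar> / \<alpha> + c0" if k: "A0 \<le> k" "k < n" for k
    unfolding c0_def
  proof (rule sum_inj_min_exp_le[OF \<alpha>, where h="\<lambda>j. N - 1 - j"])
    show "inj_on (\<lambda>j. N - 1 - j) {..<A0}" using ord by (auto simp: inj_on_def)
    fix j assume j: "j \<in> {..<A0}"
    then show "exp (t j - t k) \<le> 1" using k by (intro le1) auto
    show "exp (t j - t k) \<le> exp (\<bar>t k - s\<bar> - \<alpha> * real (N - 1 - j))" using goodL[of j] j by auto
  qed auto
  have Rr: "(\<Sum>k=D0..<n. exp (t j - t k)) \<le> \<bar>t j - s\<bar> / \<alpha> + c0" if j: "j < D0" for j
    unfolding c0_def
  proof (rule sum_inj_min_exp_le[OF \<alpha>, where h="\<lambda>k. k - N"])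
    show "inj_on (\<lambda>k. k - N) {D0..<n}" using ord by (auto simp: inj_on_def)
    fix k assume k: "k \<in> {D0..<n}"
    then show "exp (t j - t k) \<le> 1" using j by (intro le1) auto
    show "exp (t j - t k) \<le> exp (\<bar>t j - s\<bar> - \<alpha> * real (k - N))" using goodR[of k] k by auto
  qed auto
  have LR: "(\<Sum>k=D0..<n. \<Sum>j<A0. exp (t j - t k)) \<le> c0\<^sup>2"
  proof -
    have "(\<Sum>k=D0..<n. \<Sum>j<A0. exp (t j - t k)) \<le>
        (\<Sum>k=D0..<n. \<Sum>j<A0. exp (- (\<alpha> * real (k - N))) * exp (- (\<alpha> * real (N - 1 - j))))"
    proof (intro sum_mono)
      fix k j assume "k \<in> {D0..<n}" "j \<in> {..<A0}"
      then show "exp (t j - t k) \<le> exp (- (\<alpha> * real (k - N))) * exp (- (\<alpha> * real (N - 1 - j)))"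
        using goodL[of j] goodR[of k] by (simp flip: exp_add)
    qed
    also have "\<dots> = (\<Sum>k=D0..<n. exp (- (\<alpha> * real (k - N)))) * (\<Sum>j<A0. exp (- (\<alpha> * real (N - 1 - j))))"
      by (simp add: sum_product)
    also have "\<dots> \<le> c0 * c0"
    proof (rule mult_mono)
      have "(\<Sum>k=D0..<n. exp (- (\<alpha> * real (k - N)))) \<le> 0 / \<alpha> + c0" unfolding c0_def
        by (rule sum_inj_min_exp_le[OF \<alpha> order_refl, where h="\<lambda>k. k - N"]) (use \<alpha> ord in \<open>auto simp: inj_on_def\<close>)
      then show "(\<Sum>k=D0..<n. exp (- (\<alpha> * real (k - N)))) \<le> c0" by simp
      have "(\<Sum>j<A0. exp (- (\<alpha> * real (N - 1 - j)))) \<le> 0 / \<alpha> + c0" unfolding c0_def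
        by (rule sum_inj_min_exp_le[OF \<alpha> order_refl, where h="\<lambda>j. N - 1 - j"]) (use \<alpha> ord in \<open>auto simp: inj_on_def\<close>)
      then show "(\<Sum>j<A0. exp (- (\<alpha> * real (N - 1 - j)))) \<le> c0" by simp
    qed (use \<alpha> in \<open>auto simp: c0_def intro!: sum_nonneg\<close>)
    finally show ?thesis by (simp add: power2_eq_square)
  qed
  have B: "(\<Sum>j<k. exp (t j - t k)) \<le> \<bar>t k - s\<bar> / \<alpha> + c0 + real (D0 - A0)" if k: "k \<in> {A0..<D0}" for k
  proof -
    have "(\<Sum>j<k. exp (t j - t k)) = (\<Sum>j<A0. exp (t j - t k)) + (\<Sum>j=A0..<k. exp (t j - t k))"
      using k by (subst sum.atLeastLessThan_concat[of 0 A0 k, symmetric, unfolded atLeast0LessThan]) auto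
    moreover have "(\<Sum>j=A0..<k. exp (t j - t k)) \<le> (\<Sum>j=A0..<k. 1)"
      using k ord by (intro sum_mono le1) auto
    moreover have "(\<Sum>j<A0. exp (t j - t k)) \<le> \<bar>t k - s\<bar> / \<alpha> + c0" using k ord by (intro L) auto
    moreover have "real (k - A0) \<le> real (D0 - A0)" using k by simp
    ultimately show ?thesis by simp
  qed
  have "(\<Sum>k=A0..<D0. \<Sum>j<k. exp (t j - t k)) \<le> (\<Sum>k=A0..<D0. \<bar>t k - s\<bar> / \<alpha> + c0 + real (D0 - A0))"
    by (intro sum_mono B)
  also have "\<dots> = (\<Sum>k=A0..<D0. \<bar>t k - s\<bar> / \<alpha> + c0) + (real (D0 - A0))\<^sup>2"
    using ord by (simp add: sum.distrib power2_eq_square of_nat_diff)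
  finally have 1: "(\<Sum>k=A0..<D0. \<Sum>j<k. exp (t j - t k)) \<le> (\<Sum>k=A0..<D0. \<bar>t k - s\<bar> / \<alpha> + c0) + (real (D0 - A0))\<^sup>2" .
  have "(\<Sum>k=D0..<n. \<Sum>j<D0. exp (t j - t k)) =
      (\<Sum>k=D0..<n. (\<Sum>j<A0. exp (t j - t k)) + (\<Sum>j=A0..<D0. exp (t j - t k)))"
    using ord by (intro sum.cong refl, subst sum.atLeastLessThan_concat[of 0 A0 D0, symmetric, unfolded atLeast0LessThan]) auto
  also have "\<dots> = (\<Sum>k=D0..<n. \<Sum>j<A0. exp (t j - t k)) + (\<Sum>j=A0..<D0. \<Sum>k=D0..<n. exp (t j - t k))"
    by (simp only: sum.distrib) (subst (2) sum.swap, rule refl)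
  also have "\<dots> \<le> c0\<^sup>2 + (\<Sum>k=A0..<D0. \<bar>t k - s\<bar> / \<alpha> + c0)"
    by (intro add_mono LR sum_mono Rr) auto
  finally show ?thesis using 1 unfolding sum_distrib_left[symmetric] by linarith
qed

section \<open>Energy of a cluster near the cut\<close>

lemma cube_le_sum_squares:
  fixes a :: real and f :: "nat \<Rightarrow> real"
  assumes X: "X \<subseteq> Y" "finite Y" "real i \<le> 4 * real (card X)"
    and f: "\<And>k. k \<in> X \<Longrightarrow> (a * real i / 4)\<^sup>2 \<le> f k" "\<And>k. f k \<ge> 0"
  shows "a\<^sup>2 / 64 * real i ^ 3 \<le> sum f Y"
proof -
  have "a\<^sup>2 / 64 * real i ^ 3 = real i / 4 * (a * real i / 4)\<^sup>2"
    by (simp add: power2_eq_square power3_eq_cube)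
  also have "\<dots> \<le> real (card X) * (a * real i / 4)\<^sup>2" using X(3) by (intro mult_right_mono) auto
  also have "\<dots> \<le> sum f X" using sum_mono[of X "\<lambda>_. (a * real i / 4)\<^sup>2" f] f(1) by simp
  also have "\<dots> \<le> sum f Y" using X f(2) by (intro sum_mono2) auto
  finally show ?thesis .
qed

text \<open>The equilibrium position of particle k is \<open>a * k\<close>. If particle K - i lies
  more than a i / 2 above its own, the order drags the next i / 4 particles along, and each of them
  is still displaced by at least a i / 4; this makes the energy cubic in i.\<close>

lemma cluster_energy_left:
  fixes t :: "nat \<Rightarrow> real"
  assumes a: "a \<ge> 0" and mono: "\<And>i j. i \<le> j \<Longrightarrow> j \<le> K \<Longrightarrow> t i \<le> t j"
    and i: "i \<le> K" and bad: "i = 0 \<or> t (K - i) > a * real K - a / 2 * real i"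
  shows "a\<^sup>2 / 64 * real i ^ 3 \<le> (\<Sum>k=K - i..K. (t k - a * real k)\<^sup>2)"
proof (cases "i = 0")
  case True then show ?thesis by (simp add: sum_nonneg)
next
  case False
  define X where "X = {K - i..K - i + i div 4}"
  have X: "X \<subseteq> {K - i..K}" using i by (auto simp: X_def)
  have lb: "(a * real i / 4)\<^sup>2 \<le> (t k - a * real k)\<^sup>2" if k: "k \<in> X" for k
  proof -
    have "t (K - i) \<le> t k" using k X by (intro mono) (auto simp: X_def)
    then have 1: "t k > a * real K - a / 2 * real i" using bad False by simp
    have "k \<le> K - i + i div 4" using k by (simp add: X_def)
    then have "real k \<le> real K - real i + real i / 4" using i by (simp add: of_nat_diff)
    then have "a * real k \<le> a * (real K - real i + real i / 4)" using a by (intro mult_left_mono)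
    then have "a * real i / 4 \<le> t k - a * real k" using 1 by (simp add: algebra_simps)
    then show ?thesis using a by (intro power_mono) auto
  qed
  have "i \<le> 4 * (i div 4 + 1)" by presburger
  then have "real i \<le> 4 * real (card X)" by (simp add: X_def)
  then show ?thesis using X lb by (intro cube_le_sum_squares[where X=X]) auto
qed

text \<open>The mirror image: a particle that is too low pushes down the quarter of the cluster just
  below it.\<close>

lemma cluster_energy_right:
  fixes t :: "nat \<Rightarrow> real"
  assumes a: "a \<ge> 0" and mono: "\<And>i k. i \<le> k \<Longrightarrow> k \<le> K + 1 + j \<Longrightarrow> t i \<le> t k"
    and bad: "j = 0 \<or> t (K + 1 + j) < a * real K + a / 2 * real j"
  shows "a\<^sup>2 / 64 * real j ^ 3 \<le> (\<Sum>k=K + 1..K + 1 + j. (t k - a * real k)\<^sup>2)"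
proof (cases "j = 0")
  case True then show ?thesis by (simp add: sum_nonneg)
next
  case False
  define X where "X = {K + 1 + j - j div 4..K + 1 + j}"
  have X: "X \<subseteq> {K + 1..K + 1 + j}" by (auto simp: X_def)
  have lb: "(a * real j / 4)\<^sup>2 \<le> (t k - a * real k)\<^sup>2" if k: "k \<in> X" for k
  proof -
    have "t k \<le> t (K + 1 + j)" using k X by (intro mono) (auto simp: X_def)
    then have 1: "t k < a * real K + a / 2 * real j" using bad False by simp
    have "K + j - j div 4 \<le> k" using k unfolding X_def atLeastAtMost_iff by linarith
    then have "real K + real j - real j / 4 \<le> real k" by linarith
    then have "a * (real K + real j - real j / 4) \<le> a * real k" using a by (intro mult_left_mono)
    then have "a * real j / 4 \<le> a * real k - t k" using 1 by (simp add: algebra_simps)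
    then have "(a * real j / 4)\<^sup>2 \<le> (a * real k - t k)\<^sup>2" using a by (intro power_mono) auto
    then show ?thesis by (simp add: power2_commute)
  qed
  have "j \<le> 4 * (j div 4 + 1)" by presburger
  then have "real j \<le> 4 * real (card X)" by (simp add: X_def Suc_diff_le)
  then show ?thesis using X lb by (intro cube_le_sum_squares[where X=X]) auto
qed

text \<open>Young's inequality. The quadratic term is half of the re-centred energy that
  \<open>cluster_energy\<close> retains; the other half becomes \<open>bump\<close>.\<close>

lemma mult_le_weighted_squares:
  fixes c x g :: real
  assumes g: "g > 0"
  shows "c * x \<le> x\<^sup>2 / (4096 * g) + c\<^sup>2 * (1024 * g)"
proof -
  have "x\<^sup>2 / (4096 * g) + c\<^sup>2 * (1024 * g) - c * x = (x - 2048 * g * c)\<^sup>2 / (4096 * g)"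
    using g by (simp add: power2_eq_square field_simps)
  moreover have "(x - 2048 * g * c)\<^sup>2 / (4096 * g) \<ge> 0" using g by simp
  ultimately show ?thesis by linarith
qed

text \<open>With P = p, the linear term is the push of the k lower particles, and the equilibrium of
  the k-th particle comes out as p g k.\<close>

lemma complete_square:
  fixes g P k t :: real
  assumes "g > 0"
  shows "2 * (P * k) * t - t\<^sup>2 / g = g * P\<^sup>2 * k\<^sup>2 - (t - P * g * k)\<^sup>2 / g"
  using assms by (simp add: power2_eq_square field_simps)

lemma cube_Suc_le: "(real i + 1) ^ 3 \<le> 4 * real i ^ 3 + 4"
proof -
  have "4 * real i ^ 3 + 4 - (real i + 1) ^ 3 = 3 * (real i + 1) * (real i - 1)\<^sup>2"
    by (simp add: power2_eq_square power3_eq_cube algebra_simps)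
  moreover have "0 \<le> 3 * (real i + 1) * (real i - 1)\<^sup>2" by simp
  ultimately show ?thesis by linarith
qed

text \<open>A fraction \<open>1 / 1024\<close> of the quadratic energy is re-centred at the interface \<open>a * K\<close>, which
  makes the remaining weight of the cluster symmetric in its particles.\<close>

lemma cluster_energy:
  fixes t :: "nat \<Rightarrow> real"
  assumes a: "a \<ge> 0" and mono: "\<And>i k. i \<le> k \<Longrightarrow> k \<le> K + 1 + j \<Longrightarrow> t i \<le> t k"
    and i: "i \<le> K" and badL: "i = 0 \<or> t (K - i) > a * real K - a / 2 * real i"
    and badR: "j = 0 \<or> t (K + 1 + j) < a * real K + a / 2 * real j"
  shows "a\<^sup>2 / 128 * (real i ^ 3 + real j ^ 3) - a\<^sup>2 / 128 + (\<Sum>k=K - i..K + 1 + j. (t k - a * real K)\<^sup>2) / 2048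
    \<le> (\<Sum>k=K - i..K + 1 + j. (t k - a * real k)\<^sup>2)"
proof -
  define B where "B = {K - i..K + 1 + j}"
  have un: "B = {K - i..K} \<union> {K + 1..K + 1 + j}" "{K - i..K} \<inter> {K + 1..K + 1 + j} = {}"
    using i by (auto simp: B_def)
  define E where "E = (\<Sum>k\<in>B. (t k - a * real k)\<^sup>2)"
  have "E = (\<Sum>k=K - i..K. (t k - a * real k)\<^sup>2) + (\<Sum>k=K + 1..K + 1 + j. (t k - a * real k)\<^sup>2)"
    unfolding E_def un(1) using un(2) by (intro sum.union_disjoint) auto
  moreover have "a\<^sup>2 / 64 * real i ^ 3 \<le> (\<Sum>k=K - i..K. (t k - a * real k)\<^sup>2)"
    using mono by (intro cluster_energy_left a i badL) auto
  moreover have "a\<^sup>2 / 64 * real j ^ 3 \<le> (\<Sum>k=K + 1..K + 1 + j. (t k - a * real k)\<^sup>2)"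
    using mono by (intro cluster_energy_right a badR) auto
  ultimately have E1: "a\<^sup>2 / 64 * (real i ^ 3 + real j ^ 3) \<le> E" by (simp add: distrib_left)
  \<comment> \<open>Re-centring from \<open>a * k\<close> to \<open>a * K\<close> costs the squared
    distance of the two sites; over the cluster this adds up to a term cubic in i and j.\<close>
  have sq: "(x - y)\<^sup>2 / 2 - z\<^sup>2 \<le> (x - y - z)\<^sup>2" for x y z :: real
  proof -
    have "(x - y - z)\<^sup>2 - ((x - y)\<^sup>2 / 2 - z\<^sup>2) = ((x - y) - 2 * z)\<^sup>2 / 2"
      by (simp add: power2_eq_square field_simps)
    moreover have "((x - y) - 2 * z)\<^sup>2 / 2 \<ge> 0" by simp
    ultimately show ?thesis by linarith
  qed
  have "(\<Sum>k\<in>B. (t k - a * real K)\<^sup>2 / 2 - (a * (real k - real K))\<^sup>2) \<le> E"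
    unfolding E_def
  proof (rule sum_mono)
    fix k
    show "(t k - a * real K)\<^sup>2 / 2 - (a * (real k - real K))\<^sup>2 \<le> (t k - a * real k)\<^sup>2"
      using sq[of "t k" "a * real K" "a * (real k - real K)"] by (simp add: algebra_simps)
  qed
  moreover have "(\<Sum>k\<in>B. (a * (real k - real K))\<^sup>2) \<le> a\<^sup>2 * ((real i + 1) ^ 3 + (real j + 1) ^ 3)"
  proof -
    have "(\<Sum>k=K - i..K. (a * (real k - real K))\<^sup>2) \<le> (\<Sum>k=K - i..K. a\<^sup>2 * (real i + 1)\<^sup>2)"
    proof (rule sum_mono)
      fix k assume "k \<in> {K - i..K}"
      then have "\<bar>real k - real K\<bar> \<le> \<bar>real i + 1\<bar>" using i by auto
      then have "(real k - real K)\<^sup>2 \<le> (real i + 1)\<^sup>2" by (simp only: abs_le_square_iff)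
      then show "(a * (real k - real K))\<^sup>2 \<le> a\<^sup>2 * (real i + 1)\<^sup>2" by (simp add: power_mult_distrib mult_left_mono)
    qed
    also have "\<dots> = a\<^sup>2 * (real i + 1) ^ 3" using i by (simp add: power2_eq_square power3_eq_cube of_nat_diff Suc_diff_le)
    finally have 1: "(\<Sum>k=K - i..K. (a * (real k - real K))\<^sup>2) \<le> a\<^sup>2 * (real i + 1) ^ 3" .
    have "(\<Sum>k=K + 1..K + 1 + j. (a * (real k - real K))\<^sup>2) \<le> (\<Sum>k=K + 1..K + 1 + j. a\<^sup>2 * (real j + 1)\<^sup>2)"
    proof (rule sum_mono)
      fix k assume "k \<in> {K + 1..K + 1 + j}"
      then have "\<bar>real k - real K\<bar> \<le> \<bar>real j + 1\<bar>" by auto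
      then have "(real k - real K)\<^sup>2 \<le> (real j + 1)\<^sup>2" by (simp only: abs_le_square_iff)
      then show "(a * (real k - real K))\<^sup>2 \<le> a\<^sup>2 * (real j + 1)\<^sup>2" by (simp add: power_mult_distrib mult_left_mono)
    qed
    also have "\<dots> = a\<^sup>2 * (real j + 1) ^ 3" by (simp add: power2_eq_square power3_eq_cube)
    finally have 2: "(\<Sum>k=K + 1..K + 1 + j. (a * (real k - real K))\<^sup>2) \<le> a\<^sup>2 * (real j + 1) ^ 3" .
    have "(\<Sum>k\<in>B. (a * (real k - real K))\<^sup>2) =
      (\<Sum>k=K - i..K. (a * (real k - real K))\<^sup>2) + (\<Sum>k=K + 1..K + 1 + j. (a * (real k - real K))\<^sup>2)"
      unfolding un(1) using un(2) by (intro sum.union_disjoint) auto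
    then show ?thesis using 1 2 by (simp add: distrib_left)
  qed
  moreover have "a\<^sup>2 * ((real i + 1) ^ 3 + (real j + 1) ^ 3) \<le> a\<^sup>2 * (4 * real i ^ 3 + 4 + (4 * real j ^ 3 + 4))"
    by (intro mult_left_mono add_mono cube_Suc_le) auto
  ultimately have E2: "(\<Sum>k\<in>B. (t k - a * real K)\<^sup>2) / 2 - a\<^sup>2 * (4 * (real i ^ 3 + real j ^ 3) + 8) \<le> E"
    by (simp add: sum_subtractf sum_divide_distrib[symmetric] algebra_simps)
  \<comment> \<open>The two lower bounds for \<open>E\<close> are combined with weights 1023 / 1024
    and 1 / 1024. The second weight is so small that its cubic loss 4 c leaves half of the first
    bound intact.\<close>
  have ar: "c / 128 - b / 128 + T / 2048 \<le> E" if "c / 64 \<le> E" "T / 2 - (4 * c + 8 * b) \<le> E" "0 \<le> c" for c b T :: real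
    using that by linarith
  have "a\<^sup>2 * (real i ^ 3 + real j ^ 3) / 128 - a\<^sup>2 / 128 + (\<Sum>k\<in>B. (t k - a * real K)\<^sup>2) / 2048 \<le> E"
  proof (rule ar)
    show "a\<^sup>2 * (real i ^ 3 + real j ^ 3) / 64 \<le> E" using E1 by simp
    show "(\<Sum>k\<in>B. (t k - a * real K)\<^sup>2) / 2 - (4 * (a\<^sup>2 * (real i ^ 3 + real j ^ 3)) + 8 * a\<^sup>2) \<le> E"
      using E2 by (simp add: algebra_simps)
  qed simp
  then show ?thesis unfolding E_def[symmetric] B_def[symmetric] by simp
qed

section \<open>Pointwise factorisation of the density at the cut\<close>

context cylinder
begin

definition height :: "complex \<Rightarrow> real" where "height z = Re z / R"

lemma gauss_height: "gauss q z = exp (2 * q * height z - (height z)\<^sup>2 / g2)"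
  using R l by (simp add: gauss_def height_def power_divide)

text \<open>Used with x as the higher particle: the interaction is then the linear potential
  \<open>height x\<close> of one-dimensional jellium, up to an error decaying exponentially in the
  distance.\<close>

lemma cmod_w_diff_le: "cmod (w x - w y) \<le> exp (height x + exp (height y - height x))"
proof -
  have cw: "cmod (w z) = exp (height z)" for z by (simp add: w_def height_def)
  have "cmod (w x - w y) \<le> exp (height x) + exp (height y)" using norm_triangle_ineq4[of "w x" "w y"] by (simp add: cw)
  also have "\<dots> = exp (height x) * (1 + exp (height y - height x))" by (simp add: distrib_left mult_exp_exp)
  also have "\<dots> \<le> exp (height x) * exp (exp (height y - height x))"
    by (intro mult_left_mono exp_ge_add_one_self) auto
  finally show ?thesis by (simp add: exp_add)
qed

lemma prod_cmod_w_diff_le: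
  assumes "finite X"
  shows "(\<Prod>j\<in>X. cmod (w x - w (y j))) \<le> exp (real (card X) * height x + (\<Sum>j\<in>X. exp (height (y j) - height x)))"
proof -
  have "(\<Prod>j\<in>X. cmod (w x - w (y j))) \<le> (\<Prod>j\<in>X. exp (height x + exp (height (y j) - height x)))"
    by (intro prod_mono) (auto intro: cmod_w_diff_le)
  also have "\<dots> = exp (\<Sum>j\<in>X. height x + exp (height (y j) - height x))" by (simp add: exp_sum assms)
  finally show ?thesis by (simp add: sum.distrib)
qed

text \<open>Factors within the left and within the right block are kept, and every other pair is
  estimated through its particle of larger index. Cluster particle k has k predecessors; each right
  particle has \<open>D0\<close> predecessors outside its block, so the coefficient of its linear
  term is common to the whole block.\<close>

lemma pairs_split_bound:
  fixes y :: "nat \<Rightarrow> complex"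
  assumes ord: "A0 \<le> D0" "D0 \<le> n"
  defines "t \<equiv> \<lambda>k. height (y k)"
  shows "pairs {..<n} y \<le> pairs {..<A0} y * pairs {D0..<n} y *
    exp (2 * ((\<Sum>k=A0..<D0. real k * t k) + (\<Sum>k=D0..<n. real D0 * t k) +
      ((\<Sum>k=A0..<D0. \<Sum>j<k. exp (t j - t k)) + (\<Sum>k=D0..<n. \<Sum>j<D0. exp (t j - t k)))))"
proof -
  let ?d = "\<lambda>k j. cmod (w (y k) - w (y j))"
  define P where "P S = (\<Prod>k\<in>S. \<Prod>j\<in>{j\<in>S. j < k}. ?d k j)" for S
  have pairsP: "pairs S y = (P S)\<^sup>2" if "finite S" for S
    unfolding pairs_eq_cmod_squared[OF that] P_def by (simp add: prod_norm[symmetric])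
  have P0: "P S \<ge> 0" for S by (auto simp: P_def intro!: prod_nonneg)
  have PL: "P {..<m} = (\<Prod>k<m. \<Prod>j<k. ?d k j)" for m
    unfolding P_def by (intro prod.cong refl) auto
  have "P {..<n} = (\<Prod>k<A0. \<Prod>j<k. ?d k j) * (\<Prod>k=A0..<D0. \<Prod>j<k. ?d k j) * (\<Prod>k=D0..<n. \<Prod>j<k. ?d k j)"
    unfolding PL using ord
    by (simp add: prod.atLeastLessThan_concat[of 0 D0 n, symmetric, unfolded atLeast0LessThan]
        prod.atLeastLessThan_concat[of 0 A0 D0, symmetric, unfolded atLeast0LessThan])
  also have "\<dots> \<le> P {..<A0} * exp (\<Sum>k=A0..<D0. real k * t k + (\<Sum>j<k. exp (t j - t k))) *
      (P {D0..<n} * exp (\<Sum>k=D0..<n. real D0 * t k + (\<Sum>j<D0. exp (t j - t k))))"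
  proof (intro mult_mono)
    show "(\<Prod>k<A0. \<Prod>j<k. ?d k j) \<le> P {..<A0}" by (simp add: PL)
    show "(\<Prod>k=A0..<D0. \<Prod>j<k. ?d k j) \<le> exp (\<Sum>k=A0..<D0. real k * t k + (\<Sum>j<k. exp (t j - t k)))"
      unfolding exp_sum[OF finite_atLeastLessThan]
    proof (rule prod_mono)
      fix k
      show "0 \<le> (\<Prod>j<k. ?d k j) \<and> (\<Prod>j<k. ?d k j) \<le> exp (real k * t k + (\<Sum>j<k. exp (t j - t k)))"
        using prod_cmod_w_diff_le[of "{..<k}" "y k" y] by (auto simp: t_def intro!: prod_nonneg)
    qed
    have "(\<Prod>k=D0..<n. \<Prod>j<k. ?d k j) =
        (\<Prod>k=D0..<n. (\<Prod>j\<in>{j\<in>{D0..<n}. j < k}. ?d k j) * (\<Prod>j<D0. ?d k j))"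
    proof (rule prod.cong[OF refl])
      fix k assume "k \<in> {D0..<n}"
      then have k: "{..<k} = {j\<in>{D0..<n}. j < k} \<union> {..<D0}" by auto
      show "(\<Prod>j<k. ?d k j) = (\<Prod>j\<in>{j\<in>{D0..<n}. j < k}. ?d k j) * (\<Prod>j<D0. ?d k j)"
        unfolding k by (rule prod.union_disjoint) auto
    qed
    also have "\<dots> = P {D0..<n} * (\<Prod>k=D0..<n. \<Prod>j<D0. ?d k j)" by (simp add: prod.distrib P_def)
    also have "\<dots> \<le> P {D0..<n} * exp (\<Sum>k=D0..<n. real D0 * t k + (\<Sum>j<D0. exp (t j - t k)))"
      unfolding exp_sum[OF finite_atLeastLessThan]
    proof (intro mult_left_mono P0 prod_mono)
      fix k
      show "0 \<le> (\<Prod>j<D0. ?d k j) \<and> (\<Prod>j<D0. ?d k j) \<le> exp (real D0 * t k + (\<Sum>j<D0. exp (t j - t k)))"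
        using prod_cmod_w_diff_le[of "{..<D0}" "y k" y] by (auto simp: t_def intro!: prod_nonneg)
    qed
    finally show "(\<Prod>k=D0..<n. \<Prod>j<k. ?d k j) \<le>
      P {D0..<n} * exp (\<Sum>k=D0..<n. real D0 * t k + (\<Sum>j<D0. exp (t j - t k)))" .
  qed (auto simp: P0 intro!: prod_nonneg mult_nonneg_nonneg)
  finally have "P {..<n} \<le> P {..<A0} * P {D0..<n} * exp ((\<Sum>k=A0..<D0. real k * t k) + (\<Sum>k=D0..<n. real D0 * t k) +
      ((\<Sum>k=A0..<D0. \<Sum>j<k. exp (t j - t k)) + (\<Sum>k=D0..<n. \<Sum>j<D0. exp (t j - t k))))" (is "_ \<le> _ * exp ?X")
    by (simp add: sum.distrib exp_add mult_ac)
  then have "(P {..<n})\<^sup>2 \<le> (P {..<A0} * P {D0..<n} * exp ?X)\<^sup>2" using P0 by (intro power_mono)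
  then show ?thesis
    by (simp only: pairsP finite_lessThan finite_atLeastLessThan power_mult_distrib exp_double)
qed

text \<open>The common linear term of the right block is precisely a tilt of its Gaussians by
  \<open>p * D0\<close>, so the right factor belongs to the family \<open>dens\<close>
  again.\<close>

lemma dens_split_bound:
  fixes y :: "nat \<Rightarrow> complex"
  assumes ord: "A0 \<le> D0" "D0 \<le> n"
  defines "t \<equiv> \<lambda>k. height (y k)"
  shows "dens 0 {..<n} y \<le> dens 0 {..<A0} y * dens (real (p * D0)) {D0..<n} y *
    exp ((\<Sum>k=A0..<D0. 2 * real (p * k) * t k - (t k)\<^sup>2 / g2) +
      2 * real p * ((\<Sum>k=A0..<D0. \<Sum>j<k. exp (t j - t k)) + (\<Sum>k=D0..<n. \<Sum>j<D0. exp (t j - t k))))"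
proof -
  define Err where "Err = (\<Sum>k=A0..<D0. \<Sum>j<k. exp (t j - t k)) + (\<Sum>k=D0..<n. \<Sum>j<D0. exp (t j - t k))"
  define G where "G S = (\<Prod>v\<in>S. gauss 0 (y v))" for S
  have G0: "G S \<ge> 0" for S by (auto simp: G_def intro!: prod_nonneg less_imp_le[OF gauss_pos])
  have Gsplit: "G {..<n} = G {..<A0} * G {A0..<D0} * G {D0..<n}"
    unfolding G_def using ord
    by (simp add: prod.atLeastLessThan_concat[of 0 D0 n, symmetric, unfolded atLeast0LessThan]
        prod.atLeastLessThan_concat[of 0 A0 D0, symmetric, unfolded atLeast0LessThan])
  have "pairs {..<n} y ^ p \<le> (pairs {..<A0} y * pairs {D0..<n} y *
      exp (2 * ((\<Sum>k=A0..<D0. real k * t k) + (\<Sum>k=D0..<n. real D0 * t k) + Err))) ^ p"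
    unfolding Err_def t_def by (intro power_mono pairs_split_bound[OF ord] pairs_nonneg)
  also have "\<dots> = pairs {..<A0} y ^ p * pairs {D0..<n} y ^ p *
      (exp (\<Sum>k=A0..<D0. 2 * real (p * k) * t k) * exp (\<Sum>k=D0..<n. 2 * real (p * D0) * t k) * exp (2 * real p * Err))"
    by (simp add: power_mult_distrib exp_of_nat_mult[symmetric] mult_exp_exp sum_distrib_left algebra_simps)
  finally have "dens 0 {..<n} y \<le> pairs {..<A0} y ^ p * pairs {D0..<n} y ^ p *
      (exp (\<Sum>k=A0..<D0. 2 * real (p * k) * t k) * exp (\<Sum>k=D0..<n. 2 * real (p * D0) * t k) * exp (2 * real p * Err))
      * G {..<n}"
    unfolding dens_def G_def[symmetric] by (intro mult_right_mono G0)
  also have "\<dots> = (pairs {..<A0} y ^ p * G {..<A0}) * (pairs {D0..<n} y ^ p * (exp (\<Sum>k=D0..<n. 2 * real (p * D0) * t k) * G {D0..<n}))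
      * ((exp (\<Sum>k=A0..<D0. 2 * real (p * k) * t k) * G {A0..<D0}) * exp (2 * real p * Err))"
    unfolding Gsplit by (simp only: mult_ac)
  also have "exp (\<Sum>k=D0..<n. 2 * real (p * D0) * t k) * G {D0..<n} = (\<Prod>v=D0..<n. gauss (real (p * D0)) (y v))"
    unfolding G_def exp_sum[OF finite_atLeastLessThan] prod.distrib[symmetric]
    by (intro prod.cong refl) (simp add: gauss_height t_def mult_exp_exp)
  also have "exp (\<Sum>k=A0..<D0. 2 * real (p * k) * t k) * G {A0..<D0} = exp (\<Sum>k=A0..<D0. 2 * real (p * k) * t k - (t k)\<^sup>2 / g2)"
    unfolding G_def exp_sum[OF finite_atLeastLessThan] prod.distrib[symmetric]
    by (intro prod.cong refl) (simp add: gauss_height t_def mult_exp_exp)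
  finally show ?thesis by (simp add: dens_def G_def Err_def exp_add)
qed

text \<open>Distance between neighbouring equilibrium positions, measured in
  \<open>height\<close>.\<close>

definition spacing :: real where "spacing = real p * g2"
text \<open>The constant \<open>c0\<close> of \<open>interaction_bound\<close> at half the
  equilibrium spacing, the rate at which the outer particles are guaranteed to recede.\<close>

definition geo :: real where "geo = 1 + 1 / (1 - exp (- (spacing / 2)))"
text \<open>The remainder of Young's inequality per cluster particle. The slope 8 p / spacing is 2 p
  from the density, times 2 from \<open>interaction_bound\<close>, times 2 from halving the
  spacing.\<close>

definition absorb :: real where "absorb = (8 * real p / spacing)\<^sup>2 * (1024 * g2)"
text \<open>The price of one side of the cluster: cubic energy against quadratic interaction.
  Constants common to both sides are charged to each, so that the total is at most a product over
  the sides.\<close>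

definition cost :: "nat \<Rightarrow> real" where
  "cost i = exp (spacing\<^sup>2 / (128 * g2) + 2 * real p * geo\<^sup>2
    + 2 * (2 * real p + 4 * real p * geo + absorb) * (real i + 1)\<^sup>2 - spacing\<^sup>2 / (128 * g2) * real i ^ 3)"
definition bump :: "real \<Rightarrow> complex \<Rightarrow> real" where
  "bump s z = exp (- ((height z - s)\<^sup>2 / (4096 * g2)))"

lemma g2_pos: "g2 > 0" using R l by simp

lemma geo_ge_1: "p \<ge> 1 \<Longrightarrow> geo \<ge> 1"
  using g2_pos by (simp add: geo_def spacing_def)

text \<open>On each side the cluster reaches to the farthest particle that fails to recede linearly
  from the cut. Maximality makes all particles beyond it good, and the failure itself supplies the
  cubic energy.\<close>

lemma dens_sorted_bound:
  assumes p: "p \<ge> 1" and NM: "N \<ge> 1" "M \<ge> 1"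
    and mono: "\<And>i j. i \<le> j \<Longrightarrow> j < N + M \<Longrightarrow> height (y i) \<le> height (y j)"
  shows "\<exists>i<N. \<exists>j<M. dens 0 {..<N + M} y \<le> cost i * cost j *
    exp (g2 * (real p)\<^sup>2 * (\<Sum>k=N - 1 - i..<N + j + 1. (real k)\<^sup>2)) *
    (dens 0 {..<N - 1 - i} y * dens (real (p * (N + j + 1))) {N + j + 1..<N + M} y *
    (\<Prod>k=N - 1 - i..<N + j + 1. bump (spacing * real (N - 1)) (y k)))"
proof -
  define a where "a = spacing"
  define t where "t k = height (y k)" for k
  \<comment> \<open>The cut lies at the equilibrium position of the last particle of the left
    half.\<close>
  define s where "s = a * real (N - 1)"
  have a: "a > 0" using p g2_pos by (simp add: a_def spacing_def)
  define IL where "IL = {i. i < N \<and> (i = 0 \<or> t (N - 1 - i) > s - a / 2 * real i)}"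
  define IR where "IR = {j. j < M \<and> (j = 0 \<or> t (N + j) < s + a / 2 * real j)}"
  have IL: "finite IL" "0 \<in> IL" and IR: "finite IR" "0 \<in> IR" using NM by (auto simp: IL_def IR_def)
  define i where "i = Max IL"
  define j where "j = Max IR"
  have i: "i \<in> IL" unfolding i_def using IL by (intro Max_in) auto
  have j: "j \<in> IR" unfolding j_def using IR by (intro Max_in) auto
  have iN: "i < N" and jM: "j < M" using i j by (auto simp: IL_def IR_def)
  define A0 where "A0 = N - 1 - i"
  define D0 where "D0 = N + j + 1"
  have ord: "A0 < N" "N \<le> D0" "A0 \<le> D0" "D0 \<le> N + M" using iN jM NM by (auto simp: A0_def D0_def)
  have goodL: "t k \<le> s - a / 2 * real (N - 1 - k)" if k: "k < A0" for k
  proof (rule ccontr)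
    assume "\<not> t k \<le> s - a / 2 * real (N - 1 - k)"
    then have "N - 1 - k \<in> IL" using k iN by (auto simp: IL_def A0_def)
    then have "N - 1 - k \<le> i" unfolding i_def using IL by (intro Max_ge)
    then show False using k by (simp add: A0_def)
  qed
  have goodR: "t k \<ge> s + a / 2 * real (k - N)" if k: "D0 \<le> k" "k < N + M" for k
  proof (rule ccontr)
    assume "\<not> t k \<ge> s + a / 2 * real (k - N)"
    then have "k - N \<in> IR" using k by (auto simp: IR_def D0_def)
    then have "k - N \<le> j" unfolding j_def using IR by (intro Max_ge)
    then show False using k by (simp add: D0_def)
  qed
  define Err where "Err = (\<Sum>k=A0..<D0. \<Sum>j<k. exp (t j - t k)) + (\<Sum>k=D0..<N + M. \<Sum>j<D0. exp (t j - t k))"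
  define b where "b = real (D0 - A0)"
  have b: "b = real i + real j + 2" using iN by (simp add: b_def A0_def D0_def)
  have "Err \<le> b\<^sup>2 + (\<Sum>k=A0..<D0. 2 * (\<bar>t k - s\<bar> / (a / 2) + geo)) + geo\<^sup>2"
    unfolding Err_def b_def geo_def a_def[symmetric]
    by (rule interaction_bound[where N=N]) (use a ord goodL goodR mono in \<open>auto simp: t_def\<close>)
  then have "2 * real p * Err \<le> 2 * real p * (b\<^sup>2 + (\<Sum>k=A0..<D0. 2 * (\<bar>t k - s\<bar> / (a / 2) + geo)) + geo\<^sup>2)"
    by (intro mult_left_mono) auto
  also have "\<dots> = 2 * real p * b\<^sup>2 + 2 * real p * geo\<^sup>2 + 4 * real p * geo * b + (\<Sum>k=A0..<D0. 8 * real p / a * \<bar>t k - s\<bar>)"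
    by (simp add: b_def algebra_simps sum.distrib sum_distrib_left flip: sum_divide_distrib)
  also have "(\<Sum>k=A0..<D0. 8 * real p / a * \<bar>t k - s\<bar>) \<le> (\<Sum>k=A0..<D0. (t k - s)\<^sup>2 / (4096 * g2) + absorb)"
  proof (rule sum_mono)
    fix k
    show "8 * real p / a * \<bar>t k - s\<bar> \<le> (t k - s)\<^sup>2 / (4096 * g2) + absorb"
      using mult_le_weighted_squares[OF g2_pos, of "8 * real p / a" "\<bar>t k - s\<bar>"]
      by (simp only: power2_abs absorb_def a_def)
  qed
  also have "\<dots> = (\<Sum>k=A0..<D0. (t k - s)\<^sup>2) / (4096 * g2) + absorb * b"
    by (simp add: sum.distrib b_def sum_divide_distrib mult.commute)
  finally have E1: "2 * real p * Err \<le> 2 * real p * b\<^sup>2 + 2 * real p * geo\<^sup>2 + 4 * real p * geo * b +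
      ((\<Sum>k=A0..<D0. (t k - s)\<^sup>2) / (4096 * g2) + absorb * b)" by simp
  have set_eq: "{A0..<D0} = {N - 1 - i..N - 1 + 1 + j}" using NM by (auto simp: A0_def D0_def)
  have "a\<^sup>2 / 128 * (real i ^ 3 + real j ^ 3) - a\<^sup>2 / 128 + (\<Sum>k=A0..<D0. (t k - s)\<^sup>2) / 2048
      \<le> (\<Sum>k=A0..<D0. (t k - a * real k)\<^sup>2)"
    unfolding set_eq s_def
  proof (rule cluster_energy)
    show "t x \<le> t z" if "x \<le> z" "z \<le> N - 1 + 1 + j" for x z
      using that NM jM mono[of x z] by (simp add: t_def)
    show "i = 0 \<or> a * real (N - 1) - a / 2 * real i < t (N - 1 - i)" using i unfolding IL_def s_def by blast
    have N1: "N - 1 + 1 + j = N + j" using NM by simp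
    show "j = 0 \<or> t (N - 1 + 1 + j) < a * real (N - 1) + a / 2 * real j"
      unfolding N1 using j unfolding IR_def s_def by blast
  qed (use a iN in auto)
  then have "(a\<^sup>2 / 128 * (real i ^ 3 + real j ^ 3) - a\<^sup>2 / 128 + (\<Sum>k=A0..<D0. (t k - s)\<^sup>2) / 2048) / g2
      \<le> (\<Sum>k=A0..<D0. (t k - a * real k)\<^sup>2) / g2" using g2_pos by (intro divide_right_mono) auto
  then have E2: "a\<^sup>2 / (128 * g2) * (real i ^ 3 + real j ^ 3) - a\<^sup>2 / (128 * g2) + 2 * ((\<Sum>k=A0..<D0. (t k - s)\<^sup>2) / (4096 * g2))
      \<le> (\<Sum>k=A0..<D0. (t k - a * real k)\<^sup>2) / g2"
    by (simp add: add_divide_distrib diff_divide_distrib)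
  have E3: "(\<Sum>k=A0..<D0. 2 * real (p * k) * t k - (t k)\<^sup>2 / g2) =
      g2 * (real p)\<^sup>2 * (\<Sum>k=A0..<D0. (real k)\<^sup>2) - (\<Sum>k=A0..<D0. (t k - a * real k)\<^sup>2) / g2"
  proof -
    have "2 * real (p * k) * t k - (t k)\<^sup>2 / g2 = g2 * (real p)\<^sup>2 * (real k)\<^sup>2 - (t k - a * real k)\<^sup>2 / g2" for k
      using complete_square[OF g2_pos, of "real p" "real k" "t k"] by (simp add: a_def spacing_def mult_ac)
    then show ?thesis by (simp add: sum_subtractf sum_distrib_left sum_divide_distrib)
  qed
  define K1 where "K1 = 2 * real p + 4 * real p * geo + absorb"
  have ab: "absorb \<ge> 0" using g2_pos by (simp add: absorb_def)
  have geo0: "geo \<ge> 0" using geo_ge_1[OF p] by simp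
  have "b \<ge> 1" using b by simp
  then have bb: "b \<le> b\<^sup>2" by (simp add: power2_eq_square)
  have "2 * real p * b\<^sup>2 + 4 * real p * geo * b + absorb * b \<le> 2 * real p * b\<^sup>2 + 4 * real p * geo * b\<^sup>2 + absorb * b\<^sup>2"
    using bb ab geo0 by (intro add_mono mult_left_mono order_refl) auto
  also have "\<dots> = K1 * b\<^sup>2" by (simp add: K1_def algebra_simps)
  also have "\<dots> \<le> K1 * (2 * (real i + 1)\<^sup>2 + 2 * (real j + 1)\<^sup>2)"
  proof (rule mult_left_mono)
    have "2 * (real i + 1)\<^sup>2 + 2 * (real j + 1)\<^sup>2 - b\<^sup>2 = (real i - real j)\<^sup>2"
      by (simp add: b power2_eq_square algebra_simps)
    moreover have "(real i - real j)\<^sup>2 \<ge> 0" by simp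
    ultimately show "b\<^sup>2 \<le> 2 * (real i + 1)\<^sup>2 + 2 * (real j + 1)\<^sup>2" by linarith
    show "0 \<le> K1" using ab geo0 by (simp add: K1_def)
  qed
  finally have E4: "2 * real p * b\<^sup>2 + 4 * real p * geo * b + absorb * b \<le> K1 * (2 * (real i + 1)\<^sup>2 + 2 * (real j + 1)\<^sup>2)" .
  define U where "U = a\<^sup>2 / (128 * g2)"
  define V where "V = 2 * real p * geo\<^sup>2"
  \<comment> \<open>\<open>E2\<close> supplies the re-centred energy \<open>T\<close> twice: one
    copy pays for the linear interaction in \<open>E1\<close>, the other one becomes the product of
    bumps.\<close>
  define T where "T = (\<Sum>k=A0..<D0. (t k - s)\<^sup>2) / (4096 * g2)"
  have U0: "U \<ge> 0" "V \<ge> 0" using g2_pos by (auto simp: U_def V_def)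
  have "(\<Sum>k=A0..<D0. 2 * real (p * k) * t k - (t k)\<^sup>2 / g2) + 2 * real p * Err \<le>
      g2 * (real p)\<^sup>2 * (\<Sum>k=A0..<D0. (real k)\<^sup>2)
      + ((U + V + 2 * K1 * (real i + 1)\<^sup>2 - U * real i ^ 3) + (U + V + 2 * K1 * (real j + 1)\<^sup>2 - U * real j ^ 3)) - T"
    using E1 E2 E4 U0 unfolding E3 U_def[symmetric] V_def[symmetric] T_def[symmetric] by (simp add: algebra_simps)
  then have "exp ((\<Sum>k=A0..<D0. 2 * real (p * k) * t k - (t k)\<^sup>2 / g2) + 2 * real p * Err) \<le>
      exp (g2 * (real p)\<^sup>2 * (\<Sum>k=A0..<D0. (real k)\<^sup>2)
      + ((U + V + 2 * K1 * (real i + 1)\<^sup>2 - U * real i ^ 3) + (U + V + 2 * K1 * (real j + 1)\<^sup>2 - U * real j ^ 3)) - T)"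
    by simp
  also have "\<dots> = exp (g2 * (real p)\<^sup>2 * (\<Sum>k=A0..<D0. (real k)\<^sup>2)) * (cost i * cost j) * exp (- T)"
    unfolding cost_def a_def[symmetric] U_def[symmetric] V_def[symmetric] K1_def[symmetric]
    by (simp add: mult_exp_exp)
  also have "exp (- T) = (\<Prod>k=A0..<D0. bump s (y k))"
    unfolding bump_def T_def t_def[symmetric]
    by (simp add: exp_sum[symmetric] sum_divide_distrib sum_negf)
  finally have fin: "exp ((\<Sum>k=A0..<D0. 2 * real (p * k) * t k - (t k)\<^sup>2 / g2) + 2 * real p * Err) \<le>
      exp (g2 * (real p)\<^sup>2 * (\<Sum>k=A0..<D0. (real k)\<^sup>2)) * (cost i * cost j) * (\<Prod>k=A0..<D0. bump s (y k))" .
  have "dens 0 {..<N + M} y \<le> dens 0 {..<A0} y * dens (real (p * D0)) {D0..<N + M} y *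
      exp ((\<Sum>k=A0..<D0. 2 * real (p * k) * t k - (t k)\<^sup>2 / g2) + 2 * real p * Err)"
    unfolding Err_def t_def by (rule dens_split_bound[OF ord(3,4)])
  also have "\<dots> \<le> dens 0 {..<A0} y * dens (real (p * D0)) {D0..<N + M} y *
      (exp (g2 * (real p)\<^sup>2 * (\<Sum>k=A0..<D0. (real k)\<^sup>2)) * (cost i * cost j) * (\<Prod>k=A0..<D0. bump s (y k)))"
    by (intro mult_left_mono fin mult_nonneg_nonneg dens_nonneg)
  finally have "dens 0 {..<N + M} y \<le> cost i * cost j * exp (g2 * (real p)\<^sup>2 * (\<Sum>k=A0..<D0. (real k)\<^sup>2)) *
      (dens 0 {..<A0} y * dens (real (p * D0)) {D0..<N + M} y * (\<Prod>k=A0..<D0. bump s (y k)))"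
    by (simp only: mult_ac)
  then show ?thesis using iN jM unfolding A0_def D0_def s_def a_def by blast
qed

end

section \<open>Integration over all labellings and the splitting inequality\<close>

context cylinder
begin

lemma bump_pos: "bump s z > 0"
  by (simp add: bump_def)

lemma measurable_bump: "bump s \<in> borel_measurable borel"
  unfolding bump_def[abs_def] height_def
  by (intro borel_measurable_continuous_onI continuous_intros) (use R l in auto)

text \<open>As 4096 = 64^2, \<open>bump\<close> is a Gaussian of width 64 l instead of l. Each
  removed particle thus costs 64 times its original integral, wherever the centre \<open>s\<close>
  lies.\<close>

lemma nn_integral_bump: "(\<integral>\<^sup>+z. ennreal (bump s z) \<partial>strip R) = ennreal (64 * area)"
proof -
  define L where "L = 64 * l"
  define c where "c = 2 * (R * s) / L\<^sup>2"
  define e where "e = exp (- ((R * s)\<^sup>2 / L\<^sup>2))"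
  have L: "L > 0" using l by (simp add: L_def)
  have f_eq: "bump s z = e * exp (c * Re z - (Re z)\<^sup>2 / L\<^sup>2)" for z
  proof -
    have "(height z - s)\<^sup>2 / (4096 * g2) = (Re z - R * s)\<^sup>2 / L\<^sup>2"
    proof -
      have "height z - s = (Re z - R * s) / R" using R by (simp add: height_def diff_divide_distrib)
      then show ?thesis using R l by (simp add: L_def power_divide power_mult_distrib)
    qed
    also have "\<dots> = (R * s)\<^sup>2 / L\<^sup>2 - (c * Re z - (Re z)\<^sup>2 / L\<^sup>2)"
      using L by (simp add: c_def power2_diff add_divide_distrib diff_divide_distrib algebra_simps)
    finally show ?thesis by (simp add: bump_def e_def mult_exp_exp)
  qed
  define f where "f x = complex_of_real (e * exp (c * x - x\<^sup>2 / L\<^sup>2))" for x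
  have f: "integrable lborel f"
    unfolding f_def[abs_def] by (intro integrable_of_real integrable_mult_right integral_gaussian L)
  have "(\<integral>x. f x \<partial>lborel) = complex_of_real (e * (L * sqrt pi * exp (c\<^sup>2 * L\<^sup>2 / 4)))"
    unfolding f_def[abs_def] by (simp only: integral_complex_of_real integral_mult_right_zero integral_gaussian(2)[OF L])
  also have "e * (L * sqrt pi * exp (c\<^sup>2 * L\<^sup>2 / 4)) = L * sqrt pi"
  proof -
    have "c\<^sup>2 * L\<^sup>2 / 4 = (R * s)\<^sup>2 / L\<^sup>2" using L by (simp add: c_def power_divide power_mult_distrib field_simps)
    then have "e * exp (c\<^sup>2 * L\<^sup>2 / 4) = 1" by (simp add: e_def mult_exp_exp)
    then show ?thesis by (simp add: mult.left_commute)
  qed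
  finally have int_f: "(\<integral>x. f x \<partial>lborel) = complex_of_real (L * sqrt pi)" .
  have one: "continuous_on UNIV (\<lambda>_::real. 1::complex)" by simp
  note P = integral_strip_product[OF f one, of R]
  have eq: "f (Re z) * 1 = complex_of_real (bump s z)" for z by (simp add: f_def f_eq)
  have "(\<integral>y. indicator {0..2 * pi * R} y *\<^sub>R (1::complex) \<partial>lborel) = complex_of_real (2 * pi * R)"
    using integral_full_period_cis[OF R, of 0] by simp
  then have "complex_of_real (\<integral>z. bump s z \<partial>strip R) = complex_of_real (L * sqrt pi) * complex_of_real (2 * pi * R)"
    using P(2) unfolding eq int_f by (simp only: integral_complex_of_real)
  then have "(\<integral>z. bump s z \<partial>strip R) = L * sqrt pi * (2 * pi * R)"
    by (simp only: of_real_mult[symmetric] of_real_eq_iff)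
  also have "\<dots> = 64 * area" by (simp add: L_def)
  finally have val: "(\<integral>z. bump s z \<partial>strip R) = 64 * area" .
  have "integrable (strip R) (\<lambda>z. Re (complex_of_real (bump s z)))"
    using P(1) unfolding eq by (rule integrable_Re)
  then have "integrable (strip R) (bump s)" by simp
  then have "(\<integral>\<^sup>+z. ennreal (bump s z) \<partial>strip R) = ennreal (\<integral>z. bump s z \<partial>strip R)"
    by (rule nn_integral_eq_integral) (simp add: less_imp_le[OF bump_pos])
  then show ?thesis by (simp only: val)
qed

lemma nn_integral_conf_mult:
  assumes IJ: "I \<inter> J = {}" "finite I" "finite J"
    and F: "F \<in> borel_measurable (conf I)" and G: "G \<in> borel_measurable (conf J)"
  shows "(\<integral>\<^sup>+z. F (restrict z I) * G (restrict z J) \<partial>conf (I \<union> J)) =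
    (\<integral>\<^sup>+z. F z \<partial>conf I) * (\<integral>\<^sup>+z. G z \<partial>conf J)"
proof -
  have mI: "(\<lambda>z. F (restrict z I)) \<in> borel_measurable (conf (I \<union> J))"
    by (rule measurable_compose[OF measurable_restrict_subset F]) auto
  have mJ: "(\<lambda>z. G (restrict z J)) \<in> borel_measurable (conf (I \<union> J))"
    by (rule measurable_compose[OF measurable_restrict_subset G]) auto
  have "(\<integral>\<^sup>+z. F (restrict z I) * G (restrict z J) \<partial>conf (I \<union> J)) =
      (\<integral>\<^sup>+x. (\<integral>\<^sup>+y. F (restrict (merge I J (x, y)) I) * G (restrict (merge I J (x, y)) J) \<partial>conf J) \<partial>conf I)"
    by (rule product_nn_integral_fold[OF IJ]) (intro borel_measurable_times_ennreal mI mJ)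
  also have "\<dots> = (\<integral>\<^sup>+x. (\<integral>\<^sup>+y. F x * G y \<partial>conf J) \<partial>conf I)"
  proof (intro nn_integral_cong)
    fix x y assume x: "x \<in> space (conf I)" and y: "y \<in> space (conf J)"
    have "restrict x I = x" "restrict y J = y"
      using x y by (auto simp: space_PiM PiE_iff extensional_restrict)
    then show "F (restrict (merge I J (x, y)) I) * G (restrict (merge I J (x, y)) J) = F x * G y"
      using IJ(1) by (simp add: restrict_merge)
  qed
  also have "\<dots> = (\<integral>\<^sup>+x. F x * (\<integral>\<^sup>+y. G y \<partial>conf J) \<partial>conf I)"
    by (simp add: nn_integral_cmult G)
  also have "\<dots> = (\<integral>\<^sup>+z. F z \<partial>conf I) * (\<integral>\<^sup>+z. G z \<partial>conf J)"
    by (simp add: nn_integral_multc F)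
  finally show ?thesis .
qed

text \<open>The three factors share no variable, so the two outer parts and the cluster integrate
  independently.\<close>

lemma nn_integral_split_configuration:
  assumes I: "finite I" "A \<subseteq> I" "D \<subseteq> I - A"
  shows "(\<integral>\<^sup>+z. ennreal (dens q A z * dens q' D z * (\<Prod>v\<in>I - A - D. bump s (z v))) \<partial>conf I) =
    ennreal (area ^ card A * gauss_sum g2 p q A * (area ^ card D * gauss_sum g2 p q' D) * (64 * area) ^ card (I - A - D))"
proof -
  let ?B = "I - A - D"
  have fin: "finite A" "finite D" "finite ?B"
    using finite_subset[OF I(2,1)] finite_subset[OF I(3) finite_Diff[OF I(1)]] I(1) by auto
  have mD: "(\<lambda>z. ennreal (dens q S z)) \<in> borel_measurable (conf S)" for q S
    using measurable_dens[of S S q] by simp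
  have mBv: "(\<lambda>z. bump s (z v)) \<in> borel_measurable (conf ?B)" if "v \<in> ?B" for v
    by (rule measurable_component[OF measurable_bump that])
  have mB: "(\<lambda>z. ennreal (\<Prod>v\<in>?B. bump s (z v))) \<in> borel_measurable (conf ?B)"
    by (intro measurable_compose[OF _ measurable_ennreal] borel_measurable_prod mBv)
  define G where "G z = ennreal (dens q' D (restrict z D)) * ennreal (\<Prod>v\<in>?B. bump s (restrict z ?B v))" for z
  have mG: "G \<in> borel_measurable (conf (D \<union> ?B))"
    unfolding G_def[abs_def]
    by (intro borel_measurable_times_ennreal measurable_compose[OF measurable_restrict_subset mD]
        measurable_compose[OF measurable_restrict_subset mB]) auto
  have un: "A \<union> (D \<union> ?B) = I" using I by auto
  have prodB: "(\<integral>\<^sup>+z. ennreal (\<Prod>v\<in>?B. bump s (z v)) \<partial>conf ?B) = ennreal ((64 * area) ^ card ?B)"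
  proof -
    have "(\<integral>\<^sup>+z. ennreal (\<Prod>v\<in>?B. bump s (z v)) \<partial>conf ?B) = (\<integral>\<^sup>+z. (\<Prod>v\<in>?B. ennreal (bump s (z v))) \<partial>conf ?B)"
      by (simp add: prod_ennreal less_imp_le[OF bump_pos])
    also have "\<dots> = (\<Prod>v\<in>?B. \<integral>\<^sup>+z. ennreal (bump s z) \<partial>strip R)"
      by (rule product_nn_integral_prod[OF fin(3)]) (intro measurable_compose[OF measurable_strip[OF measurable_bump] measurable_ennreal])
    also have "\<dots> = ennreal (64 * area) ^ card ?B" by (simp only: nn_integral_bump prod_constant)
    finally show ?thesis using R l by (simp add: ennreal_power)
  qed
  have "(\<integral>\<^sup>+z. ennreal (dens q A z * dens q' D z * (\<Prod>v\<in>?B. bump s (z v))) \<partial>conf I) =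
      (\<integral>\<^sup>+z. ennreal (dens q A (restrict z A)) * G (restrict z (D \<union> ?B)) \<partial>conf (A \<union> (D \<union> ?B)))"
    unfolding un
  proof (rule nn_integral_cong)
    fix z :: "nat \<Rightarrow> complex"
    have r: "restrict (restrict z (D \<union> ?B)) D = restrict z D" "restrict (restrict z (D \<union> ?B)) ?B = restrict z ?B"
      by (auto simp: restrict_def fun_eq_iff)
    have d: "dens q A (restrict z A) = dens q A z" "dens q' D (restrict z D) = dens q' D z"
      by (rule dens_cong; simp)+
    have b: "(\<Prod>v\<in>?B. bump s (restrict z ?B v)) = (\<Prod>v\<in>?B. bump s (z v))" by (intro prod.cong) auto
    have b0: "0 \<le> (\<Prod>v\<in>?B. bump s (z v))" by (intro prod_nonneg ballI less_imp_le[OF bump_pos])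
    show "ennreal (dens q A z * dens q' D z * (\<Prod>v\<in>?B. bump s (z v))) =
        ennreal (dens q A (restrict z A)) * G (restrict z (D \<union> ?B))"
      unfolding G_def r d b using b0 by (simp add: ennreal_mult dens_nonneg mult.assoc)
  qed
  also have "\<dots> = (\<integral>\<^sup>+z. ennreal (dens q A z) \<partial>conf A) * (\<integral>\<^sup>+z. G z \<partial>conf (D \<union> ?B))"
    by (rule nn_integral_conf_mult[OF _ _ _ mD mG]) (use fin I in auto)
  also have "(\<integral>\<^sup>+z. G z \<partial>conf (D \<union> ?B)) = (\<integral>\<^sup>+z. ennreal (dens q' D z) \<partial>conf D) * (\<integral>\<^sup>+z. ennreal (\<Prod>v\<in>?B. bump s (z v)) \<partial>conf ?B)"
    unfolding G_def by (rule nn_integral_conf_mult[OF _ _ _ mD mB]) (use fin in auto)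
  finally show ?thesis
    using R l unfolding nn_integral_dens[OF fin(1)] nn_integral_dens[OF fin(2)] prodB
    by (simp add: ennreal_mult gauss_sum_nonneg mult.assoc)
qed

lemma sorting_bijection:
  fixes f :: "nat \<Rightarrow> real"
  obtains e where "bij_betw e {..<n} {..<n}" "\<And>i j. i \<le> j \<Longrightarrow> j < n \<Longrightarrow> f (e i) \<le> f (e j)"
proof
  let ?xs = "sort_key f [0..<n]"
  show "bij_betw ((!) ?xs) {..<n} {..<n}" by (rule bij_betw_nth) auto
  fix i j assume ij: "i \<le> j" "j < n"
  have "sorted (map f ?xs)" by simp
  then have "map f ?xs ! i \<le> map f ?xs ! j" using ij by (intro sorted_nth_mono) auto
  then show "f (?xs ! i) \<le> f (?xs ! j)" using ij by simp
qed

text \<open>Choices of labels for the left and the right block. The cluster receives the remaining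
  labels; since all three weights are symmetric, no order within a group is recorded.\<close>

definition splits :: "nat \<Rightarrow> nat \<Rightarrow> nat \<Rightarrow> (nat set \<times> nat set) set" where
  "splits n a d = (SIGMA A:{A. A \<subseteq> {..<n} \<and> card A = a}. {D. D \<subseteq> {..<n} - A \<and> card D = d})"

lemma finite_splits: "finite (splits n a d)"
  unfolding splits_def by (intro finite_SigmaI) (auto intro: finite_subset[of _ "Pow {..<n}"])

lemma card_splits: "card (splits n a d) = (n choose a) * ((n - a) choose d)"
proof -
  have "card {D. D \<subseteq> {..<n} - A \<and> card D = d} = (n - a) choose d" if "A \<subseteq> {..<n}" "card A = a" for A
    using n_subsets[of "{..<n} - A" d] that finite_subset[OF that(1)] by (simp add: card_Diff_subset)
  then have "card (splits n a d) = (\<Sum>A | A \<subseteq> {..<n} \<and> card A = a. (n - a) choose d)"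
    unfolding splits_def by (subst card_SigmaI) (auto intro: finite_subset[of _ "Pow {..<n}"])
  then show ?thesis using n_subsets[of "{..<n}" a] by simp
qed

definition interface :: "nat \<Rightarrow> nat \<Rightarrow> nat \<Rightarrow> real" where
  "interface N i j = cost i * cost j * exp (g2 * (real p)\<^sup>2 * (\<Sum>k=N - 1 - i..<N + j + 1. (real k)\<^sup>2))"

lemma interface_pos: "interface N i j > 0"
  by (simp add: interface_def cost_def)

text \<open>Sorting by height selects i, j and the label sets as functions of \<open>z\<close>.
  Nonnegativity permits replacing this selection by the sum over all possibilities, which can be
  integrated term by term.\<close>

lemma dens_le_sum_splits:
  assumes p: "p \<ge> 1" and NM: "N \<ge> 1" "M \<ge> 1"
  shows "dens 0 {..<N + M} z \<le> (\<Sum>i<N. \<Sum>j<M. \<Sum>S\<in>splits (N + M) (N - 1 - i) (M - 1 - j).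
    interface N i j * (dens 0 (fst S) z * dens (real (p * (N + j + 1))) (snd S) z *
      (\<Prod>v\<in>{..<N + M} - fst S - snd S. bump (spacing * real (N - 1)) (z v))))"
proof -
  let ?n = "N + M"
  let ?W = "\<lambda>i j. splits ?n (N - 1 - i) (M - 1 - j)"
  let ?s = "spacing * real (N - 1)"
  let ?T = "\<lambda>i j S. interface N i j * (dens 0 (fst S) z * dens (real (p * (N + j + 1))) (snd S) z *
      (\<Prod>v\<in>{..<?n} - fst S - snd S. bump ?s (z v)))"
  have T0: "?T i j S \<ge> 0" for i j S
    by (intro mult_nonneg_nonneg dens_nonneg prod_nonneg ballI less_imp_le[OF bump_pos] less_imp_le[OF interface_pos])
  obtain e where e: "bij_betw e {..<?n} {..<?n}" "\<And>i j. i \<le> j \<Longrightarrow> j < ?n \<Longrightarrow> height (z (e i)) \<le> height (z (e j))"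
    using sorting_bijection[of ?n "\<lambda>v. height (z v)"] by blast
  obtain i j where ij: "i < N" "j < M" and le: "dens 0 {..<?n} (\<lambda>k. z (e k)) \<le> cost i * cost j *
    exp (g2 * (real p)\<^sup>2 * (\<Sum>k=N - 1 - i..<N + j + 1. (real k)\<^sup>2)) *
    (dens 0 {..<N - 1 - i} (\<lambda>k. z (e k)) * dens (real (p * (N + j + 1))) {N + j + 1..<?n} (\<lambda>k. z (e k)) *
    (\<Prod>k=N - 1 - i..<N + j + 1. bump ?s (z (e k))))"
    using dens_sorted_bound[OF p NM, of "\<lambda>k. z (e k)"] e(2) by blast
  define A where "A = e ` {..<N - 1 - i}"
  define D where "D = e ` {N + j + 1..<?n}"
  have inj: "inj_on e {..<?n}" and im: "e ` {..<?n} = {..<?n}" using e(1) by (auto simp: bij_betw_def)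
  have sub: "{..<N - 1 - i} \<subseteq> {..<?n}" "{N + j + 1..<?n} \<subseteq> {..<?n}" "{N - 1 - i..<N + j + 1} \<subseteq> {..<?n}"
    using ij by auto
  have bA: "bij_betw e {..<N - 1 - i} A" unfolding A_def using inj_on_subset[OF inj sub(1)] by (rule inj_on_imp_bij_betw)
  have bD: "bij_betw e {N + j + 1..<?n} D" unfolding D_def using inj_on_subset[OF inj sub(2)] by (rule inj_on_imp_bij_betw)
  have "{..<?n} - A - D = e ` ({..<?n} - {..<N - 1 - i} - {N + j + 1..<?n})"
  proof -
    have "e ` ({..<?n} - {..<N - 1 - i} - {N + j + 1..<?n}) = e ` ({..<?n} - {..<N - 1 - i}) - D"
      unfolding D_def by (rule inj_on_image_set_diff[OF inj _ sub(2)]) blast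
    also have "e ` ({..<?n} - {..<N - 1 - i}) = {..<?n} - A"
      using inj_on_image_set_diff[OF inj Diff_subset sub(1)] by (simp only: im A_def)
    finally show ?thesis by simp
  qed
  also have "{..<?n} - {..<N - 1 - i} - {N + j + 1..<?n} = {N - 1 - i..<N + j + 1}" using ij by auto
  finally have Beq: "{..<?n} - A - D = e ` {N - 1 - i..<N + j + 1}" .
  have bB: "bij_betw e {N - 1 - i..<N + j + 1} ({..<?n} - A - D)"
    unfolding Beq using inj_on_subset[OF inj sub(3)] by (rule inj_on_imp_bij_betw)
  have prodB: "(\<Prod>k=N - 1 - i..<N + j + 1. bump ?s (z (e k))) = (\<Prod>v\<in>{..<?n} - A - D. bump ?s (z v))"
    by (rule prod.reindex_bij_betw[OF bB])
  have disj: "A \<inter> D = {}"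
  proof -
    have "{..<N - 1 - i} \<inter> {N + j + 1..<?n} = {}" by auto
    then show ?thesis
      unfolding A_def D_def using inj_on_image_Int[OF inj sub(1,2)] by (simp only: image_empty)
  qed
  have mem: "(A, D) \<in> ?W i j"
    using bij_betw_same_card[OF bA] bij_betw_same_card[OF bD] disj im sub ij
    unfolding splits_def A_def D_def by auto
  have "dens 0 {..<?n} z = dens 0 {..<?n} (\<lambda>k. z (e k))" by (rule dens_reindex[OF e(1)])
  also have "\<dots> \<le> ?T i j (A, D)"
    using le unfolding interface_def dens_reindex[OF bA, symmetric] dens_reindex[OF bD, symmetric] prodB
    by (simp only: fst_conv snd_conv)
  also have "\<dots> \<le> (\<Sum>S\<in>?W i j. ?T i j S)"
    by (rule member_le_sum[where f="?T i j", OF mem]) (use T0 finite_splits in auto)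
  also have "\<dots> \<le> (\<Sum>j<M. \<Sum>S\<in>?W i j. ?T i j S)"
  proof (rule member_le_sum[where f="\<lambda>j. \<Sum>S\<in>?W i j. ?T i j S"])
    show "0 \<le> (\<Sum>S\<in>?W i k. ?T i k S)" for k by (intro sum_nonneg T0)
  qed (use ij in auto)
  also have "\<dots> \<le> (\<Sum>i<N. \<Sum>j<M. \<Sum>S\<in>?W i j. ?T i j S)"
  proof (rule member_le_sum[where f="\<lambda>i. \<Sum>j<M. \<Sum>S\<in>?W i j. ?T i j S"])
    show "0 \<le> (\<Sum>j<M. \<Sum>S\<in>?W k j. ?T k j S)" for k by (intro sum_nonneg T0)
  qed (use ij in auto)
  finally show ?thesis .
qed

lemma gauss_sum_splitting_bound:
  assumes p: "p \<ge> 1" and NM: "N \<ge> 1" "M \<ge> 1"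
  shows "area ^ (N + M) * gauss_sum g2 p 0 {..<N + M} \<le> (\<Sum>i<N. \<Sum>j<M.
    real (card (splits (N + M) (N - 1 - i) (M - 1 - j))) * (interface N i j *
    (area ^ (N - 1 - i) * gauss_sum g2 p 0 {..<N - 1 - i} *
     (area ^ (M - 1 - j) * gauss_sum g2 p (real (p * (N + j + 1))) {..<M - 1 - j}) * (64 * area) ^ (i + j + 2))))"
proof -
  let ?n = "N + M"
  let ?W = "\<lambda>i j. splits ?n (N - 1 - i) (M - 1 - j)"
  let ?s = "spacing * real (N - 1)"
  let ?U = "\<lambda>j S z. dens 0 (fst S) z * dens (real (p * (N + j + 1))) (snd S) z *
      (\<Prod>v\<in>{..<?n} - fst S - snd S. bump ?s (z v))"
  let ?V = "\<lambda>i j. area ^ (N - 1 - i) * gauss_sum g2 p 0 {..<N - 1 - i} *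
     (area ^ (M - 1 - j) * gauss_sum g2 p (real (p * (N + j + 1))) {..<M - 1 - j}) * (64 * area) ^ (i + j + 2)"
  have U0: "?U j S z \<ge> 0" for j S z
    by (intro mult_nonneg_nonneg dens_nonneg prod_nonneg ballI less_imp_le[OF bump_pos])
  have V0: "?V i j \<ge> 0" for i j using R l by (intro mult_nonneg_nonneg gauss_sum_nonneg zero_le_power) auto
  have I0: "interface N i j \<ge> 0" for i j using interface_pos less_imp_le by blast
  have meas: "(\<lambda>z. ennreal (?U j S z)) \<in> borel_measurable (conf {..<?n})"
    if S: "S \<in> splits ?n a d" for j S a d
  proof -
    have "dens 0 (fst S) \<in> borel_measurable (conf {..<?n})"
      "dens (real (p * (N + j + 1))) (snd S) \<in> borel_measurable (conf {..<?n})"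
      using S by (auto simp: splits_def intro!: measurable_dens)
    moreover have "(\<lambda>z. \<Prod>v\<in>{..<?n} - fst S - snd S. bump ?s (z v)) \<in> borel_measurable (conf {..<?n})"
      by (intro borel_measurable_prod measurable_component measurable_bump) auto
    ultimately show ?thesis
      by (intro measurable_compose[OF _ measurable_ennreal] borel_measurable_times)
  qed
  have val: "(\<integral>\<^sup>+z. ennreal (?U j S z) \<partial>conf {..<?n}) = ennreal (?V i j)"
    if S: "S \<in> ?W i j" and ij: "i < N" "j < M" for i j S
  proof -
    obtain A D where SAD: "S = (A, D)" by (cases S)
    have AD: "A \<subseteq> {..<?n}" "D \<subseteq> {..<?n} - A" "card A = N - 1 - i" "card D = M - 1 - j"
      using S by (auto simp: splits_def SAD)
    have fin: "finite A" "finite D" using AD finite_subset by blast+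
    have "card ({..<?n} - A - D) = ?n - (N - 1 - i) - (M - 1 - j)"
      using AD fin by (simp add: card_Diff_subset)
    also have "\<dots> = i + j + 2" using ij by simp
    finally have B: "card ({..<?n} - A - D) = i + j + 2" .
    show ?thesis
      using nn_integral_split_configuration[OF finite_lessThan AD(1,2), of 0 "real (p * (N + j + 1))" ?s]
        gauss_sum_card[OF fin(1), of 0] gauss_sum_card[OF fin(2), of "real (p * (N + j + 1))"]
      by (simp only: SAD fst_conv snd_conv AD(3,4) B)
  qed
  have "ennreal (area ^ ?n * gauss_sum g2 p 0 {..<?n}) = (\<integral>\<^sup>+z. ennreal (dens 0 {..<?n} z) \<partial>conf {..<?n})"
    using nn_integral_dens[of "{..<?n}" 0] by simp
  also have "\<dots> \<le> (\<integral>\<^sup>+z. (\<Sum>i<N. \<Sum>j<M. \<Sum>S\<in>?W i j.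
      ennreal (interface N i j) * ennreal (?U j S z)) \<partial>conf {..<?n})"
  proof (rule nn_integral_mono)
    fix z
    have "ennreal (dens 0 {..<?n} z) \<le> ennreal (\<Sum>i<N. \<Sum>j<M. \<Sum>S\<in>?W i j. interface N i j * ?U j S z)"
      by (rule ennreal_leI[OF dens_le_sum_splits[OF p NM]])
    also have "\<dots> = (\<Sum>i<N. \<Sum>j<M. \<Sum>S\<in>?W i j. ennreal (interface N i j) * ennreal (?U j S z))"
      by (simp only: sum_ennreal[symmetric] sum_nonneg mult_nonneg_nonneg U0 I0 ennreal_mult[OF I0 U0])
    finally show "ennreal (dens 0 {..<?n} z) \<le> (\<Sum>i<N. \<Sum>j<M. \<Sum>S\<in>?W i j.
      ennreal (interface N i j) * ennreal (?U j S z))" .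
  qed
  also have "\<dots> = (\<Sum>i<N. \<Sum>j<M. \<Sum>S\<in>?W i j.
      ennreal (interface N i j) * (\<integral>\<^sup>+z. ennreal (?U j S z) \<partial>conf {..<?n}))"
  proof -
    have m2: "(\<lambda>z. ennreal (interface N i j) * ennreal (?U j S z)) \<in> borel_measurable (conf {..<?n})"
      if "S \<in> splits ?n a d" for i j S a d
      by (intro borel_measurable_times_ennreal borel_measurable_const meas[OF that])
    show ?thesis
      by (subst nn_integral_sum, intro borel_measurable_sum m2, assumption,
          intro sum.cong refl, subst nn_integral_sum, intro borel_measurable_sum m2, assumption,
          intro sum.cong refl, subst nn_integral_sum, rule m2, assumption,
          intro sum.cong refl nn_integral_cmult meas, assumption)
  qed
  also have "\<dots> = (\<Sum>i<N. \<Sum>j<M. \<Sum>S\<in>?W i j. ennreal (interface N i j) * ennreal (?V i j))"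
    by (intro sum.cong refl arg_cong2[where f="(*)"] val) auto
  also have "\<dots> = (\<Sum>i<N. \<Sum>j<M. ennreal (real (card (?W i j)) * (interface N i j * ?V i j)))"
  proof (intro sum.cong refl)
    fix i j
    have "(\<Sum>S\<in>?W i j. ennreal (interface N i j) * ennreal (?V i j)) =
        of_nat (card (?W i j)) * ennreal (interface N i j * ?V i j)"
      by (simp only: sum_constant ennreal_mult[OF I0 V0])
    also have "\<dots> = ennreal (real (card (?W i j)) * (interface N i j * ?V i j))"
      by (simp only: ennreal_of_nat_eq_real_of_nat ennreal_mult[OF of_nat_0_le_iff mult_nonneg_nonneg[OF I0 V0]])
    finally show "(\<Sum>S\<in>?W i j. ennreal (interface N i j) * ennreal (?V i j)) =
        ennreal (real (card (?W i j)) * (interface N i j * ?V i j))" .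
  qed
  also have "\<dots> = ennreal (\<Sum>i<N. \<Sum>j<M. real (card (?W i j)) * (interface N i j * ?V i j))"
    by (simp only: sum_ennreal sum_nonneg mult_nonneg_nonneg of_nat_0_le_iff V0 I0)
  finally show ?thesis
    by (subst (asm) ennreal_le_iff) (intro sum_nonneg mult_nonneg_nonneg of_nat_0_le_iff V0 I0)
qed

text \<open>The energies of the left block, the interface and the tilted right block telescope to
  the energy of N + M particles. What remains is a function of i times a function of j, so the
  double sum factorises.\<close>

lemma normC_splitting:
  assumes p: "p \<ge> 1" and NM: "N \<ge> 1" "M \<ge> 1"
  shows "normC R l p (N + M) \<le> (\<Sum>i<N. (cost i * 64 ^ (i + 1)) * normC R l p (N - 1 - i)) *
    (\<Sum>j<M. (cost j * 64 ^ (j + 1)) * normC R l p (M - 1 - j))"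
proof -
  let ?n = "N + M"
  let ?u = "\<lambda>k. cost k * 64 ^ (k + 1)"
  define sq where "sq m = g2 * (real p)\<^sup>2 * (\<Sum>k<m. (real k)\<^sup>2)" for m :: nat
  let ?E = "area ^ ?n * exp (sq ?n) * fact ?n"
  define h where "h m = normalized_sum g2 p {..<m}" for m
  have h0: "h m \<ge> 0" for m by (simp add: h_def normalized_sum_def gauss_sum_nonneg)
  have gs0: "gauss_sum g2 p 0 {..<m} = h m * exp (sq m)" for m
    by (simp add: h_def normalized_sum_def sq_def mult_exp_exp)
  have gsq: "gauss_sum g2 p (real (p * D)) {..<m} = h m * exp (sq (D + m) - sq D)" for D m
    using gauss_sum_shift_normalized[of "{..<m}" g2 p D] by (simp add: h_def sq_def right_diff_distrib)
  have ar: "area > 0" using R l by simp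
  have "area ^ ?n * (h ?n * exp (sq ?n)) \<le> (\<Sum>i<N. \<Sum>j<M. ?E *
      (?u i * (h (N - 1 - i) / fact (N - 1 - i)) * (?u j * (h (M - 1 - j) / fact (M - 1 - j)))))"
    unfolding gs0[symmetric]
  proof (rule order_trans[OF gauss_sum_splitting_bound[OF p NM]], intro sum_mono)
    fix i j assume "i \<in> {..<N}" "j \<in> {..<M}"
    then have ij: "i < N" "j < M" by auto
    define a where "a = N - 1 - i"
    define d where "d = M - 1 - j"
    define D0 where "D0 = N + j + 1"
    have nad: "?n = a + d + (i + j + 2)" "D0 + d = ?n" "a \<le> D0" using ij by (auto simp: a_def d_def D0_def)
    have "(\<Sum>k<D0. (real k)\<^sup>2) = (\<Sum>k<a. (real k)\<^sup>2) + (\<Sum>k=a..<D0. (real k)\<^sup>2)"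
      using sum.atLeastLessThan_concat[of 0 a D0 "\<lambda>k. (real k)\<^sup>2"] nad(3) by (simp add: atLeast0LessThan)
    then have itf: "interface N i j = cost i * cost j * exp (sq D0 - sq a)"
      unfolding interface_def a_def[symmetric] D0_def[symmetric] by (simp add: sq_def algebra_simps)
    have ex: "exp (sq D0 - sq a) * exp (sq a) * exp (sq ?n - sq D0) = exp (sq ?n)" by (simp add: mult_exp_exp)
    have arn: "area ^ ?n = area ^ a * area ^ d * area ^ (i + j + 2)" by (simp only: nad(1) power_add)
    \<comment> \<open>A multinomial coefficient; dropping the factorial of the cluster size leaves
      exactly the factorials that turn \<open>normalized_sum\<close> into
      \<open>normC\<close>.\<close>
    have bin: "real (card (splits ?n a d)) \<le> fact ?n / (fact a * fact d)"
    proof -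
      have "real (card (splits ?n a d)) = real (?n choose a) * real ((?n - a) choose d)"
        by (simp only: card_splits of_nat_mult)
      also have "\<dots> = fact ?n / (fact a * fact (?n - a)) * (fact (?n - a) / (fact d * fact (?n - a - d)))"
        using nad(1) by (subst (1 2) binomial_fact) auto
      also have "\<dots> = fact ?n / (fact a * fact d) / fact (?n - a - d)" by simp
      also have "\<dots> \<le> fact ?n / (fact a * fact d) / 1"
        by (intro divide_left_mono) auto
      finally show ?thesis by simp
    qed
    have "real (card (splits ?n a d)) * (interface N i j * (area ^ a * gauss_sum g2 p 0 {..<a} *
        (area ^ d * gauss_sum g2 p (real (p * D0)) {..<d}) * (64 * area) ^ (i + j + 2)))
      = real (card (splits ?n a d)) * (area ^ ?n * exp (sq ?n) * (cost i * cost j * (64 ^ (i + 1) * 64 ^ (j + 1)) * (h a * h d)))"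
    proof -
      have "(64 * area) ^ (i + j + 2) = (64 ^ (i + 1) * 64 ^ (j + 1)) * area ^ (i + j + 2)"
      proof -
        have e: "i + j + 2 = (i + 1) + (j + 1)" by simp
        show ?thesis by (simp only: e power_mult_distrib power_add[of "64::real" "i + 1" "j + 1"])
      qed
      then show ?thesis unfolding itf gs0 gsq nad(2) arn ex[symmetric] by (simp only: mult_ac)
    qed
    also have "\<dots> \<le> fact ?n / (fact a * fact d) * (area ^ ?n * exp (sq ?n) * (cost i * cost j * (64 ^ (i + 1) * 64 ^ (j + 1)) * (h a * h d)))"
    proof (rule mult_right_mono[OF bin])
      show "0 \<le> area ^ ?n * exp (sq ?n) * (cost i * cost j * (64 ^ (i + 1) * 64 ^ (j + 1)) * (h a * h d))"
        using R l h0[of a] h0[of d] by (intro mult_nonneg_nonneg) (auto simp: cost_def)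
    qed
    also have "\<dots> = ?E *
      (?u i * (h a / fact a) * (?u j * (h d / fact d)))"
      by (simp add: field_simps)
    finally show "real (card (splits ?n (N - 1 - i) (M - 1 - j))) * (interface N i j *
      (area ^ (N - 1 - i) * gauss_sum g2 p 0 {..<N - 1 - i} *
       (area ^ (M - 1 - j) * gauss_sum g2 p (real (p * (N + j + 1))) {..<M - 1 - j}) * (64 * area) ^ (i + j + 2)))
      \<le> ?E *
      (?u i * (h (N - 1 - i) / fact (N - 1 - i)) * (?u j * (h (M - 1 - j) / fact (M - 1 - j))))"
      unfolding a_def d_def D0_def .
  qed
  also have "\<dots> = ?E * ((\<Sum>i<N. ?u i * (h (N - 1 - i) / fact (N - 1 - i))) *
      (\<Sum>j<M. ?u j * (h (M - 1 - j) / fact (M - 1 - j))))"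
    unfolding sum_product by (simp only: sum_distrib_left)
  finally have "?E * (h ?n / fact ?n) \<le> ?E *
      ((\<Sum>i<N. ?u i * (h (N - 1 - i) / fact (N - 1 - i))) *
      (\<Sum>j<M. ?u j * (h (M - 1 - j) / fact (M - 1 - j))))"
    by (simp add: mult_ac)
  moreover have "0 < ?E" using zero_less_power[OF ar, of ?n] by simp
  ultimately show ?thesis unfolding normC_eq h_def by (rule mult_left_le_imp_le)
qed

text \<open>The cubic term in the exponent, with positive coefficient because p >= 1 makes
  \<open>spacing\<close> positive, beats the quadratic term and any geometric factor. All x > 0 are
  covered because rho is only found afterwards.\<close>

lemma summable_cost:
  assumes p: "p \<ge> 1" and x: "x > 0"
  shows "summable (\<lambda>i. (cost i * 64 ^ (i + 1)) * x ^ i)"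
proof -
  define c where "c = spacing\<^sup>2 / (128 * g2)"
  define K where "K = c + 2 * real p * geo\<^sup>2"
  define K1 where "K1 = 2 * (2 * real p + 4 * real p * geo + absorb)"
  define X where "X = ln x"
  define Y where "Y = ln (64::real)"
  have c: "c > 0" using p g2_pos by (simp add: c_def spacing_def)
  have eq: "(cost i * 64 ^ (i + 1)) * x ^ i = exp (K + K1 * (real i + 1)\<^sup>2 - c * real i ^ 3 + (real i + 1) * Y + real i * X)" for i
  proof -
    have "64 ^ (i + 1) = exp ((real i + 1) * Y)"
      using exp_of_nat_mult[of "i + 1" Y] by (simp add: Y_def add.commute)
    moreover have "x ^ i = exp (real i * X)" using exp_of_nat_mult[of i X] x by (simp add: X_def)
    moreover have "cost i = exp (K + K1 * (real i + 1)\<^sup>2 - c * real i ^ 3)"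
      by (simp add: cost_def K_def K1_def c_def)
    ultimately show ?thesis by (simp only: exp_add)
  qed
  have "eventually (\<lambda>i::nat. K + K1 * (real i + 1)\<^sup>2 - c * real i ^ 3 + (real i + 1) * Y + real i * X \<le> - real i) at_top"
    using c by real_asymp
  then have ev: "eventually (\<lambda>i. norm ((cost i * 64 ^ (i + 1)) * x ^ i) \<le> exp (- 1) ^ i) at_top"
  proof eventually_elim
    case (elim i)
    have "exp (- 1 :: real) ^ i = exp (- real i)" using exp_of_nat_mult[of i "- 1 :: real"] by simp
    then show ?case unfolding eq using elim by simp
  qed
  show ?thesis by (rule summable_comparison_test_ev[OF ev summable_geometric]) simp
qed

theorem normC_limit:
  assumes p: "p \<ge> 1"
  shows "\<exists>L>0. (\<lambda>N. normC R l p N * rate R l p ^ N) \<longlonglongrightarrow> L"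
proof -
  obtain a where a: "\<And>k. a k \<ge> 0" "a 0 = 0" "a 1 > (0::real)"
    "\<And>n. n \<ge> 1 \<Longrightarrow> normC R l p n = (\<Sum>k\<le>n. a k * normC R l p (n - k))"
    using normC_renewal[OF p] by blast
  have C0: "normC R l p 0 = 1" by (simp add: normC_eq normalized_sum_def)
  have w0: "cost i * 64 ^ (i + 1) \<ge> 0" for i by (simp add: cost_def)
  show ?thesis unfolding rate_def
    by (rule renewal_splitting_limit[of "normC R l p" a "\<lambda>i. cost i * 64 ^ (i + 1)",
          OF C0 a w0 summable_cost[OF p] normC_splitting[OF p]])
qed

end

theorem theorem5p1:
  fixes R l :: real and p :: nat
  assumes "R > 0" and "l > 0" and "p \<ge> 1"
  shows "\<exists>L>0. (\<lambda>N. normC R l p N * rate R l p ^ N) \<longlonglongrightarrow> L"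
proof -
  interpret cylinder R l p using assms by unfold_locales
  show ?thesis by (rule normC_limit[OF assms(3)])
qed

end
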